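(* Let $\lambda=[\lambda_1,\dots,\lambda_p]$ be a partition of $n$, let $\sigma_1,\dots,\sigma_p$ be index maps for $\lambda$ satisfying properties (1), (2), (3) of the context, let $\mathcal C$ be the associated set of positive roots of $\mathfrak{sl}_n(\mathbb C)$, and let $I_{\mathcal C}$ be the ad-nilpotent ideal generated by $\mathcal C$. Then the associated orbit of $I_{\mathcal C}$ is $\mathcal O_\lambda$, and $I_{\mathcal C}$ is an ideal of minimal dimension for $\mathcal O_\lambda$, i.e. $\dim I_{\mathcal C}=m_{\mathcal O_\lambda}$.
   Context: Let $\mathfrak g=\mathfrak{sl}_n(\mathbb C)$, $G=SL_n(\mathbb C)$, $\mathfrak b$ the upper triangular matrices in $\mathfrak g$ (Lie algebra of the Borel subgroup $B$), $\mathfrak h$ the diagonal matrices, $\mathfrak n$ the strictly upper triangular matrices. The roots are $\Delta=\{e_i-e_j: i\ne j\}$, with positive roots $\Delta^+=\{e_i-e_j: i<j\}$; the root space of $e_i-e_j$ is spanned by $E_{ij}$. An ad-nilpotent ideal is an ideal of $\mathfrak b$ contained in $\mathfrak n$. The ideal generated by a set of positive roots is the smallest ad-nilpotent ideal containing the corresponding root spaces. For an ad-nilpotent ideal $I$, the image of $G\times_B I\to\mathfrak g$, $(g,x)\mapsto\mathrm{Ad}(g)x$, is the closure of a unique nilpotent orbit $\mathcal O_I$, the associated orbit of $I$. For a nilpotent orbit $\mathcal O$ and $X\in\mathcal O$, $m_{\mathcal O}=\dim B-\dim B_{G_X}$, where $G_X$ is the centralizer of $X$ in $G$ and $B_{G_X}$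 is a Borel subgroup (maximal connected solvable subgroup) of $G_X$; it is a known lower bound for the dimension of every ad-nilpotent ideal with associated orbit $\mathcal O$. $\mathcal O_\lambda$ is the nilpotent orbit with Jordan type $\lambda$. Index maps: for $1\le i\le p$, $\sigma_i:\mathrm{Dom}(\sigma_i)=\{\lambda_i-1,\lambda_i-3,\dots,1-\lambda_i\}\to[n]=\{1,\dots,n\}$, satisfying: (1) each $\sigma_i$ is one-to-one, and $\mathrm{Im}(\sigma_i)\cap\mathrm{Im}(\sigma_j)=\emptyset$ if $i\neq j$; (2) if $k<l$, $k\in\mathrm{Dom}(\sigma_i)$, $l\in\mathrm{Dom}(\sigma_j)$, then $\sigma_i(k)>\sigma_j(l)$; (3) for any $i,j$ and $k,l\in\mathrm{Dom}(\sigma_i)\cap\mathrm{Dom}(\sigma_j)$, if $\sigma_i(k)>\sigma_j(k)$ then $\sigma_i(l)>\sigma_j(l)$. Set $\mathcal C^+(\sigma_i)=\{e_{\sigma_i(\lambda_i-1)}-e_{\sigma_i(\lambda_i-3)},\ e_{\sigma_i(\lambda_i-3)}-e_{\sigma_i(\lambda_i-5)},\dots,e_{\sigma_i(3-\lambda_i)}-e_{\sigma_i(1-\lambda_i)}\}$ (empty if $\lambda_i=1$) and $\mathcal C=\bigcup_i\mathcal C^+(\sigma_i)$. *)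

theory Defs
  imports
    "Jordan_Normal_Form.Jordan_Normal_Form"
    "HOL-Algebra.Solvable_Groups"
    "HOL-Analysis.Analysis"
begin

no_notation Matrix.vec_index (infixl "$" 100)
no_notation Matrix.scalar_prod (infix "\<bullet>" 70)
hide_const (open) Matrix.mat Matrix.vec Matrix.row Determinant.det
hide_type (open) Matrix.vec

text \<open>
  The index set \<open>[n] = {1, \<dots>, n}\<close> is a finite linearly ordered type \<open>'n\<close> with \<open>CARD('n) = n\<close>, and
  \<open>n \<times> n\<close> matrices have type \<open>'n cmat\<close>, i.e. \<open>complex^'n^'n\<close>, with the Euclidean topology.
\<close>

type_synonym 'n cmat = "((complex, 'n) vec, 'n) vec"

section \<open>The Lie algebra of traceless matrices\<close>

definition cscale :: "complex \<Rightarrow> ('n::finite) cmat \<Rightarrow> 'n cmat" where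
  "cscale c A = (\<chi> i j. c * A $ i $ j)"

text \<open>Complex dimension of spaces of matrices is \<open>cmat.dim\<close>; the library's \<open>dim\<close> is the real one.\<close>

global_interpretation cmat: vector_space "cscale :: complex \<Rightarrow> ('n::finite) cmat \<Rightarrow> 'n cmat"
  by unfold_locales (simp_all add: cscale_def vec_eq_iff algebra_simps)

definition matpow :: "('n::finite) cmat \<Rightarrow> nat \<Rightarrow> 'n cmat" where
  "matpow A k = (((**) A) ^^ k) (mat 1)"

definition bracket :: "('n::finite) cmat \<Rightarrow> 'n cmat \<Rightarrow> 'n cmat" where
  "bracket A B = A ** B - B ** A"

definition sl_alg :: "('n::finite) cmat set" where
  "sl_alg = {A. trace A = 0}"

definition b_alg :: "('n::{finite,wellorder}) cmat set" where
  "b_alg = {A \<in> sl_alg. \<forall>i j. j < i \<longrightarrow> A $ i $ j = 0}"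

definition n_alg :: "('n::{finite,wellorder}) cmat set" where
  "n_alg = {A. \<forall>i j. j \<le> i \<longrightarrow> A $ i $ j = 0}"

definition ad_nilpotent_ideal :: "('n::{finite,wellorder}) cmat set \<Rightarrow> bool" where
  "ad_nilpotent_ideal I \<longleftrightarrow>
     cmat.subspace I \<and> I \<subseteq> n_alg \<and> (\<forall>A\<in>b_alg. \<forall>X\<in>I. bracket A X \<in> I)"

text \<open>The root \<open>e\<^sub>i - e\<^sub>j\<close> is represented by the pair \<open>(i, j)\<close>.\<close>

definition elem_mat :: "('n::finite) \<Rightarrow> 'n \<Rightarrow> 'n cmat" where
  "elem_mat i j = (\<chi> k l. if k = i \<and> l = j then 1 else 0)"

definition root_space :: "('n::finite) \<times> 'n \<Rightarrow> 'n cmat set" where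
  "root_space r = cmat.span {elem_mat (fst r) (snd r)}"

definition generated_ideal ::
    "(('n::{finite,wellorder}) \<times> 'n) set \<Rightarrow> 'n cmat set" where
  "generated_ideal S = \<Inter>{I. ad_nilpotent_ideal I \<and> (\<forall>r\<in>S. root_space r \<subseteq> I)}"

section \<open>The group \<open>SL\<^sub>n(\<complex>)\<close> and nilpotent orbits\<close>

definition SL :: "('n::finite) cmat monoid" where
  "SL = \<lparr>carrier = {A. det A = 1}, mult = (**), one = mat 1\<rparr>"

definition Ad :: "'n cmat \<Rightarrow> 'n cmat \<Rightarrow> ('n::finite) cmat" where
  "Ad g X = g ** X ** matrix_inv g"

definition nilpotent_orbit :: "('n::finite) cmat set \<Rightarrow> bool" where
  "nilpotent_orbit \<O> \<longleftrightarrow>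
     (\<exists>X\<in>sl_alg. (\<exists>k. matpow X k = 0) \<and> \<O> = (\<lambda>g. Ad g X) ` carrier SL)"

text \<open>
  The image of \<open>G \<times>\<^sub>B I \<rightarrow> \<gg>\<close> consists of all \<open>Ad g x\<close> with \<open>g \<in> G\<close> and \<open>x \<in> I\<close>. Nilpotent orbits are
  constructible, so their Zariski closure is the Euclidean closure used here.
\<close>

definition associated_orbit ::
    "('n::finite) cmat set \<Rightarrow> 'n cmat set \<Rightarrow> bool" where
  "associated_orbit I \<O> \<longleftrightarrow>
     nilpotent_orbit \<O> \<and> {Ad g x | g x. g \<in> carrier SL \<and> x \<in> I} = closure \<O>"

text \<open>The \<open>i\<close>-th smallest index corresponds to row and column number \<open>i\<close>.\<close>

definition to_mat :: "('n::{finite,wellorder}) cmat \<Rightarrow> complex Matrix.mat" where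
  "to_mat A = Matrix.mat CARD('n) CARD('n)
     (\<lambda>(i, j). A $ (sorted_list_of_set UNIV ! i) $ (sorted_list_of_set UNIV ! j))"

definition orbit_of_type :: "nat list \<Rightarrow> ('n::{finite,wellorder}) cmat set" where
  "orbit_of_type lam = {X. jordan_nf (to_mat X) (map (\<lambda>k. (k, 0)) lam)}"

section \<open>Borel subgroups and dimensions\<close>

text \<open>
  The dimension of a complex Lie subgroup \<open>H\<close> is the complex dimension of its Lie algebra
  (tangent space at the identity), \<open>{Y. \<forall>t\<in>\<real>. exp (t Y) \<in> H}\<close>.
\<close>

definition mexp :: "'n cmat \<Rightarrow> ('n::finite) cmat" where
  "mexp A = (\<Sum>k. (1 / fact k) *\<^sub>R matpow A k)"

definition lie_alg :: "('n::finite) cmat set \<Rightarrow> 'n cmat set" where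
  "lie_alg H = {Y. \<forall>t::real. mexp (t *\<^sub>R Y) \<in> H}"

definition group_dim :: "('n::finite) cmat set \<Rightarrow> nat" where
  "group_dim H = cmat.dim (lie_alg H)"

definition upper_borel :: "('n::{finite,wellorder}) cmat set" where
  "upper_borel = {A \<in> carrier SL. \<forall>i j. j < i \<longrightarrow> A $ i $ j = 0}"

definition centralizer :: "('n::finite) cmat \<Rightarrow> 'n cmat set" where
  "centralizer X = {g \<in> carrier SL. Ad g X = X}"

definition connected_solvable :: "('n::finite) cmat set \<Rightarrow> bool" where
  "connected_solvable H \<longleftrightarrow> subgroup H SL \<and> connected H \<and> solvable (SL\<lparr>carrier := H\<rparr>)"

text \<open>
  Closedness is automatic: the identity component of the Zariski closure of a connected solvable
  subgroup is again connected and solvable. Zariski and Euclidean connectedness agree for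
  Zariski-closed subgroups.
\<close>

definition borel_subgroup :: "('n::finite) cmat set \<Rightarrow> 'n cmat set \<Rightarrow> bool" where
  "borel_subgroup K H \<longleftrightarrow> H \<subseteq> K \<and> connected_solvable H \<and>
     (\<forall>H'. H' \<subseteq> K \<and> connected_solvable H' \<and> H \<subseteq> H' \<longrightarrow> H' = H)"

text \<open>
  \<open>m\<^sub>\<O> = dim B - dim B\<^bsub>G\<^sub>X\<^esub>\<close> does not depend on the choice of \<open>X\<close> in the orbit nor on that of the
  Borel subgroup of its centralizer; the definite description makes this part of the meaning.
\<close>

definition m_orbit :: "('n::{finite,wellorder}) cmat set \<Rightarrow> int" where
  "m_orbit \<O> = (THE m. \<forall>X\<in>\<O>. \<forall>H. borel_subgroup (centralizer X) H \<longrightarrow>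
     m = int (group_dim (upper_borel :: 'n cmat set)) - int (group_dim H))"

section \<open>Index maps\<close>

definition is_partition :: "nat list \<Rightarrow> nat \<Rightarrow> bool" where
  "is_partition lam n \<longleftrightarrow> sorted_wrt (\<ge>) lam \<and> (\<forall>k\<in>set lam. 0 < k) \<and> sum_list lam = n"

text \<open>\<open>{k - 1, k - 3, \<dots>, 1 - k}\<close>\<close>

definition dom_index :: "nat \<Rightarrow> int set" where
  "dom_index k = {int k - 1 - 2 * int j | j. j < k}"

text \<open>The parts \<open>\<lambda>\<^sub>1, \<dots>, \<lambda>\<^sub>p\<close> and the maps \<open>\<sigma>\<^sub>1, \<dots>, \<sigma>\<^sub>p\<close> are numbered from 0.\<close>

definition index_maps :: "nat list \<Rightarrow> (nat \<Rightarrow> int \<Rightarrow> 'n::{finite,wellorder}) \<Rightarrow> bool" where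
  "index_maps lam \<sigma> \<longleftrightarrow>
     (\<forall>i<length lam. inj_on (\<sigma> i) (dom_index (lam ! i))) \<and>
     (\<forall>i<length lam. \<forall>j<length lam. i \<noteq> j \<longrightarrow>
        \<sigma> i ` dom_index (lam ! i) \<inter> \<sigma> j ` dom_index (lam ! j) = {}) \<and>
     (\<forall>i<length lam. \<forall>j<length lam. \<forall>k\<in>dom_index (lam ! i). \<forall>l\<in>dom_index (lam ! j).
        k < l \<longrightarrow> \<sigma> i k > \<sigma> j l) \<and>
     (\<forall>i<length lam. \<forall>j<length lam.
        \<forall>k\<in>dom_index (lam ! i) \<inter> dom_index (lam ! j).
        \<forall>l\<in>dom_index (lam ! i) \<inter> dom_index (lam ! j).
        \<sigma> i k > \<sigma> j k \<longrightarrow> \<sigma> i l > \<sigma> j l)"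

definition root_set ::
    "nat list \<Rightarrow> (nat \<Rightarrow> int \<Rightarrow> 'n::{finite,wellorder}) \<Rightarrow> ('n \<times> 'n) set" where
  "root_set lam \<sigma> = (\<Union>i<length lam.
     {(\<sigma> i k, \<sigma> i (k - 2)) | k. k \<in> dom_index (lam ! i) \<and> k - 2 \<in> dom_index (lam ! i)})"

end

theory Submission
  imports Defs
begin

text \<open>
  Let \<open>X\<close> be the sum of the root vectors of \<open>\<C>\<close> and grade matrices by the weights \<open>k\<close> of the
  indices \<open>\<sigma>\<^sub>i(k)\<close>, so that \<open>X\<close> is a Jordan matrix of type \<open>\<lambda>\<close> of degree 2. By (2) positive degree
  implies upper triangular and the centraliser of \<open>X\<close> has no negative degrees. A telescoping
  argument along pairs of strings, with (3) used in degree 2, shows that the ideal \<open>I\<close> equals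
  \<open>[\<bb>, X]\<close>.

  Hence every line through \<open>X\<close> in \<open>I\<close> meets the orbit of \<open>X\<close> in a cofinite set, so \<open>I\<close> lies in the
  closure of the orbit; conversely \<open>G \<cdot> I\<close> is closed because \<open>G = U(n) B\<close> with \<open>U(n)\<close> compact.

  For the dimension, \<open>dim I = dim \<bb> - dim \<bb>\<^sub>X\<close>, where \<open>\<bb>\<^sub>X\<close> is the Lie algebra of the identity
  component \<open>B\<^sub>1\<close> of the upper triangular part of \<open>G\<^sub>X\<close>. The part of degree 0 of the centraliser is a
  product of matrix algebras, one for each part size, and by (3) an element of the centraliser is
  upper triangular iff its degree 0 part is. The Lie--Kolchin theorem for the degree 0 part therefore
  conjugates every connected solvable subgroup of \<open>G\<^sub>X\<close> into \<open>B\<^sub>1\<close>: the Borel subgroups of \<open>G\<^sub>X\<close> are the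
  conjugates of \<open>B\<^sub>1\<close>.
\<close>

section \<open>Complex matrices\<close>

text \<open>The weight of an index is its diagonal entry in the neutral element of an sl2 triple
  through \<open>X\<close>, and the strings take over the role of sl2 theory: a matrix unit is
  pushed along a pair of strings until one of them ends, and an entry of the centraliser is constant
  along such a pair. Which end is met first depends on the two lengths, hence the paired up and down
  lemmas. The delicate degree is 0, where weights no longer decide the order of the indices. Only
  (3) controls it, and it does so twice: it keeps the solutions \<open>Y\<close> of
  \<open>[Y, X] = V\<close> upper triangular, and it reduces triangularity in the centraliser to the
  highest weights. Borel subgroups are maximal among subgroups known only to be connected and
  solvable, so neither closedness nor a Lie algebra can be assumed for them. Lie-Kolchin therefore
  rests on continuity and the finiteness of spectra. It is applied to the multiplicity spaces of the
  Jordan blocks rather than to the whole space, because the conjugating matrix has to commute with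
  \<open>X\<close>. A Borel subgroup must also be exhibited, since otherwise every integer would
  satisfy the condition in \<open>m_orbit\<close>.\<close>

lemma matrix_inv_right_inverse: "invertible A \<Longrightarrow> A ** matrix_inv A = mat 1"
  and matrix_inv_left_inverse: "invertible A \<Longrightarrow> matrix_inv A ** A = mat 1"
  for A :: "('n::finite) cmat"
  unfolding matrix_inv_def invertible_def by (metis (mono_tags, lifting) someI_ex)+

lemma matrix_inv_unique: "A ** B = mat 1 \<Longrightarrow> matrix_inv A = B" for A :: "('n::finite) cmat"
  by (metis invertible_def matrix_inv_left_inverse matrix_left_right_inverse matrix_mul_assoc
      matrix_mul_lid matrix_mul_rid)

lemma invertible_matrix_inv: "invertible A \<Longrightarrow> invertible (matrix_inv A)" for A :: "('n::finite) cmat"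
  using invertible_def matrix_inv_left_inverse matrix_inv_right_inverse by blast

lemma matrix_inv_matrix_inv: "invertible A \<Longrightarrow> matrix_inv (matrix_inv A) = A" for A :: "('n::finite) cmat"
  by (simp add: matrix_inv_left_inverse matrix_inv_unique)

lemma matrix_mul_inv_cancel [simp]:
  fixes A B :: "('n::finite) cmat"
  assumes "invertible A"
  shows "A ** (matrix_inv A ** B) = B" "matrix_inv A ** (A ** B) = B"
    "B ** A ** matrix_inv A = B" "B ** matrix_inv A ** A = B"
  using assms by (metis matrix_mul_assoc matrix_mul_lid matrix_mul_rid matrix_inv_right_inverse
      matrix_inv_left_inverse)+

lemma matrix_inv_mult:
  "invertible A \<Longrightarrow> invertible B \<Longrightarrow> matrix_inv (A ** B) = matrix_inv B ** matrix_inv A"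
  for A B :: "('n::finite) cmat"
  by (rule matrix_inv_unique) (metis matrix_mul_assoc matrix_mul_inv_cancel(1) matrix_inv_right_inverse)

lemma matrix_mult_nth: "(A ** B) $ i $ j = (\<Sum>k\<in>UNIV. A $ i $ k * B $ k $ j)"
  by (simp add: matrix_matrix_mult_def)

lemma mat_1_nth: "(mat 1 :: ('n::finite) cmat) $ i $ j = (if i = j then 1 else 0)"
  by (simp add: mat_def)

section \<open>Linearity and continuity of matrix operations\<close>

lemma bounded_bilinear_matrix_mult:
  "bounded_bilinear ((**) :: ('n::finite) cmat \<Rightarrow> 'n cmat \<Rightarrow> 'n cmat)"
proof -
  have "bilinear ((**) :: 'n cmat \<Rightarrow> 'n cmat \<Rightarrow> 'n cmat)"
    unfolding bilinear_def
    by (auto intro!: linearI simp: vec_eq_iff matrix_mult_nth algebra_simps sum.distrib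
        scaleR_sum_right)
  then show ?thesis by (simp add: bilinear_conv_bounded_bilinear)
qed

lemmas matrix_mult_tendsto [tendsto_intros] = bounded_bilinear.tendsto[OF bounded_bilinear_matrix_mult]
lemmas matrix_mult_continuous_on [continuous_intros] =
  bounded_bilinear.continuous_on[OF bounded_bilinear_matrix_mult]
lemmas matrix_mult_sum_right = bounded_bilinear.sum_right[OF bounded_bilinear_matrix_mult]
lemmas matrix_mult_simps =
  bounded_bilinear.add_left[OF bounded_bilinear_matrix_mult]
  bounded_bilinear.add_right[OF bounded_bilinear_matrix_mult]
  bounded_bilinear.diff_left[OF bounded_bilinear_matrix_mult]
  bounded_bilinear.diff_right[OF bounded_bilinear_matrix_mult]
  bounded_bilinear.zero_left[OF bounded_bilinear_matrix_mult]
  bounded_bilinear.zero_right[OF bounded_bilinear_matrix_mult]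
  bounded_bilinear.minus_left[OF bounded_bilinear_matrix_mult]
  bounded_bilinear.minus_right[OF bounded_bilinear_matrix_mult]
  bounded_bilinear.scaleR_left[OF bounded_bilinear_matrix_mult]
  bounded_bilinear.scaleR_right[OF bounded_bilinear_matrix_mult]

lemma cscale_mult: "cscale c A ** B = cscale c (A ** B)" "A ** cscale c B = cscale c (A ** B)"
  by (simp_all add: cscale_def vec_eq_iff matrix_mult_nth sum_distrib_left algebra_simps)

lemma cscale_nth [simp]: "cscale c A $ i $ j = c * A $ i $ j"
  by (simp add: cscale_def)

lemma scaleR_eq_cscale: "r *\<^sub>R A = cscale (of_real r) A"
  by (simp add: vec_eq_iff scaleR_conv_of_real[symmetric])

lemma cmat_subspace_imp_subspace: "cmat.subspace S \<Longrightarrow> subspace S"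
  by (simp add: cmat.subspace_def subspace_def scaleR_eq_cscale)

lemma continuous_on_det [continuous_intros]:
  fixes f :: "'a::topological_space \<Rightarrow> ('n::finite) cmat"
  assumes "continuous_on S f"
  shows "continuous_on S (\<lambda>x. det (f x))"
  unfolding det_def using assms by (intro continuous_intros)

text \<open>Cramer's rule for a standard basis vector. Quotients of determinants make the continuity
  of inversion immediate.\<close>

lemma matrix_inv_nth:
  fixes A :: "('n::finite) cmat"
  assumes "det A \<noteq> 0"
  shows "matrix_inv A $ i $ j
    = det (\<chi> k l. if l = i then (axis j 1 :: complex^'n) $ k else A $ k $ l) / det A"
proof -
  have inv: "invertible A" using assms invertible_det_nz by blast
  have "A *v (matrix_inv A *v axis j 1) = axis j 1"
    by (simp add: matrix_vector_mul_assoc matrix_inv_right_inverse[OF inv])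
  from this[unfolded cramer[OF assms]]
  have "(matrix_inv A *v axis j 1) $ i
      = det (\<chi> k l. if l = i then (axis j 1 :: complex^'n) $ k else A $ k $ l) / det A"
    by simp
  moreover have "(matrix_inv A *v axis j 1) $ i = matrix_inv A $ i $ j"
    by (simp add: matrix_vector_mult_def axis_def if_distrib cong: if_cong)
  ultimately show ?thesis by simp
qed

lemma continuous_on_matrix_inv:
  fixes f :: "'a::topological_space \<Rightarrow> ('n::finite) cmat"
  assumes "continuous_on S f" "\<And>x. x \<in> S \<Longrightarrow> det (f x) \<noteq> 0"
  shows "continuous_on S (\<lambda>x. matrix_inv (f x))"
proof -
  have c: "continuous_on S (\<lambda>x. det (\<chi> k l. if l = i then (axis j 1 :: complex^'n) $ k else f x $ k $ l))" for i j
  proof -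
    have "continuous_on S (\<lambda>x. if l = i then (axis j 1 :: complex^'n) $ k else f x $ k $ l)" for k l
      using assms(1) by (cases "l = i") (auto intro: continuous_intros)
    then show ?thesis by (intro continuous_intros)
  qed
  have "continuous_on S (\<lambda>x. \<chi> i j. det (\<chi> k l. if l = i then (axis j 1 :: complex^'n) $ k else f x $ k $ l) / det (f x))"
    using assms(2) by (intro continuous_on_vec_lambda continuous_on_divide c continuous_on_det[OF assms(1)]) blast
  then show ?thesis
    by (rule continuous_on_eq) (simp add: vec_eq_iff matrix_inv_nth assms(2))
qed

text \<open>Left multiplication by \<open>A\<close> is an injective linear map of the
  finite-dimensional \<open>S\<close> into itself, hence onto, and so reaches \<open>mat 1\<close>.
  This gives closure under inverses for multiplicatively closed subspaces such as
  \<open>upper\<close> and \<open>alg\<close>.\<close>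

lemma matrix_inv_in_subspace:
  fixes S :: "('n::finite) cmat set"
  assumes S: "subspace S" "mat 1 \<in> S" and A: "invertible A"
    and mult: "\<And>B. B \<in> S \<Longrightarrow> A ** B \<in> S"
  shows "matrix_inv A \<in> S"
proof -
  let ?f = "\<lambda>B :: 'n cmat. A ** B"
  have lin: "linear ?f"
    by (rule bounded_linear.linear[OF bounded_bilinear.bounded_linear_right[OF bounded_bilinear_matrix_mult]])
  have inj: "inj_on ?f (span S)"
    by (rule inj_on_inverseI[of _ "(**) (matrix_inv A)"]) (simp add: A)
  have "?f ` S = S"
  proof (rule subspace_dim_equal)
    show "subspace (?f ` S)" by (rule linear_subspace_image[OF lin S(1)])
    show "dim S \<le> dim (?f ` S)" using dim_image_eq[OF lin inj] by simp
  qed (use S mult in auto)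
  then obtain B where "B \<in> S" "A ** B = mat 1" using S(2) by force
  then show ?thesis using matrix_inv_unique by blast
qed

section \<open>Conjugation by invertible matrices\<close>

lemma Ad_mult:
  "invertible g \<Longrightarrow> invertible h \<Longrightarrow> Ad (g ** h) A = Ad g (Ad h A)"
  by (simp add: Ad_def matrix_inv_mult matrix_mul_assoc)

lemma matrix_inv_one [simp]: "matrix_inv (mat 1 :: ('n::finite) cmat) = mat 1"
  by (simp add: matrix_inv_unique)

lemma Ad_one [simp]: "Ad (mat 1) A = A"
  by (simp add: Ad_def)

lemma Ad_Ad_inv: "invertible g \<Longrightarrow> Ad g (Ad (matrix_inv g) A) = A"
  and Ad_inv_Ad: "invertible g \<Longrightarrow> Ad (matrix_inv g) (Ad g A) = A"
  by (simp_all add: matrix_inv_left_inverse matrix_inv_right_inverse invertible_matrix_inv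
      flip: Ad_mult)

lemma Ad_eq_iff: "invertible g \<Longrightarrow> Ad g A = B \<longleftrightarrow> g ** A = B ** g"
  unfolding Ad_def by (metis matrix_mul_inv_cancel(3,4))

lemma Ad_matrix_mult: "invertible g \<Longrightarrow> Ad g (A ** B) = Ad g A ** Ad g B"
  by (simp add: Ad_def matrix_mul_assoc)

lemma Ad_mat_1: "invertible g \<Longrightarrow> Ad g (mat 1) = mat 1"
  by (simp add: Ad_def matrix_inv_right_inverse)

lemma det_Ad: "invertible g \<Longrightarrow> det (Ad g A) = det A"
  unfolding Ad_def det_mul
  by (metis det_I det_mul matrix_inv_left_inverse mult.commute mult.left_neutral mult.assoc)

lemma Ad_cscale_left:
  assumes "invertible g" "c \<noteq> 0" shows "invertible (cscale c g)" "Ad (cscale c g) A = Ad g A"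
proof -
  have e: "cscale c g ** cscale (1/c) (matrix_inv g) = mat 1"
    using assms by (simp add: cscale_mult matrix_inv_right_inverse)
  then have "matrix_inv (cscale c g) = cscale (1/c) (matrix_inv g)"
    by (rule matrix_inv_unique)
  moreover from e show "invertible (cscale c g)"
    using invertible_right_inverse by blast
  ultimately show "Ad (cscale c g) A = Ad g A"
    using assms(2) by (simp add: Ad_def cscale_mult)
qed

text \<open>Scalars act trivially by conjugation, so \<open>g\<close> may be multiplied by an n-th
  root of \<open>1 / det g\<close>. Orbits can then be described with arbitrary invertible matrices
  instead of \<open>SL\<close>.\<close>

lemma Ad_SL_ex:
  fixes g :: "('n::finite) cmat"
  assumes "invertible g"
  shows "\<exists>h\<in>carrier SL. Ad h = Ad g"
proof -
  have d: "det g \<noteq> 0" using assms invertible_det_nz by blast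
  define c where "c = exp (- Ln (det g) / of_nat CARD('n))"
  have c: "c \<noteq> 0" "c ^ CARD('n) * det g = 1"
  proof -
    have "c ^ CARD('n) = exp (- Ln (det g))"
      unfolding c_def exp_of_nat_mult[symmetric] by simp
    then show "c \<noteq> 0" "c ^ CARD('n) * det g = 1"
      using d by (simp_all add: c_def exp_minus)
  qed
  have "det (cscale c g) = c ^ CARD('n) * det g"
  proof -
    have "cscale c g = (\<chi> i. c *s g $ i)" by (simp add: vec_eq_iff)
    then show ?thesis by (simp add: det_rows_mul)
  qed
  then have "cscale c g \<in> carrier SL" using c by (simp add: SL_def)
  moreover have "Ad (cscale c g) = Ad g" using Ad_cscale_left[OF assms c(1)] by blast
  ultimately show ?thesis by blast
qed

lemma linear_Ad: "linear (Ad g)"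
  by (rule linearI) (simp_all add: Ad_def matrix_mult_simps)

lemma Ad_cscale: "Ad g (cscale c A) = cscale c (Ad g A)"
  by (simp add: Ad_def cscale_mult)

lemma Ad_add: "Ad g (A + B) = Ad g A + Ad g B"
  by (simp add: Ad_def matrix_mult_simps)

lemma continuous_on_Ad [continuous_intros]: "continuous_on S f \<Longrightarrow> continuous_on S (\<lambda>x. Ad g (f x))"
  unfolding Ad_def by (intro continuous_intros)

section \<open>The group \<open>SL\<close> and its subgroups\<close>

lemma carrier_SL: "A \<in> carrier SL \<longleftrightarrow> det A = 1" by (simp add: SL_def)

lemma SL_invertible: "A \<in> carrier SL \<Longrightarrow> invertible A"
  by (simp add: SL_def invertible_det_nz)

lemma SL_mult_one [simp]: "x \<otimes>\<^bsub>SL\<^esub> y = x ** y" "\<one>\<^bsub>SL\<^esub> = mat 1"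
  by (simp_all add: SL_def)

lemma det_matrix_inv_SL: "A \<in> carrier SL \<Longrightarrow> matrix_inv A \<in> carrier SL"
proof -
  assume A: "A \<in> carrier SL"
  have "det (A ** matrix_inv A) = 1"
    using A by (simp add: matrix_inv_right_inverse SL_invertible)
  then show ?thesis using A by (simp add: det_mul carrier_SL)
qed

lemma group_SL: "group (SL :: ('n::finite) cmat monoid)"
proof (rule groupI)
  fix x :: "'n cmat" assume x: "x \<in> carrier SL"
  show "\<exists>y\<in>carrier SL. y \<otimes>\<^bsub>SL\<^esub> x = \<one>\<^bsub>SL\<^esub>"
    using x det_matrix_inv_SL SL_invertible matrix_inv_left_inverse by (intro bexI[of _ "matrix_inv x"]) auto
qed (simp_all add: SL_def det_mul matrix_mul_assoc)

interpretation SL: group "SL :: ('n::finite) cmat monoid"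
  by (rule group_SL)

lemma m_inv_SL: "A \<in> carrier SL \<Longrightarrow> inv\<^bsub>SL\<^esub> A = matrix_inv A"
  by (rule SL.inv_equality) (simp_all add: det_matrix_inv_SL SL_invertible matrix_inv_left_inverse)

lemma subgroup_SL_iff:
  "subgroup H SL \<longleftrightarrow> H \<subseteq> carrier SL \<and> mat 1 \<in> H \<and> (\<forall>x\<in>H. \<forall>y\<in>H. x ** y \<in> H) \<and> (\<forall>x\<in>H. matrix_inv x \<in> H)"
proof -
  have "(\<forall>x\<in>H. inv\<^bsub>SL\<^esub> x \<in> H) \<longleftrightarrow> (\<forall>x\<in>H. matrix_inv x \<in> H)" if "H \<subseteq> carrier SL"
    using that m_inv_SL by (metis subsetD)
  then show ?thesis by (auto simp: subgroup_def)
qed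

lemma matpow_Suc: "matpow A (Suc k) = A ** matpow A k" and matpow_0: "matpow A 0 = mat 1"
  by (simp_all add: matpow_def)

section \<open>Eigenvectors and polynomial families of matrices\<close>

lemma det_polynomial:
  fixes M :: "complex \<Rightarrow> ('n::finite) cmat"
  assumes "\<And>i j. \<exists>p. \<forall>t. M t $ i $ j = poly p t"
  shows "\<exists>p. \<forall>t. det (M t) = poly p t"
proof -
  obtain P where P: "\<And>i j t. M t $ i $ j = poly (P i j) t" using assms by metis
  have "det (M t) = poly (\<Sum>p | p permutes UNIV. [:of_int (sign p):] * (\<Prod>i\<in>UNIV. P i (p i))) t" for t
    by (simp add: det_def poly_sum poly_prod P)
  then show ?thesis by blast
qed

text \<open>The determinant along a polynomial family is a polynomial in \<open>t\<close>, and a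
  single nonzero value excludes the zero polynomial. Both the finiteness of spectra and the cofinite
  meeting of lines with the orbit come from here.\<close>

lemma finite_singular_parameters:
  fixes M :: "complex \<Rightarrow> ('n::finite) cmat"
  assumes "\<And>i j. \<exists>p. \<forall>t. M t $ i $ j = poly p t" "det (M s) \<noteq> 0"
  shows "finite {t. det (M t) = 0}"
proof -
  obtain p where p: "\<And>t. det (M t) = poly p t" using det_polynomial[OF assms(1)] by blast
  then have "p \<noteq> 0" using assms(2) by force
  then show ?thesis using poly_roots_finite by (simp add: p)
qed

lemma singular_if_kernel:
  fixes A :: "('n::finite) cmat"
  assumes "A *v v = 0" "v \<noteq> 0" shows "det A = 0"
  using assms invertible_det_nz[of A] invertible_left_inverse[of A] matrix_left_invertible_ker[of A] by blast

lemma finite_eigenvalues: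
  fixes A :: "('n::finite) cmat"
  shows "finite {\<mu>. \<exists>v. v \<noteq> 0 \<and> A *v v = \<mu> *s v}" (is "finite ?E")
proof -
  \<comment> \<open>The family \<open>1 - t A\<close> is invertible at \<open>t = 0\<close>, which
    \<open>t - A\<close> need not be. Its singular parameters are the inverses of the nonzero
    eigenvalues, and 0 is added by hand.\<close>
  let ?M = "\<lambda>t. mat 1 - cscale t A"
  have p: "\<exists>p. \<forall>t. ?M t $ i $ j = poly p t" for i j
    by (rule exI[of _ "[:mat 1 $ i $ j, - A $ i $ j:]"]) simp
  have "finite {t. det (?M t) = 0}"
    using p by (rule finite_singular_parameters[where s = 0]) (simp add: cscale_def vec_eq_iff[symmetric] zero_vec_def[symmetric])
  moreover have "?E \<subseteq> insert 0 (inverse ` {t. det (?M t) = 0})"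
  proof
    fix \<mu> assume "\<mu> \<in> ?E"
    then obtain v where v: "v \<noteq> 0" "A *v v = \<mu> *s v" by blast
    have "\<mu> \<in> inverse ` {t. det (?M t) = 0}" if "\<mu> \<noteq> 0"
    proof
      have "cscale (inverse \<mu>) A *v v = inverse \<mu> *s (A *v v)"
        by (simp add: vec_eq_iff matrix_vector_mult_def sum_distrib_left mult.assoc)
      then have "?M (inverse \<mu>) *v v = 0"
        using that v(2) by (simp add: matrix_vector_mult_diff_rdistrib)
      then show "inverse \<mu> \<in> {t. det (?M t) = 0}" using singular_if_kernel[OF _ v(1)] by blast
    qed simp
    then show "\<mu> \<in> insert 0 (inverse ` {t. det (?M t) = 0})" by blast
  qed
  ultimately show ?thesis by (meson finite_imageI finite_insert finite_subset)
qed

lemma in_span_initial_segment: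
  fixes v :: "nat \<Rightarrow> 'a::real_vector"
  shows "x \<in> span (v ` {..<N}) \<Longrightarrow> \<exists>c. x = (\<Sum>i<N. c i *\<^sub>R v i)"
proof (induction N arbitrary: x)
  case (Suc N)
  then obtain k where "x - k *\<^sub>R v N \<in> span (v ` {..<N})"
    by (auto simp: lessThan_Suc span_breakdown_eq)
  then obtain c where "x - k *\<^sub>R v N = (\<Sum>i<N. c i *\<^sub>R v i)" using Suc.IH by blast
  then have "x = (\<Sum>i<Suc N. (c(N := k)) i *\<^sub>R v i)" by (simp add: algebra_simps)
  then show ?case by blast
qed simp

text \<open>The real dimension bounds the independent initial segments, hence the real coefficients.
  The relation serves as an annihilating polynomial for eigenvectors and later truncates a power
  series of matrices.\<close>

lemma sequence_dependent:
  fixes v :: "nat \<Rightarrow> 'a::euclidean_space"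
  obtains N c where "v N = (\<Sum>i<N. c i *\<^sub>R v i)"
proof -
  have "\<exists>N. v N \<in> span (v ` {..<N})"
  proof (rule ccontr)
    assume neg: "\<not> ?thesis"
    have "independent (v ` {..<N}) \<and> card (v ` {..<N}) = N" for N
    proof (induction N)
      case (Suc N)
      have N: "v N \<notin> span (v ` {..<N})" using neg by simp
      then have "v N \<notin> v ` {..<N}" using span_base[of "v N" "v ` {..<N}"] by argo
      then show ?case using Suc N by (simp add: lessThan_Suc independent_insert)
    qed (simp add: independent_empty)
    from this[of "Suc DIM('a)"] show False using independent_bound[of "v ` {..<Suc DIM('a)}"] by simp
  qed
  then obtain N where "v N \<in> span (v ` {..<N})" by blast
  from in_span_initial_segment[OF this] show ?thesis using that by blast
qed

text \<open>Among the nonzero polynomials \<open>p\<close> with \<open>p(A) v = 0\<close> take one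
  of least degree and split off a linear factor \<open>x - \<mu>\<close>: the cofactor applied to
  \<open>v\<close> is nonzero by minimality and killed by \<open>A - \<mu>\<close>. All vectors
  involved stay in \<open>U\<close>.\<close>

lemma eigenvector_in_subspace:
  fixes A :: "('n::finite) cmat"
  assumes U: "vec.subspace U" and inv: "\<And>u. u \<in> U \<Longrightarrow> A *v u \<in> U" and v: "v \<in> U" "v \<noteq> 0"
  shows "\<exists>u\<in>U. u \<noteq> 0 \<and> (\<exists>\<mu>. A *v u = \<mu> *s u)"
proof -
  define w where "w i = ((*v) A ^^ i) v" for i
  have wS: "w (Suc i) = A *v w i" "w 0 = v" for i by (simp_all add: w_def)
  have wU: "w i \<in> U" for i by (induction i) (simp_all add: wS v inv)
  \<comment> \<open>\<open>ev p\<close> stands for \<open>p(A) v\<close>; \<open>ev_pCons\<close> is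
    multiplication by the variable.\<close>
  define ev where "ev p = (\<Sum>i\<le>degree p. coeff p i *s w i)" for p
  have ev: "ev p = (\<Sum>i\<le>n. coeff p i *s w i)" if "degree p \<le> n" for p n
    unfolding ev_def using that
    by (intro sum.mono_neutral_left) (auto simp: coeff_eq_0 not_le)
  have ev_add: "ev (p + q) = ev p + ev q" for p q
  proof -
    let ?n = "max (degree p) (degree q)"
    show ?thesis
      by (subst (1 2 3) ev[of _ ?n]) (auto simp: degree_add_le vec.scale_left_distrib sum.distrib)
  qed
  have ev_smult: "ev (Polynomial.smult c p) = c *s ev p" for c p
    by (subst (1 2) ev[of _ "degree p"]) (auto simp: degree_smult_le vec.scale_sum_right)
  have ev_pCons: "ev (pCons 0 p) = A *v ev p" for p
  proof -
    have "ev (pCons 0 p) = (\<Sum>i\<le>Suc (degree p). coeff (pCons 0 p) i *s w i)"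
      by (rule ev) (simp add: degree_pCons_le)
    also have "\<dots> = (\<Sum>i\<le>degree p. coeff p i *s w (Suc i))"
      by (subst sum.atMost_Suc_shift) simp
    also have "\<dots> = A *v ev p"
      by (simp add: ev_def wS vec.linear_sum[OF matrix_vector_mul_linear_gen] vec.linear_scale[OF matrix_vector_mul_linear_gen])
    finally show ?thesis .
  qed
  have evU: "ev p \<in> U" for p
    unfolding ev_def by (intro vec.subspace_sum vec.subspace_scale U wU)
  obtain N c where N: "w N = (\<Sum>i<N. c i *\<^sub>R w i)" by (rule sequence_dependent)
  define p0 where "p0 = monom 1 N - (\<Sum>i<N. monom (complex_of_real (c i)) i)"
  have c0: "coeff p0 i = (if i = N then 1 else if i < N then - complex_of_real (c i) else 0)" for i
    by (auto simp: p0_def coeff_sum coeff_monom)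
  have "p0 \<noteq> 0" using c0[of N] by auto
  moreover have "ev p0 = 0"
  proof -
    have "ev p0 = (\<Sum>i\<le>N. coeff p0 i *s w i)"
      by (rule ev, rule degree_le) (simp add: c0)
    also have "\<dots> = w N + (\<Sum>i<N. - (c i *\<^sub>R w i))"
      unfolding lessThan_Suc_atMost[symmetric]
      by (simp add: c0 vec_eq_iff scaleR_conv_of_real[where 'a = complex] sum_component)
    also have "\<dots> = 0" using N by (simp add: sum_negf)
    finally show ?thesis .
  qed
  ultimately have p0: "p0 \<noteq> 0 \<and> ev p0 = 0" by (rule conjI)
  obtain p where p: "p \<noteq> 0" "ev p = 0" and min: "\<And>q. q \<noteq> 0 \<Longrightarrow> ev q = 0 \<Longrightarrow> degree p \<le> degree q"
    using ex_has_least_nat[of "\<lambda>p. p \<noteq> 0 \<and> ev p = 0" p0 degree, OF p0] by metis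
  have "degree p \<noteq> 0"
  proof
    assume "degree p = 0"
    then obtain a where a: "p = [:a:]" using degree_eq_zeroE by blast
    then have "ev p = a *s v" by (simp add: ev_def wS)
    then show False using p a v(2) by simp
  qed
  then obtain \<mu> where "poly p \<mu> = 0"
    using fundamental_theorem_of_algebra[of p] by (metis constant_degree)
  then obtain q where q: "p = [:-\<mu>, 1:] * q" by (metis dvdE poly_eq_0_iff_dvd)
  with p(1) have q0: "q \<noteq> 0" by auto
  have "degree p = Suc (degree q)" using q0 unfolding q by (subst degree_mult_eq) auto
  then have "ev q \<noteq> 0" using min[OF q0] by auto
  moreover have "A *v ev q = \<mu> *s ev q"
  proof -
    have "p = pCons 0 q + Polynomial.smult (-\<mu>) q" by (simp add: q)
    then have "A *v ev q + (-\<mu>) *s ev q = 0" using p(2) by (metis ev_add ev_smult ev_pCons)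
    then show ?thesis by (simp add: vec_eq_iff eq_neg_iff_add_eq_0)
  qed
  ultimately show ?thesis using evU by blast
qed

section \<open>The Lie--Kolchin theorem\<close>

lemma connected_via_point:
  assumes "\<And>x. x \<in> S \<Longrightarrow> \<exists>C. connected C \<and> a \<in> C \<and> x \<in> C \<and> C \<subseteq> S"
  shows "connected S"
proof -
  have "connected_component S a x" if "x \<in> S" for x
    using assms[OF that] unfolding connected_component_def by blast
  then show ?thesis
    unfolding connected_iff_connected_component
    by (meson connected_component_sym connected_component_trans)
qed

lemma connected_mult_image:
  fixes C D :: "('n::finite) cmat set"
  assumes "connected C" "connected D" shows "connected ((\<lambda>(a, b). a ** b) ` (C \<times> D))"
proof (rule connected_continuous_image)
  show "continuous_on (C \<times> D) (\<lambda>(a, b). a ** b)"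
    unfolding case_prod_beta by (intro continuous_intros)
qed (use assms connected_Times in auto)

lemma connected_inv_image:
  assumes "connected C" "C \<subseteq> carrier SL" shows "connected (matrix_inv ` C)"
  using assms by (intro connected_continuous_image continuous_on_matrix_inv continuous_on_id)
    (auto simp: SL_def)

text \<open>Each element lies in a connected subset of the generated group through 1:
  \<open>K\<close>, its image under inversion, or a product of two sets already found.\<close>

lemma connected_generate_SL:
  fixes K :: "('n::finite) cmat set"
  assumes K: "K \<subseteq> carrier SL" "connected K" "mat 1 \<in> K"
  shows "connected (generate SL K)"
proof (rule connected_via_point[where a = "mat 1"])
  fix x assume "x \<in> generate SL K"
  then show "\<exists>C. connected C \<and> mat 1 \<in> C \<and> x \<in> C \<and> C \<subseteq> generate SL K"
  proof induction
    case one
    then show ?case using K by (intro exI[of _ K]) (auto intro: generate.incl)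
  next
    case (incl h)
    then show ?case using K by (intro exI[of _ K]) (auto intro: generate.incl)
  next
    case (inv h)
    have "mat 1 \<in> matrix_inv ` K" using K(3) matrix_inv_one by (metis imageI)
    moreover have "inv\<^bsub>SL\<^esub> h \<in> matrix_inv ` K" using inv K by (auto simp: m_inv_SL subset_iff)
    moreover have "matrix_inv ` K \<subseteq> generate SL K"
      using K(1) generate.inv[of _ K SL] by (auto simp: m_inv_SL subset_iff)
    ultimately show ?case using connected_inv_image[OF K(2,1)] by blast
  next
    case (eng h1 h2)
    then obtain C D where C: "connected C" "mat 1 \<in> C" "h1 \<in> C" "C \<subseteq> generate SL K"
      and D: "connected D" "mat 1 \<in> D" "h2 \<in> D" "D \<subseteq> generate SL K" by blast
    let ?I = "(\<lambda>(a, b). a ** b) ` (C \<times> D)"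
    have "mat 1 ** mat 1 \<in> ?I" using C(2) D(2) by (force simp del: matrix_mul_lid matrix_mul_rid)
    moreover have "h1 \<otimes>\<^bsub>SL\<^esub> h2 \<in> ?I" using C(3) D(3) by force
    moreover have "?I \<subseteq> generate SL K"
      using C(4) D(4) generate.eng[of _ SL K] by auto
    ultimately show ?case using connected_mult_image[OF C(1) D(1)] by (intro exI[of _ ?I]) simp
  qed
qed

lemma derived_set_SL:
  assumes "H \<subseteq> carrier SL"
  shows "derived_set SL H = (\<lambda>(a, b). a ** b ** matrix_inv a ** matrix_inv b) ` (H \<times> H)"
  using assms by (force simp: m_inv_SL subset_iff image_iff)

lemma connected_derived_SL:
  fixes H :: "('n::finite) cmat set"
  assumes H: "subgroup H SL" "connected H"
  shows "connected (derived SL H)"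
  unfolding derived_def
proof (rule connected_generate_SL)
  have HS: "H \<subseteq> carrier SL" and H1: "mat 1 \<in> H" using H(1) by (auto simp: subgroup_SL_iff)
  show "derived_set SL H \<subseteq> carrier SL" by (rule SL.derived_set_in_carrier[OF HS])
  show "mat 1 \<in> derived_set SL H" unfolding derived_set_SL[OF HS]
    using H1 by (intro image_eqI[of _ _ "(mat 1, mat 1)"]) auto
  show "connected (derived_set SL H)" unfolding derived_set_SL[OF HS] case_prod_beta
    using HS H(2)
    by (intro connected_continuous_image continuous_intros continuous_on_matrix_inv connected_Times)
      (auto simp: SL_def)
qed

text \<open>Derived subgroups are the same whether formed in \<open>H\<close> or in
  \<open>SL\<close>. The exponent \<open>n\<close> is what the Lie-Kolchin induction runs
  on.\<close>

lemma solvable_SL_iff: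
  assumes H: "subgroup H SL"
  shows "solvable (SL\<lparr>carrier := H\<rparr>) \<longleftrightarrow> (\<exists>n. (derived SL ^^ n) H = {mat 1})"
proof -
  interpret HG: group "SL\<lparr>carrier := H\<rparr>" by (rule SL.subgroup_imp_group[OF H])
  have sub: "(derived SL ^^ n) H \<subseteq> H" for n
    by (induction n) (use SL.derived_incl[OF _ H] in auto)
  have "(derived (SL\<lparr>carrier := H\<rparr>) ^^ n) H = (derived SL ^^ n) H" for n
    by (induction n) (simp_all add: SL.derived_consistent[OF sub H])
  moreover have "subgroup H (SL\<lparr>carrier := H\<rparr>)" using HG.subgroup_self by simp
  ultimately show ?thesis
    using HG.solvable_imp_trivial_derived_seq[of H] HG.trivial_derived_seq_imp_solvable[of H]
    by (auto simp: solvable_def)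
qed

lemma finite_range_eq:
  fixes f :: "'a::topological_space \<Rightarrow> complex"
  assumes "connected S" "continuous_on S f" "finite F" "f ` S \<subseteq> F" "x \<in> S" "y \<in> S"
  shows "f x = f y"
  using continuous_finite_range_constant[OF assms(1,2) finite_subset[OF assms(4,3)]] assms(5,6)
  by (auto simp: constant_on_def)

lemma matrix_vector_scale: "A *v (c *s v) = c *s (A *v v)" for A :: "('n::finite) cmat"
  by (rule vec.linear_scale[OF matrix_vector_mul_linear_gen])

text \<open>Representations are taken on a subspace \<open>U\<close> only, so that the action on a quotient can be
  realised on a complement.\<close>

definition rep_on :: "('n::finite) cmat set \<Rightarrow> ('n cmat \<Rightarrow> 'n cmat) \<Rightarrow> (complex^'n) set \<Rightarrow> bool" where
  "rep_on H \<rho> U \<longleftrightarrow> vec.subspace U \<and> continuous_on H \<rho> \<and>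
     (\<forall>g\<in>H. \<forall>u\<in>U. \<rho> g *v u \<in> U) \<and> (\<forall>u\<in>U. \<rho> (mat 1) *v u = u) \<and>
     (\<forall>g\<in>H. \<forall>h\<in>H. \<forall>u\<in>U. \<rho> (g ** h) *v u = \<rho> g *v (\<rho> h *v u))"

text \<open>In a nonzero invariant subspace of least dimension, an eigenspace of any
  \<open>A\<close> is again invariant by commutation, hence everything; so each nonzero vector there
  is a common eigenvector.\<close>

lemma commuting_family_eigenvector:
  fixes \<R> :: "('n::finite) cmat set"
  assumes V: "vec.subspace V" "V \<noteq> {0}" and inv: "\<And>A v. A \<in> \<R> \<Longrightarrow> v \<in> V \<Longrightarrow> A *v v \<in> V"
    and comm: "\<And>A B v. A \<in> \<R> \<Longrightarrow> B \<in> \<R> \<Longrightarrow> v \<in> V \<Longrightarrow> A *v (B *v v) = B *v (A *v v)"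
  shows "\<exists>v\<in>V. v \<noteq> 0 \<and> (\<forall>A\<in>\<R>. \<exists>c. A *v v = c *s v)"
proof -
  let ?P = "\<lambda>W. vec.subspace W \<and> W \<noteq> {0} \<and> W \<subseteq> V \<and> (\<forall>A\<in>\<R>. \<forall>w\<in>W. A *v w \<in> W)"
  have "?P V" using V inv by blast
  then obtain W where W: "?P W" and min: "\<And>W'. ?P W' \<Longrightarrow> vec.dim W \<le> vec.dim W'"
    using ex_has_least_nat[of ?P V vec.dim] by blast
  have "0 \<in> W" using W vec.subspace_0 by blast
  with W obtain w where w: "w \<in> W" "w \<noteq> 0" by blast
  have "\<exists>c. A *v w = c *s w" if A: "A \<in> \<R>" for A
  proof -
    obtain u \<mu> where u: "u \<in> W" "u \<noteq> 0" "A *v u = \<mu> *s u"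
      using eigenvector_in_subspace[of W A w] W w A by blast
    let ?W' = "{x \<in> W. A *v x = \<mu> *s x}"
    have "vec.subspace ?W'"
      using W unfolding vec.subspace_def
      by (auto simp: matrix_vector_right_distrib matrix_vector_scale vec.scale_right_distrib mult.commute)
    moreover have "B *v x \<in> ?W'" if "B \<in> \<R>" "x \<in> ?W'" for B x
      using that W comm[OF A that(1)] by (auto simp: matrix_vector_scale subset_iff)
    ultimately have "?P ?W'" using W u by blast
    then have "?W' = W"
      using min[of ?W'] W by (intro vec.subspace_dim_equal) auto
    then show ?thesis using w(1) by blast
  qed
  then show ?thesis using w W by blast
qed

text \<open>Induction on the derived length. The derived subgroup has a common eigenvector, hence a
  character \<open>\<xi>\<close>, and \<open>V\<close> is its full weight space in \<open>U\<close>.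
  Two quantities vary continuously over the connected group \<open>H\<close> inside the finite
  spectrum of some \<open>\<rho> h\<close> and are therefore constant: this shows first that
  \<open>H\<close> preserves \<open>V\<close>, then that commutators act as 1 on \<open>V\<close>.
  Thus \<open>H\<close> acts on \<open>V\<close> by commuting matrices.\<close>

lemma Lie_Kolchin_eigenvector:
  fixes H :: "('n::finite) cmat set"
  assumes "subgroup H SL" "connected H" "(derived SL ^^ n) H = {mat 1}" "rep_on H \<rho> U" "U \<noteq> {0}"
  shows "\<exists>u\<in>U. u \<noteq> 0 \<and> (\<forall>g\<in>H. \<exists>c. \<rho> g *v u = c *s u)"
  using assms
proof (induction n arbitrary: H)
  case 0
  have "0 \<in> U" using 0 vec.subspace_0 by (auto simp: rep_on_def)
  then obtain u where u: "u \<in> U" "u \<noteq> 0" using 0 by blast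
  then have "\<forall>g\<in>H. \<rho> g *v u = 1 *s u" using 0 by (simp add: rep_on_def)
  then show ?case using u by blast
next
  case (Suc n)
  let ?D = "derived SL H"
  have HS: "H \<subseteq> carrier SL" and H1: "mat 1 \<in> H"
    and Hm: "\<And>x y. x \<in> H \<Longrightarrow> y \<in> H \<Longrightarrow> x ** y \<in> H" and Hi: "\<And>x. x \<in> H \<Longrightarrow> matrix_inv x \<in> H"
    using Suc.prems(1) by (auto simp: subgroup_SL_iff)
  have inv: "invertible x" if "x \<in> H" for x using that HS SL_invertible by blast
  have DH: "?D \<subseteq> H" by (rule SL.derived_incl[OF _ Suc.prems(1)]) simp
  have subD: "subgroup ?D SL" by (rule SL.derived_is_subgroup[OF HS])
  have comD: "a ** b ** matrix_inv a ** matrix_inv b \<in> ?D" if "a \<in> H" "b \<in> H" for a b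
    unfolding derived_def derived_set_SL[OF HS] using that by (force intro: generate.incl)
  have conjD: "matrix_inv g ** h ** g \<in> ?D" if "g \<in> H" "h \<in> ?D" for g h
  proof -
    have h: "h \<in> H" using that DH by blast
    have "matrix_inv g ** h ** g = (matrix_inv g ** h ** matrix_inv (matrix_inv g) ** matrix_inv h) ** h"
      using that inv h by (simp add: matrix_inv_matrix_inv)
    then show ?thesis using comD[OF Hi[OF that(1)] h] that(2) subD by (metis subgroup_SL_iff)
  qed
  have rep: "vec.subspace U" "continuous_on H \<rho>" "\<And>g u. g \<in> H \<Longrightarrow> u \<in> U \<Longrightarrow> \<rho> g *v u \<in> U"
    "\<And>u. u \<in> U \<Longrightarrow> \<rho> (mat 1) *v u = u"
    "\<And>g h u. g \<in> H \<Longrightarrow> h \<in> H \<Longrightarrow> u \<in> U \<Longrightarrow> \<rho> (g ** h) *v u = \<rho> g *v (\<rho> h *v u)"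
    using Suc.prems(4) by (auto simp: rep_on_def)
  have rho_nz: "\<rho> g *v u \<noteq> 0" if "g \<in> H" "u \<in> U" "u \<noteq> 0" for g u
    using rep(5)[OF Hi[OF that(1)] that(1,2)] rep(4)[OF that(2)] that inv matrix_inv_left_inverse
    by (metis matrix_vector_mult_0_right)
  have "rep_on ?D \<rho> U"
    using Suc.prems(4) DH continuous_on_subset[OF _ DH] unfolding rep_on_def by blast
  moreover have "(derived SL ^^ n) ?D = {mat 1}" using Suc.prems(3) by (simp add: funpow_swap1)
  ultimately obtain u0 where u0: "u0 \<in> U" "u0 \<noteq> 0" "\<forall>g\<in>?D. \<exists>c. \<rho> g *v u0 = c *s u0"
    using Suc.IH[OF subD connected_derived_SL[OF Suc.prems(1,2)]] Suc.prems(5) by blast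
  then obtain \<xi> where chi: "\<And>g. g \<in> ?D \<Longrightarrow> \<rho> g *v u0 = \<xi> g *s u0" by metis
  obtain k where k: "u0 $ k \<noteq> 0" using u0(2) by (auto simp: vec_eq_iff)
  have chi_eq: "\<xi> g = (\<rho> g *v u0) $ k / u0 $ k" if "g \<in> ?D" for g using chi[OF that] k by simp
  have chi_nz: "\<xi> g \<noteq> 0" if "g \<in> ?D" for g using rho_nz[of g u0] chi[OF that] u0 DH that by auto
  have chi_cont: "continuous_on S (\<lambda>g. \<xi> (f g))"
    if "continuous_on S f" "f ` S \<subseteq> ?D" for f :: "'n cmat \<Rightarrow> 'n cmat" and S
  proof -
    have "continuous_on S (\<lambda>g. \<rho> (f g))"
      using that DH by (intro continuous_on_compose2[OF rep(2) that(1)]) auto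
    then have "continuous_on S (\<lambda>g. (\<rho> (f g) *v u0) $ k / u0 $ k)"
      unfolding matrix_vector_mult_def using k by (intro continuous_intros)  auto
    then show ?thesis by (rule continuous_on_eq) (use that chi_eq in auto)
  qed
  have cinv: "continuous_on H matrix_inv"
    using HS by (intro continuous_on_matrix_inv continuous_on_id) (auto simp: SL_def)
  define V where "V = {v \<in> U. \<forall>h\<in>?D. \<rho> h *v v = \<xi> h *s v}"
  have V: "vec.subspace V" "u0 \<in> V" "V \<subseteq> U"
    using rep(1) u0 chi unfolding V_def vec.subspace_def
    by (auto simp: matrix_vector_right_distrib matrix_vector_scale vec.scale_right_distrib mult.commute)
  \<comment> \<open>\<open>\<xi> (g^-1 h g)\<close> is an eigenvalue of \<open>\<rho> h\<close>,
    with eigenvector \<open>\<rho> g u0\<close>, and depends continuously on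
    \<open>g\<close>.\<close>
  have chi_conj: "\<xi> (matrix_inv g ** h ** g) = \<xi> h" if "g \<in> H" "h \<in> ?D" for g h
  proof -
    let ?f = "\<lambda>g. \<xi> (matrix_inv g ** h ** g)"
    have "?f g = ?f (mat 1)"
    proof (rule finite_range_eq[OF Suc.prems(2), where f = ?f])
      show "continuous_on H ?f"
        by (rule chi_cont) (use conjD that(2) cinv in \<open>auto intro!: continuous_intros\<close>)
      show "finite {\<mu>. \<exists>v. v \<noteq> 0 \<and> \<rho> h *v v = \<mu> *s v}" by (rule finite_eigenvalues)
      show "?f ` H \<subseteq> {\<mu>. \<exists>v. v \<noteq> 0 \<and> \<rho> h *v v = \<mu> *s v}"
      proof (rule image_subsetI, rule CollectI)
        fix g assume g: "g \<in> H"
        have h: "h \<in> H" "matrix_inv g ** h ** g \<in> H" using that(2) DH g Hm Hi by auto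
        have "\<rho> h *v (\<rho> g *v u0) = \<rho> (h ** g) *v u0" using rep(5) h g u0 by simp
        also have "h ** g = g ** (matrix_inv g ** h ** g)" using inv[OF g] by (simp add: matrix_mul_assoc matrix_inv_right_inverse)
        also have "\<rho> \<dots> *v u0 = \<rho> g *v (\<rho> (matrix_inv g ** h ** g) *v u0)"
          using rep(5) h g u0 by simp
        also have "\<dots> = ?f g *s (\<rho> g *v u0)"
          using chi[OF conjD[OF g that(2)]] by (simp add: matrix_vector_scale)
        finally show "\<exists>v. v \<noteq> 0 \<and> \<rho> h *v v = ?f g *s v"
          using rho_nz[OF g u0(1,2)] by blast
      qed
    qed (use that H1 in auto)
    then show ?thesis by simp
  qed
  have VH: "\<rho> g *v v \<in> V" if g: "g \<in> H" and v: "v \<in> V" for g v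
  proof -
    have "\<rho> h *v (\<rho> g *v v) = \<xi> h *s (\<rho> g *v v)" if "h \<in> ?D" for h
    proof -
      have h: "h \<in> H" "matrix_inv g ** h ** g \<in> H" using that DH g Hm Hi by auto
      have vU: "v \<in> U" using v V by blast
      have "\<rho> h *v (\<rho> g *v v) = \<rho> (h ** g) *v v" using rep(5) h g vU by simp
      also have "h ** g = g ** (matrix_inv g ** h ** g)" using inv[OF g] by (simp add: matrix_mul_assoc matrix_inv_right_inverse)
      also have "\<rho> \<dots> *v v = \<rho> g *v (\<rho> (matrix_inv g ** h ** g) *v v)"
        using rep(5) h g vU by simp
      also have "\<dots> = \<xi> h *s (\<rho> g *v v)"
        using v conjD[OF g that] chi_conj[OF g that] by (simp add: V_def matrix_vector_scale)
      finally show ?thesis .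
    qed
    then show ?thesis using rep(3) g v V by (auto simp: V_def)
  qed
  have gh: "g ** h = (g ** h ** matrix_inv g ** matrix_inv h) ** (h ** g)" if "g \<in> H" "h \<in> H" for g h
    using that inv by (simp add: matrix_mul_assoc)
  have swap: "\<rho> g *v (\<rho> h *v v) = \<xi> (g ** h ** matrix_inv g ** matrix_inv h) *s (\<rho> h *v (\<rho> g *v v))"
    if "g \<in> H" "h \<in> H" "v \<in> V" for g h v
  proof -
    have vU: "v \<in> U" using that V by blast
    have "\<rho> g *v (\<rho> h *v v) = \<rho> (g ** h) *v v" using rep(5) that vU by simp
    also have "\<dots> = \<rho> (g ** h ** matrix_inv g ** matrix_inv h) *v (\<rho> h *v (\<rho> g *v v))"
      using rep(5) that vU DH comD Hm rep(3) by (subst gh[OF that(1,2)]) (simp add: subset_iff)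
    also have "\<dots> = \<xi> (g ** h ** matrix_inv g ** matrix_inv h) *s (\<rho> h *v (\<rho> g *v v))"
      using VH[OF that(2) VH[OF that(1,3)]] comD that by (simp add: V_def)
    finally show ?thesis .
  qed
  \<comment> \<open>If \<open>w\<close> is an eigenvector of \<open>\<rho> h\<close> in
    \<open>V\<close> for \<open>\<mu>\<close>, then \<open>\<rho> g w\<close> is one for
    \<open>\<mu>\<close> divided by the scalar of the commutator. The quotient is constant in
    \<open>g\<close>, and at \<open>g = 1\<close> the scalar is 1.\<close>
  have chi1: "\<xi> (g ** h ** matrix_inv g ** matrix_inv h) = 1" if g: "g \<in> H" and h: "h \<in> H" for g h
  proof -
    obtain w \<mu> where w: "w \<in> V" "w \<noteq> 0" "\<rho> h *v w = \<mu> *s w"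
      using eigenvector_in_subspace[OF V(1) VH[OF h] V(2) u0(2)] by blast
    have mu: "\<mu> \<noteq> 0" using rho_nz[OF h _ w(2)] w V by auto
    let ?c = "\<lambda>g. g ** h ** matrix_inv g ** matrix_inv h"
    let ?f = "\<lambda>g. \<mu> / \<xi> (?c g)"
    have cm1: "?c (mat 1) = mat 1" using inv[OF h] by (simp add: matrix_inv_right_inverse)
    have c1: "\<xi> (?c (mat 1)) = 1"
    proof -
      have "\<xi> (?c (mat 1)) *s u0 = 1 *s u0"
        using chi[OF comD[OF H1 h]] rep(4)[OF u0(1)] unfolding cm1 by simp
      then show ?thesis using u0(2) by (simp only: vec.scale_cancel_right)  simp
    qed
    have "?f g = ?f (mat 1)"
    proof (rule finite_range_eq[OF Suc.prems(2), where f = ?f])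
      have "continuous_on H (\<lambda>g. \<xi> (?c g))"
        by (rule chi_cont) (use comD h cinv in \<open>auto intro!: continuous_intros\<close>)
      then show "continuous_on H ?f" using chi_nz comD h by (intro continuous_intros) auto
      show "finite {\<mu>. \<exists>v. v \<noteq> 0 \<and> \<rho> h *v v = \<mu> *s v}" by (rule finite_eigenvalues)
      show "?f ` H \<subseteq> {\<mu>. \<exists>v. v \<noteq> 0 \<and> \<rho> h *v v = \<mu> *s v}"
      proof (rule image_subsetI, rule CollectI)
        fix g assume g: "g \<in> H"
        have "\<mu> *s (\<rho> g *v w) = \<xi> (?c g) *s (\<rho> h *v (\<rho> g *v w))"
          using swap[OF g h w(1)] w(3) by (simp add: matrix_vector_scale)
        then have "\<rho> h *v (\<rho> g *v w) = ?f g *s (\<rho> g *v w)"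
          using chi_nz[OF comD[OF g h]] by (simp add: vec_eq_iff field_simps)
        then show "\<exists>v. v \<noteq> 0 \<and> \<rho> h *v v = ?f g *s v"
          using rho_nz[OF g _ w(2)] w V by blast
      qed
    qed (use g H1 in auto)
    then show ?thesis using c1 mu chi_nz[OF comD[OF g h]] by (simp add: field_simps)
  qed
  have "\<exists>v\<in>V. v \<noteq> 0 \<and> (\<forall>A\<in>\<rho> ` H. \<exists>c. A *v v = c *s v)"
  proof (rule commuting_family_eigenvector[OF V(1)])
    show "V \<noteq> {0}" using V(2) u0(2) by blast
    show "A *v v \<in> V" if "A \<in> \<rho> ` H" "v \<in> V" for A v using that VH by blast
    show "A *v (B *v v) = B *v (A *v v)" if "A \<in> \<rho> ` H" "B \<in> \<rho> ` H" "v \<in> V" for A B v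
      using that swap chi1 by auto
  qed
  then show ?case using V(3) by blast
qed

section \<open>The ideal of a system of index maps\<close>

lemma dom_index_iff: "k \<in> dom_index m \<longleftrightarrow> - int m < k \<and> k < int m \<and> odd (k + int m)"
proof
  assume "k \<in> dom_index m"
  then show "- int m < k \<and> k < int m \<and> odd (k + int m)" by (auto simp: dom_index_def)
next
  assume k: "- int m < k \<and> k < int m \<and> odd (k + int m)"
  define j where "j = nat ((int m - 1 - k) div 2)"
  have "even (int m - 1 - k)" using k by auto
  moreover have "0 \<le> int m - 1 - k" using k by linarith
  ultimately have "k = int m - 1 - 2 * int j" unfolding j_def by simp
  moreover from this have "j < m" using k by linarith
  ultimately show "k \<in> dom_index m" unfolding dom_index_def by blast
qed

lemma finite_dom_index [simp]: "finite (dom_index m)"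
  and card_dom_index: "card (dom_index m) = m"
proof -
  have e: "dom_index m = (\<lambda>j. int m - 1 - 2 * int j) ` {..<m}" by (auto simp: dom_index_def)
  show "finite (dom_index m)" unfolding e by simp
  show "card (dom_index m) = m" unfolding e by (subst card_image) (auto simp: inj_on_def)
qed

text \<open>The associative algebra around \<open>b_alg\<close>; without the trace condition it is
  closed under products and contains \<open>mat 1\<close>.\<close>

definition upper :: "('n::{finite,wellorder}) cmat set" where
  "upper = {A. \<forall>i j. j < i \<longrightarrow> A $ i $ j = 0}"

lemma upper_mult: "A \<in> upper \<Longrightarrow> B \<in> upper \<Longrightarrow> A ** B \<in> upper"
  unfolding upper_def
proof (clarsimp simp: matrix_mult_nth)
  fix i j :: 'a assume *: "\<forall>i j. j < i \<longrightarrow> A $ i $ j = 0" "\<forall>i j. j < i \<longrightarrow> B $ i $ j = 0" "j < i"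
  show "(\<Sum>k\<in>UNIV. A $ i $ k * B $ k $ j) = 0"
  proof (rule sum.neutral, rule ballI)
    fix k show "A $ i $ k * B $ k $ j = 0"
      using * by (cases "k < i") (auto simp: not_less dest: less_le_trans)
  qed
qed

lemma subspace_upper: "cmat.subspace upper" "subspace upper"
proof -
  show "cmat.subspace upper" by (simp add: upper_def cmat.subspace_def)
  then show "subspace upper" by (rule cmat_subspace_imp_subspace)
qed

lemma one_upper [simp]: "mat 1 \<in> upper" by (simp add: upper_def mat_def)

lemma elem_mat_nth: "elem_mat i j $ a $ b = (if a = i \<and> b = j then 1 else 0)"
  by (simp add: elem_mat_def)

lemma matrix_eq_sum_elem_mat:
  fixes M :: "('n::finite) cmat"
  shows "M = (\<Sum>i\<in>UNIV. \<Sum>j\<in>UNIV. cscale (M $ i $ j) (elem_mat i j))"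
proof -
  have "(\<Sum>i\<in>UNIV. \<Sum>j\<in>UNIV. M $ i $ j * (if a = i \<and> b = j then 1 else 0)) = M $ a $ b" for a b
  proof -
    have "(\<Sum>j\<in>UNIV. M $ i $ j * (if a = i \<and> b = j then 1 else 0)) = (if a = i then M $ i $ b else 0)" for i
      by (cases "a = i") (simp_all add: if_distrib cong: if_cong)
    then show ?thesis by simp
  qed
  then show ?thesis by (simp add: vec_eq_iff elem_mat_nth)
qed

lemma bracket_linear:
  "bracket (A + B) M = bracket A M + bracket B M" "bracket (A - B) M = bracket A M - bracket B M"
  "bracket (cscale c A) M = cscale c (bracket A M)"
  by (simp_all add: bracket_def matrix_mult_simps cscale_mult)
    (simp add: vec_eq_iff algebra_simps)

section \<open>Coordinates of an index: string and weight\<close>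

locale index_system =
  fixes lam :: "nat list" and \<sigma> :: "nat \<Rightarrow> int \<Rightarrow> 'n::{finite,wellorder}"
  assumes partition: "is_partition lam CARD('n)" and index: "index_maps lam \<sigma>"
begin

definition D :: "nat \<Rightarrow> int \<Rightarrow> bool" where
  "D i k \<longleftrightarrow> i < length lam \<and> - int (lam ! i) < k \<and> k < int (lam ! i) \<and> odd (k + int (lam ! i))"

lemma D_iff: "D i k \<longleftrightarrow> i < length lam \<and> k \<in> dom_index (lam ! i)"
  by (simp add: D_def dom_index_iff)

lemmas index_maps_conjs = index[unfolded index_maps_def]

lemma \<sigma>_inj: assumes "D i k" "D j l" "\<sigma> i k = \<sigma> j l" shows "i = j \<and> k = l"
proof -
  have "i = j"
    using conjunct1[OF conjunct2[OF index_maps_conjs], rule_format, of i j] assms by (auto simp: D_iff)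
  moreover have "inj_on (\<sigma> i) (dom_index (lam ! i))"
    using conjunct1[OF index_maps_conjs] assms(1) by (simp add: D_iff)
  ultimately show ?thesis using inj_onD[of "\<sigma> i" _ k l] assms by (simp add: D_iff)
qed

lemma \<sigma>_less: "D i k \<Longrightarrow> D j l \<Longrightarrow> k < l \<Longrightarrow> \<sigma> j l < \<sigma> i k"
  using conjunct1[OF conjunct2[OF conjunct2[OF index_maps_conjs]], rule_format, of i j k l]
  by (simp add: D_iff)

lemma \<sigma>_le: "D i k \<Longrightarrow> D j k \<Longrightarrow> D i l \<Longrightarrow> D j l \<Longrightarrow> \<sigma> i k \<le> \<sigma> j k \<Longrightarrow> \<sigma> i l \<le> \<sigma> j l"
  using conjunct2[OF conjunct2[OF conjunct2[OF index_maps_conjs]], rule_format, of i j l k]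
  by (force simp: D_iff not_less[symmetric])

text \<open>The images are disjoint and their sizes add up to \<open>n\<close>, so they fill the
  index type: every index has a string and a weight.\<close>

lemma \<sigma>_surj: "\<exists>i k. D i k \<and> \<sigma> i k = a"
proof -
  let ?S = "\<Union>i\<in>{..<length lam}. \<sigma> i ` dom_index (lam ! i)"
  have "card ?S = (\<Sum>i<length lam. card (\<sigma> i ` dom_index (lam ! i)))"
    using conjunct1[OF conjunct2[OF index_maps_conjs]] by (intro card_UN_disjoint) auto
  also have "\<dots> = (\<Sum>i<length lam. lam ! i)"
    using conjunct1[OF index_maps_conjs] by (intro sum.cong) (auto simp: card_image card_dom_index)
  also have "\<dots> = CARD('n)"
    using partition by (simp add: is_partition_def sum_list_sum_nth atLeast0LessThan)
  finally have "?S = UNIV" by (intro card_subset_eq) auto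
  then have "a \<in> ?S" by simp
  then show ?thesis by (auto simp: D_iff)
qed

text \<open>The two coordinates of the inverse of \<open>\<sigma>\<close>;
  \<open>wt a - wt b\<close> is the degree of the matrix position \<open>(a, b)\<close>.\<close>

definition str :: "'n \<Rightarrow> nat" where "str a = (THE i. \<exists>k. D i k \<and> \<sigma> i k = a)"
definition wt :: "'n \<Rightarrow> int" where "wt a = (THE k. \<exists>i. D i k \<and> \<sigma> i k = a)"

lemma str_\<sigma> [simp]: "D i k \<Longrightarrow> str (\<sigma> i k) = i"
  unfolding str_def by (rule the_equality) (use \<sigma>_inj in \<open>blast+\<close>)

lemma wt_\<sigma> [simp]: "D i k \<Longrightarrow> wt (\<sigma> i k) = k"
  unfolding wt_def by (rule the_equality) (use \<sigma>_inj in \<open>blast+\<close>)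

lemma D_str_wt [simp]: "D (str a) (wt a)" and \<sigma>_str_wt [simp]: "\<sigma> (str a) (wt a) = a"
  using \<sigma>_surj[of a] by auto

lemma str_wt_eqD: "str a = str b \<Longrightarrow> wt a = wt b \<Longrightarrow> a = b"
  using \<sigma>_str_wt by metis

lemma less_if_wt: "wt b < wt a \<Longrightarrow> a < b"
  using \<sigma>_less[OF D_str_wt D_str_wt, of b a] by simp

lemma wt_mono: "a \<le> b \<Longrightarrow> wt b \<le> wt a"
  using less_if_wt[of a b] by force

definition X :: "'n cmat" where "X = (\<chi> a b. if (a, b) \<in> root_set lam \<sigma> then 1 else 0)"

lemma str_wt_iff: "str c = j \<and> wt c = k \<longleftrightarrow> D j k \<and> c = \<sigma> j k"
  by (metis D_str_wt \<sigma>_str_wt str_\<sigma> wt_\<sigma>)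

lemma root_set_iff: "(a, b) \<in> root_set lam \<sigma> \<longleftrightarrow> str a = str b \<and> wt b = wt a - 2"
proof
  assume ab: "str a = str b \<and> wt b = wt a - 2"
  have root: "(\<sigma> i k, \<sigma> i (k - 2)) \<in> root_set lam \<sigma>" if "D i k" "D i (k - 2)" for i k
    using that unfolding root_set_def D_iff by blast
  have s: "str b = str a" "wt b = wt a - 2" using ab by auto
  have "D (str a) (wt a - 2)" using D_str_wt[of b] unfolding s .
  moreover have "\<sigma> (str a) (wt a - 2) = b" using \<sigma>_str_wt[of b] unfolding s .
  ultimately show "(a, b) \<in> root_set lam \<sigma>" using root[of "str a" "wt a"] by simp
next
  assume "(a, b) \<in> root_set lam \<sigma>"
  then obtain i k where "a = \<sigma> i k" "b = \<sigma> i (k - 2)" "D i k" "D i (k - 2)"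
    unfolding root_set_def D_iff by blast
  then show "str a = str b \<and> wt b = wt a - 2" by simp
qed

section \<open>Multiplication by \<open>X\<close> and brackets of matrix units\<close>

lemma X_nth: "X $ a $ b = (if str a = str b \<and> wt b = wt a - 2 then 1 else 0)"
  by (simp add: X_def root_set_iff)

lemma mult_X_nth:
  assumes "D j l"
  shows "(M ** X) $ a $ \<sigma> j l = (if D j (l + 2) then M $ a $ \<sigma> j (l + 2) else 0)"
proof -
  have "(str c = j \<and> l = wt c - 2) \<longleftrightarrow> (D j (l + 2) \<and> c = \<sigma> j (l + 2))" for c
    using str_wt_iff[of c j "l + 2"] by auto
  then show ?thesis
    by (simp add: matrix_mult_nth X_nth assms if_distrib cong: if_cong)
qed

lemma X_mult_nth:
  assumes "D i k"
  shows "(X ** M) $ \<sigma> i k $ b = (if D i (k - 2) then M $ \<sigma> i (k - 2) $ b else 0)"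
proof -
  have "(i = str c \<and> wt c = k - 2) \<longleftrightarrow> (D i (k - 2) \<and> c = \<sigma> i (k - 2))" for c
    using str_wt_iff[of c i "k - 2"] by auto
  then show ?thesis
    by (simp add: matrix_mult_nth X_nth assms if_distrib if_distribR cong: if_cong)
qed

text \<open>Matrix units in string coordinates. The value 0 off the strings makes
  \<open>bracket_E\<close> valid at the ends without case distinctions.\<close>

definition E :: "nat \<Rightarrow> int \<Rightarrow> nat \<Rightarrow> int \<Rightarrow> 'n cmat" where
  "E i k j l = (if D i k \<and> D j l then elem_mat (\<sigma> i k) (\<sigma> j l) else 0)"

text \<open>\<open>X\<close> on the right lowers the weight of the column, on the left it raises
  that of the row. The two terms are neighbours, both positions differing by 2, so a chain of such
  brackets telescopes.\<close>

lemma bracket_E: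
  assumes "D i k" "D j l"
  shows "bracket (E i k j l) X = E i k j (l - 2) - E i (k + 2) j l"
proof -
  have "bracket (E i k j l) X $ a $ b = (E i k j (l - 2) - E i (k + 2) j l) $ a $ b" for a b
  proof -
    obtain i' k' j' l' where ab: "a = \<sigma> i' k'" "b = \<sigma> j' l'" "D i' k'" "D j' l'"
      using \<sigma>_str_wt D_str_wt by metis
    have *: "\<sigma> i k = \<sigma> i' k' \<longleftrightarrow> i = i' \<and> k = k'" if "D i k" "D i' k'" for i i' k k'
      using \<sigma>_inj that by blast
    show ?thesis
      unfolding bracket_def ab vector_minus_component mult_X_nth[OF ab(4)] X_mult_nth[OF ab(3)]
      using assms ab(3,4)
      by (auto simp: E_def elem_mat_nth * )
  qed
  then show ?thesis by (simp add: vec_eq_iff)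
qed

text \<open>The upper set of roots generated by \<open>\<C>\<close>: a positive root
  \<open>e_a - e_b\<close> dominates \<open>e_c - e_d\<close> exactly if \<open>a \<le> c\<close>
  and \<open>d \<le> b\<close>. Ad-nilpotent ideals correspond to such sets, so \<open>I\<close> is
  the explicit candidate for the generated ideal.\<close>

definition Up :: "('n \<times> 'n) set" where
  "Up = {(a, b). \<exists>(c, d)\<in>root_set lam \<sigma>. a \<le> c \<and> d \<le> b}"

definition I :: "'n cmat set" where "I = {M. \<forall>a b. M $ a $ b \<noteq> 0 \<longrightarrow> (a, b) \<in> Up}"

lemma Up_mono: "(a, b) \<in> Up \<Longrightarrow> a' \<le> a \<Longrightarrow> b \<le> b' \<Longrightarrow> (a', b') \<in> Up"
  unfolding Up_def
  by (clarsimp, rule bexI) (auto intro: order_trans)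

lemma Up_wt: "(a, b) \<in> Up \<Longrightarrow> wt b + 2 \<le> wt a"
proof -
  assume "(a, b) \<in> Up"
  then obtain c d where cd: "(c, d) \<in> root_set lam \<sigma>" "a \<le> c" "d \<le> b" by (auto simp: Up_def)
  then show ?thesis using wt_mono[OF cd(2)] wt_mono[OF cd(3)] by (simp add: root_set_iff)
qed

lemma Up_less: "(a, b) \<in> Up \<Longrightarrow> a < b"
  using Up_wt[of a b] less_if_wt[of b a] by simp

text \<open>In degree 2 the roots of \<open>Up\<close> only join comparable strings; this is where (3) enters.\<close>

lemma Up_degree_2:
  assumes ab: "(\<sigma> i k, \<sigma> j (k - 2)) \<in> Up" and D: "D i k" "D j (k - 2)" "D i m" "D j m"
  shows "\<sigma> i m \<le> \<sigma> j m"
proof -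
  obtain c d where cd: "(c, d) \<in> root_set lam \<sigma>" "\<sigma> i k \<le> c" "d \<le> \<sigma> j (k - 2)"
    using ab by (auto simp: Up_def)
  \<comment> \<open>Squeezed between \<open>wt c \<le> k\<close>, \<open>k - 2 \<le> wt d\<close>
    and \<open>wt d = wt c - 2\<close>.\<close>
  then have wt: "wt c = k" "wt d = k - 2" and s: "str c = str d"
    using wt_mono[OF cd(2)] wt_mono[OF cd(3)] D by (auto simp: root_set_iff)
  let ?s = "str c"
  have cs: "c = \<sigma> ?s k" "d = \<sigma> ?s (k - 2)" "D ?s k" "D ?s (k - 2)"
    using \<sigma>_str_wt[of c] \<sigma>_str_wt[of d] D_str_wt[of c] D_str_wt[of d] wt s by metis+
  have le: "\<sigma> i k \<le> \<sigma> ?s k" "\<sigma> ?s (k - 2) \<le> \<sigma> j (k - 2)" using cd cs by simp_all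
  \<comment> \<open>The common weight \<open>m\<close> gives both parts the same parity, so the
    longer of the two strings carries both \<open>k\<close> and \<open>k - 2\<close>, where it can
    be compared with the string of the root.\<close>
  have "D i (k - 2) \<or> D j k" using D by (auto simp: D_def)
  then show ?thesis
  proof
    assume D': "D i (k - 2)"
    have "\<sigma> i (k - 2) \<le> \<sigma> ?s (k - 2)" using \<sigma>_le[OF D(1) cs(3) D' cs(4) le(1)] .
    then show ?thesis using \<sigma>_le[OF D' D(2) D(3,4)] le by (meson order.trans)
  next
    assume D': "D j k"
    have "\<sigma> ?s k \<le> \<sigma> j k" using \<sigma>_le[OF cs(4) D(2) cs(3) D' le(2)] .
    then show ?thesis using \<sigma>_le[OF D(1) D' D(3,4)] le by (meson order.trans)
  qed
qed

definition Z :: "'n cmat set" where "Z = (\<lambda>Y. bracket Y X) ` upper"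

lemma subspace_Z: "cmat.subspace Z"
proof -
  have "bracket 0 X = 0" by (simp add: bracket_def matrix_mult_simps)
  then show ?thesis
    using subspace_upper(1) unfolding Z_def cmat.subspace_def
    by (auto simp: image_iff) (metis bracket_linear)+
qed

lemma E_upper:
  assumes "l \<le> k" "l = k \<Longrightarrow> D i k \<Longrightarrow> D j k \<Longrightarrow> \<sigma> i k \<le> \<sigma> j k"
  shows "E i k j l \<in> upper"
proof -
  have "\<sigma> i k \<le> \<sigma> j l" if "D i k" "D j l"
    using assms that \<sigma>_less[OF that(2,1)] by (cases "l = k") auto
  then show ?thesis by (auto simp: upper_def E_def elem_mat_nth)
qed

text \<open>A matrix unit of degree at least 2 is a bracket with \<open>X\<close> up to its shift along the pair of
  strings. Shifting towards the end of the pair that is reached first, the sum telescopes.\<close>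

lemma E_in_Z_up:
  assumes "int (lam ! i) - k + 2 \<le> int (lam ! j) - l" "D i k" "D j l"
    and "l + 2 \<le> k" "\<And>m. l + 2 = k \<Longrightarrow> D i m \<Longrightarrow> D j m \<Longrightarrow> \<sigma> i m \<le> \<sigma> j m"
  shows "E i k j l \<in> Z"
  using assms
proof (induction "nat (int (lam ! i) - k)" arbitrary: k l rule: less_induct)
  case less
  \<comment> \<open>By the first hypothesis string \<open>j\<close> has at least one more step above
    \<open>l\<close> than string \<open>i\<close> has above \<open>k\<close>; shifting upwards, the
    row leaves its string first and the remainder is 0.\<close>
  have D: "D j (l + 2)" using less.prems by (simp add: D_def)
  have "bracket (E i k j (l + 2)) X = E i k j l - E i (k + 2) j (l + 2)"
    using bracket_E[OF less.prems(2) D] by simp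
  moreover have "E i k j (l + 2) \<in> upper" using less.prems by (intro E_upper) auto
  then have "bracket (E i k j (l + 2)) X \<in> Z" by (auto simp: Z_def)
  moreover have "E i (k + 2) j (l + 2) \<in> Z"
  proof (cases "D i (k + 2)")
    case True
    show ?thesis by (rule less.hyps) (use less.prems True D in \<open>auto simp: D_def\<close>)
  qed (use cmat.subspace_0[OF subspace_Z] in \<open>simp add: E_def\<close>)
  ultimately show ?case
    using cmat.subspace_add[OF subspace_Z, of "E i k j l - E i (k + 2) j (l + 2)" "E i (k + 2) j (l + 2)"] by simp
qed

text \<open>The mirror image: the column has fewer steps left below it than the row, so shifting
  downwards makes the column leave first.\<close>

lemma E_in_Z_down:
  assumes "int (lam ! j) + l + 2 \<le> int (lam ! i) + k" "D i k" "D j l"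
    and "l + 2 \<le> k" "\<And>m. l + 2 = k \<Longrightarrow> D i m \<Longrightarrow> D j m \<Longrightarrow> \<sigma> i m \<le> \<sigma> j m"
  shows "E i k j l \<in> Z"
  using assms
proof (induction "nat (int (lam ! j) + l)" arbitrary: k l rule: less_induct)
  case less
  have D: "D i (k - 2)" using less.prems by (simp add: D_def)
  have "bracket (E i (k - 2) j l) X = E i (k - 2) j (l - 2) - E i k j l"
    using bracket_E[OF D less.prems(3)] by simp
  moreover have "E i (k - 2) j l \<in> upper" using less.prems by (intro E_upper) auto
  then have "bracket (E i (k - 2) j l) X \<in> Z" by (auto simp: Z_def)
  moreover have "E i (k - 2) j (l - 2) \<in> Z"
  proof (cases "D j (l - 2)")
    case True
    show ?thesis by (rule less.hyps) (use less.prems True D in \<open>auto simp: D_def\<close>)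
  qed (use cmat.subspace_0[OF subspace_Z] in \<open>simp add: E_def\<close>)
  ultimately show ?case
    using cmat.subspace_diff[OF subspace_Z, of "E i (k - 2) j (l - 2)" "E i (k - 2) j (l - 2) - E i k j l"] by simp
qed

text \<open>As the degree is at least 2, the row has fewer steps to the upper end if string
  \<open>i\<close> is not the longer one, and the column has fewer to the lower end if it is. The
  order condition of the shift lemmas arises only in degree 2 and is
  \<open>Up_degree_2\<close>.\<close>

lemma elem_mat_in_Z:
  assumes "(a, b) \<in> Up" shows "elem_mat a b \<in> Z"
proof -
  obtain i k j l where ab: "a = \<sigma> i k" "b = \<sigma> j l" "D i k" "D j l"
    using \<sigma>_str_wt D_str_wt by metis
  have kl: "l + 2 \<le> k" using Up_wt[OF assms] ab by simp
  have le: "\<sigma> i m \<le> \<sigma> j m" if "l + 2 = k" "D i m" "D j m" for m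
    using Up_degree_2[of i k j m] assms ab that by auto
  have "E i k j l \<in> Z"
  proof (cases "lam ! i \<le> lam ! j")
    case True
    then show ?thesis using E_in_Z_up[of i k j l] ab kl le by auto
  next
    case False
    then show ?thesis using E_in_Z_down[of j l i k] ab kl le by auto
  qed
  then show ?thesis using ab by (simp add: E_def)
qed

section \<open>The generated ideal as a bracket image\<close>

lemma subspace_I: "cmat.subspace I"
proof -
  have e: "I = {M. \<forall>a b. (a, b) \<notin> Up \<longrightarrow> M $ a $ b = 0}" by (auto simp: I_def)
  show ?thesis unfolding e cmat.subspace_def by simp
qed

lemma I_subset_Z: "I \<subseteq> Z"
proof
  fix M assume M: "M \<in> I"
  have "cscale (M $ a $ b) (elem_mat a b) \<in> Z" for a b
    using M elem_mat_in_Z[of a b] cmat.subspace_scale[OF subspace_Z] cmat.subspace_0[OF subspace_Z]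
    by (cases "M $ a $ b = 0") (auto simp: I_def)
  then have "(\<Sum>a\<in>UNIV. \<Sum>b\<in>UNIV. cscale (M $ a $ b) (elem_mat a b)) \<in> Z"
    by (intro cmat.subspace_sum subspace_Z)
  then show "M \<in> Z" by (simp only: matrix_eq_sum_elem_mat[symmetric])
qed

lemma upper_mult_I: assumes "A \<in> upper" "M \<in> I" shows "A ** M \<in> I" "M ** A \<in> I"
proof -
  have "(a, b) \<in> Up" if nz: "(A ** M) $ a $ b \<noteq> 0" for a b
  proof -
    obtain c where "A $ a $ c * M $ c $ b \<noteq> 0"
      by (rule sum.not_neutral_contains_not_neutral[OF nz[unfolded matrix_mult_nth]]) blast
    then have "\<not> c < a" "(c, b) \<in> Up" using assms by (auto simp: upper_def I_def)
    then have "a \<le> c" "(c, b) \<in> Up" by simp_all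
    then show ?thesis using Up_mono by blast
  qed
  then show "A ** M \<in> I" by (simp add: I_def)
  have "(a, b) \<in> Up" if nz: "(M ** A) $ a $ b \<noteq> 0" for a b
  proof -
    obtain c where "M $ a $ c * A $ c $ b \<noteq> 0"
      by (rule sum.not_neutral_contains_not_neutral[OF nz[unfolded matrix_mult_nth]]) blast
    then have "\<not> b < c" "(a, c) \<in> Up" using assms by (auto simp: upper_def I_def)
    then have "c \<le> b" "(a, c) \<in> Up" by simp_all
    then show ?thesis using Up_mono by blast
  qed
  then show "M ** A \<in> I" by (simp add: I_def)
qed

lemma X_in_I: "X \<in> I"
proof -
  have "(a, b) \<in> Up" if "(a, b) \<in> root_set lam \<sigma>" for a b
    unfolding Up_def using that by (auto intro!: bexI[of _ "(a, b)"])
  then show ?thesis by (simp add: I_def X_def)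
qed

lemma b_alg_upper: "(b_alg :: 'n cmat set) = {A \<in> upper. trace A = 0}"
  by (auto simp: b_alg_def sl_alg_def upper_def)

lemma Z_eq_bracket_b: "Z = (\<lambda>Y. bracket Y X) ` b_alg"
proof
  show "(\<lambda>Y. bracket Y X) ` b_alg \<subseteq> Z" by (auto simp: Z_def b_alg_upper)
  show "Z \<subseteq> (\<lambda>Y. bracket Y X) ` b_alg"
  proof
    fix M assume "M \<in> Z"
    then obtain Y where Y: "Y \<in> upper" "M = bracket Y X" by (auto simp: Z_def)
    let ?Y = "Y - cscale (trace Y / of_nat CARD('n)) (mat 1)"
    have "?Y \<in> upper"
      by (intro cmat.subspace_diff cmat.subspace_scale subspace_upper Y one_upper)
    moreover have "trace ?Y = 0" by (simp add: trace_def mat_1_nth sum_subtractf)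
    moreover have "bracket ?Y X = M"
      by (simp add: bracket_linear Y) (simp add: bracket_def vec_eq_iff)
    ultimately show "M \<in> (\<lambda>Y. bracket Y X) ` b_alg" by (auto simp: b_alg_upper)
  qed
qed

lemma ad_nilpotent_ideal_I: "ad_nilpotent_ideal I"
  unfolding ad_nilpotent_ideal_def
proof (intro conjI ballI subspace_I)
  show "I \<subseteq> n_alg"
  proof
    fix M assume M: "M \<in> I"
    have "M $ a $ b = 0" if "b \<le> a" for a b
    proof (rule ccontr)
      assume "M $ a $ b \<noteq> 0"
      then have "(a, b) \<in> Up" using M by (simp add: I_def)
      then show False using Up_less[of a b] that by simp
    qed
    then show "M \<in> n_alg" by (simp add: n_alg_def)
  qed
  fix A M :: "'n cmat" assume "A \<in> b_alg" and M: "M \<in> I"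
  then have "A \<in> upper" by (simp add: b_alg_upper)
  from cmat.subspace_diff[OF subspace_I upper_mult_I[OF this M]]
  show "bracket A M \<in> I" by (simp add: bracket_def)
qed

text \<open>An ideal containing the root spaces contains their sum \<open>X\<close>, hence all
  brackets of \<open>b_alg\<close> with \<open>X\<close>. These form \<open>Z\<close>, so
  \<open>I_subset_Z\<close> gives the hard inclusion at one stroke.\<close>

lemma generated_ideal_eq_I: "generated_ideal (root_set lam \<sigma>) = I"
proof
  have "root_space r \<subseteq> I" if "r \<in> root_set lam \<sigma>" for r
    unfolding root_space_def
  proof (rule cmat.span_minimal)
    obtain c d where r: "r = (c, d)" by (cases r)
    have "(c, d) \<in> Up" unfolding Up_def using that r by (auto intro!: bexI[of _ "(c, d)"])
    then show "{elem_mat (fst r) (snd r)} \<subseteq> I" unfolding r I_def by (simp add: elem_mat_nth)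
  qed (rule subspace_I)
  then show "generated_ideal (root_set lam \<sigma>) \<subseteq> I"
    unfolding generated_ideal_def using ad_nilpotent_ideal_I by (intro Inter_lower) simp
  have "Z \<subseteq> J" if J: "ad_nilpotent_ideal J" and r: "\<forall>r\<in>root_set lam \<sigma>. root_space r \<subseteq> J" for J
  proof -
    have sJ: "cmat.subspace J" using J by (simp add: ad_nilpotent_ideal_def)
    have "cscale (X $ a $ b) (elem_mat a b) \<in> J" for a b
    proof (cases "(a, b) \<in> root_set lam \<sigma>")
      case True
      then have "root_space (a, b) \<subseteq> J" using r by blast
      moreover have "elem_mat a b \<in> root_space (a, b)"
        unfolding root_space_def by (rule cmat.span_base) simp
      ultimately have "elem_mat a b \<in> J" by (rule subsetD)
      then show ?thesis by (rule cmat.subspace_scale[OF sJ])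
    qed (simp add: X_def cmat.subspace_0[OF sJ])
    then have "(\<Sum>a\<in>UNIV. \<Sum>b\<in>UNIV. cscale (X $ a $ b) (elem_mat a b)) \<in> J"
      by (intro cmat.subspace_sum sJ)
    then have "X \<in> J" by (simp only: matrix_eq_sum_elem_mat[symmetric])
    then show ?thesis using J by (auto simp: Z_eq_bracket_b ad_nilpotent_ideal_def)
  qed
  then have "Z \<subseteq> generated_ideal (root_set lam \<sigma>)"
    unfolding generated_ideal_def by (intro Inter_greatest) simp
  with I_subset_Z show "I \<subseteq> generated_ideal (root_set lam \<sigma>)" by (rule subset_trans)
qed

lemma I_eq_bracket_b: "I = (\<lambda>Y. bracket Y X) ` b_alg"
proof (rule subset_antisym)
  show "I \<subseteq> (\<lambda>Y. bracket Y X) ` b_alg" by (rule subset_trans[OF I_subset_Z equalityD1[OF Z_eq_bracket_b]])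
  show "(\<lambda>Y. bracket Y X) ` b_alg \<subseteq> I"
  proof (rule image_subsetI)
    fix Y :: "'n cmat" assume "Y \<in> b_alg"
    then show "bracket Y X \<in> I"
      using conjunct2[OF conjunct2[OF ad_nilpotent_ideal_I[unfolded ad_nilpotent_ideal_def]], rule_format] X_in_I
      by metis
  qed
qed

end

section \<open>The orbit of the standard nilpotent matrix\<close>

text \<open>Rows and columns are numbered separately because two numberings meet: the increasing one
  of \<open>to_mat\<close> and the one along the strings, in which \<open>X\<close> is the Jordan
  matrix.\<close>

definition reindex :: "(nat \<Rightarrow> 'n) \<Rightarrow> (nat \<Rightarrow> 'n) \<Rightarrow> ('n::finite) cmat \<Rightarrow> complex Matrix.mat" where
  "reindex f g A = Matrix.mat CARD('n) CARD('n) (\<lambda>(i, j). A $ f i $ g j)"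

abbreviation numbering :: "(nat \<Rightarrow> 'n::finite) \<Rightarrow> bool" where
  "numbering f \<equiv> bij_betw f {..<CARD('n)} UNIV"

lemma reindex_carrier [simp]: "reindex f g (A :: ('n::finite) cmat) \<in> carrier_mat CARD('n) CARD('n)"
  by (simp add: reindex_def)

lemma reindex_mult:
  fixes A B :: "('n::finite) cmat"
  assumes g: "numbering g"
  shows "reindex f g A * reindex g h B = reindex f h (A ** B)"
proof (rule eq_matI)
  fix i j assume "i < dim_row (reindex f h (A ** B))" "j < dim_col (reindex f h (A ** B))"
  then have ij: "i < CARD('n)" "j < CARD('n)" by (simp_all add: reindex_def)
  have "(reindex f g A * reindex g h B) $$ (i, j) = (\<Sum>k<CARD('n). A $ f i $ g k * B $ g k $ h j)"
    using ij by (simp add: reindex_def Matrix.scalar_prod_def atLeast0LessThan)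
  also have "\<dots> = (\<Sum>k\<in>UNIV. A $ f i $ k * B $ k $ h j)"
    by (rule sum.reindex_bij_betw[OF g])
  finally show "(reindex f g A * reindex g h B) $$ (i, j) = reindex f h (A ** B) $$ (i, j)"
    using ij by (simp add: reindex_def matrix_mult_nth)
qed (simp_all add: reindex_def)

lemma reindex_one:
  assumes "numbering (f :: nat \<Rightarrow> 'n::finite)" shows "reindex f f (mat 1) = 1\<^sub>m CARD('n)"
proof (rule eq_matI)
  fix i j assume "i < dim_row (1\<^sub>m CARD('n) :: complex Matrix.mat)" "j < dim_col (1\<^sub>m CARD('n) :: complex Matrix.mat)"
  then show "reindex f f (mat 1) $$ (i, j) = 1\<^sub>m CARD('n) $$ (i, j)"
    using bij_betw_imp_inj_on[OF assms] by (simp add: reindex_def mat_1_nth inj_on_eq_iff)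
qed (simp_all add: reindex_def)

lemma reindex_inj:
  fixes A B :: "('n::finite) cmat"
  assumes f: "numbering f" and g: "numbering g" and e: "reindex f g A = reindex f g B"
  shows "A = B"
proof -
  have "A $ a $ b = B $ a $ b" for a b
  proof -
    obtain i where i: "i < CARD('n)" "a = f i" using f by (metis UNIV_I bij_betw_iff_bijections lessThan_iff)
    obtain j where j: "j < CARD('n)" "b = g j" using g by (metis UNIV_I bij_betw_iff_bijections lessThan_iff)
    have "reindex f g A $$ (i, j) = reindex f g B $$ (i, j)" using e by simp
    then show ?thesis using i j by (simp add: reindex_def)
  qed
  then show ?thesis by (simp add: vec_eq_iff)
qed

lemma reindex_surj:
  assumes f: "numbering (f :: nat \<Rightarrow> 'n::finite)" and g: "numbering g"
    and P: "P \<in> carrier_mat CARD('n) CARD('n)"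
  shows "\<exists>A. P = reindex f g A"
proof -
  let ?f = "inv_into {..<CARD('n)} f" and ?g = "inv_into {..<CARD('n)} g"
  have "P = reindex f g (\<chi> a b. P $$ (?f a, ?g b))"
    by (rule eq_matI) (use P f g in \<open>auto simp: reindex_def bij_betw_inv_into_left\<close>)
  then show ?thesis by blast
qed

text \<open>A change of numbering is absorbed by the similarity: the conjugating matrix is read with
  \<open>f\<close> on one side and \<open>g\<close> on the other.\<close>

lemma similar_reindex_iff:
  fixes A B :: "('n::finite) cmat"
  assumes f: "numbering f" and g: "numbering g"
  shows "similar_mat (reindex f f A) (reindex g g B) \<longleftrightarrow> (\<exists>p. invertible p \<and> A = Ad p B)"
proof
  assume "similar_mat (reindex f f A) (reindex g g B)"
  then obtain P Q where w: "similar_mat_wit (reindex f f A) (reindex g g B) P Q"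
    by (auto simp: similar_mat_def)
  note d = similar_mat_witD2[OF reindex_carrier w]
  obtain p q where pq: "P = reindex f g p" "Q = reindex g f q"
    using reindex_surj[OF f g] reindex_surj[OF g f] d by metis
  have "reindex f f (p ** q) = reindex f f (mat 1)"
    using d(1) pq by (simp add: reindex_mult[OF g] reindex_one[OF f])
  then have pq1: "p ** q = mat 1" by (rule reindex_inj[OF f f])
  then have "invertible p" using invertible_right_inverse by blast
  moreover have "reindex f f A = reindex f f (p ** B ** q)"
    using d(3) pq by (simp add: reindex_mult[OF g])
  then have "A = p ** B ** q" by (rule reindex_inj[OF f f])
  ultimately show "\<exists>p. invertible p \<and> A = Ad p B"
    using matrix_inv_unique[OF pq1] by (auto simp: Ad_def)
next
  assume "\<exists>p. invertible p \<and> A = Ad p B"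
  then obtain p where p: "invertible p" "A = Ad p B" by blast
  have "similar_mat_wit (reindex f f A) (reindex g g B) (reindex f g p) (reindex g f (matrix_inv p))"
    by (rule similar_mat_witI[where n = "CARD('n)"])
      (simp_all add: reindex_mult f g p Ad_def reindex_one[OF f] reindex_one[OF g] matrix_inv_left_inverse matrix_inv_right_inverse)
  then show "similar_mat (reindex f f A) (reindex g g B)" by (auto simp: similar_mat_def)
qed

lemma to_mat_reindex: "to_mat A = reindex ((!) (sorted_list_of_set UNIV)) ((!) (sorted_list_of_set UNIV)) A"
  by (simp add: to_mat_def reindex_def)

lemma numbering_nth:
  fixes xs :: "('n::finite) list"
  assumes "distinct xs" "set xs = UNIV"
  shows "numbering ((!) xs)"
  using bij_betw_nth[of xs "{..<CARD('n)}" UNIV] assms distinct_card[of xs] by simp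

definition consecutive :: "'a list list \<Rightarrow> ('a \<times> 'a) set" where
  "consecutive xss = {(xs ! j, xs ! Suc j) | xs j. xs \<in> set xss \<and> Suc j < length xs}"

text \<open>For eigenvalue 0 the matrix records the successor relation inside the blocks; distinct
  labels allow positions to be replaced by labels. The first block is peeled off and the four
  corners are compared.\<close>

lemma jordan_matrix_consecutive:
  assumes "distinct (concat xss)" "p < length (concat xss)" "q < length (concat xss)"
  shows "jordan_matrix (map (\<lambda>xs. (length xs, 0 :: complex)) xss) $$ (p, q)
    = (if (concat xss ! p, concat xss ! q) \<in> consecutive xss then 1 else 0)"
  using assms
proof (induction xss arbitrary: p q)
  case (Cons xs xss)
  let ?J = "jordan_matrix (map (\<lambda>xs. (length xs, 0 :: complex)) xss)"
  let ?n = "length xs" and ?m = "length (concat xss)"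
  have m: "sum_list (map fst (map (\<lambda>xs. (length xs, 0 :: complex)) xss)) = ?m"
    by (simp add: length_concat comp_def)
  have dimJ: "dim_row ?J = ?m" "dim_col ?J = ?m"
    unfolding jordan_matrix_dim m by (rule refl)+
  have d: "distinct xs" "distinct (concat xss)" "set xs \<inter> set (concat xss) = {}"
    using Cons.prems(1) by auto
  have cons: "(a, b) \<in> consecutive (xs # xss) \<longleftrightarrow>
      (\<exists>j. a = xs ! j \<and> b = xs ! Suc j \<and> Suc j < ?n) \<or> (a, b) \<in> consecutive xss" for a b
    by (auto simp: consecutive_def)
  have inside: "a \<in> set (concat xss) \<and> b \<in> set (concat xss)" if "(a, b) \<in> consecutive xss" for a b
    using that by (auto simp: consecutive_def) (metis nth_mem Suc_lessD)+
  have J: "jordan_matrix (map (\<lambda>xs. (length xs, 0 :: complex)) (xs # xss)) $$ (p, q) =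
    (if p < ?n then if q < ?n then jordan_block ?n 0 $$ (p, q) else 0
     else if q < ?n then 0 else ?J $$ (p - ?n, q - ?n))"
    using Cons.prems(2,3) unfolding list.map jordan_matrix_Cons m
    by (subst index_mat_four_block) (auto simp: dimJ simp del: jordan_matrix_dim)
  have pq: "p < ?n + ?m" "q < ?n + ?m" using Cons.prems(2,3) by auto
  consider "p < ?n" "q < ?n" | "p < ?n" "\<not> q < ?n" | "\<not> p < ?n" "q < ?n" | "\<not> p < ?n" "\<not> q < ?n" by blast
  then show ?case
  proof cases
    case 1
    have "(concat (xs # xss) ! p, concat (xs # xss) ! q) \<in> consecutive (xs # xss) \<longleftrightarrow> Suc p = q"
    proof -
      have "(xs ! p, xs ! q) \<notin> consecutive xss" using inside[of "xs ! p" "xs ! q"] d(3) 1 by (meson disjoint_iff nth_mem)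
      then show ?thesis
        using 1 d(1) unfolding cons by (auto simp: nth_append nth_eq_iff_index_eq)
    qed
    then show ?thesis unfolding J using 1 by auto
  next
    case 2
    have y: "concat (xs # xss) ! q \<in> set (concat xss)" using 2 pq nth_mem[of "q - ?n" "concat xss"] by (simp add: nth_append del: set_concat)
    have x: "concat (xs # xss) ! p \<in> set xs" using 2 by (simp add: nth_append)
    have "(concat (xs # xss) ! p, concat (xs # xss) ! q) \<notin> consecutive (xs # xss)"
      unfolding cons using inside x y d(3) by (metis disjoint_iff nth_mem)
    then show ?thesis unfolding J using 2 by auto
  next
    case 3
    have y: "concat (xs # xss) ! p \<in> set (concat xss)" using 3 pq nth_mem[of "p - ?n" "concat xss"] by (simp add: nth_append del: set_concat)
    have x: "concat (xs # xss) ! q \<in> set xs" using 3 by (simp add: nth_append)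
    have "(concat (xs # xss) ! p, concat (xs # xss) ! q) \<notin> consecutive (xs # xss)"
      unfolding cons using inside x y d(3) by (metis disjoint_iff nth_mem Suc_lessD)
    then show ?thesis unfolding J using 3 by auto
  next
    case 4
    have lt: "p - ?n < ?m" "q - ?n < ?m" using 4 pq by auto
    have e: "concat (xs # xss) ! p = concat xss ! (p - ?n)" "concat (xs # xss) ! q = concat xss ! (q - ?n)"
      using 4 by (simp_all add: nth_append)
    have "concat xss ! (p - ?n) \<notin> set xs" using d(3) nth_mem[OF lt(1)] by blast
    then have "(concat xss ! (p - ?n), b) \<in> consecutive (xs # xss) \<longleftrightarrow>
        (concat xss ! (p - ?n), b) \<in> consecutive xss" for b
      unfolding cons by (metis nth_mem Suc_lessD)
    then show ?thesis unfolding J e using 4 Cons.IH[OF d(2) lt] by simp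
  qed
qed simp

context index_system
begin

section \<open>The Jordan type of \<open>X\<close>\<close>

definition strings :: "'n list list" where
  "strings = map (\<lambda>i. map (\<lambda>j. \<sigma> i (int (lam ! i) - 1 - 2 * int j)) [0..<lam ! i]) [0..<length lam]"

lemma D_position: "i < length lam \<Longrightarrow> D i (int (lam ! i) - 1 - 2 * int j) \<longleftrightarrow> j < lam ! i"
  by (auto simp: D_def)

lemma set_strings: "set (concat strings) = UNIV"
proof -
  have "a \<in> set (concat strings)" for a
  proof -
    obtain i k where ik: "D i k" "\<sigma> i k = a" using \<sigma>_surj by blast
    then obtain j where j: "j < lam ! i" "k = int (lam ! i) - 1 - 2 * int j"
      by (auto simp: D_iff dom_index_def)
    then show ?thesis using ik
      by (auto simp: strings_def D_iff intro!: bexI[of _ i] image_eqI[of _ _ j])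
  qed
  then show ?thesis by blast
qed

lemma distinct_strings: "distinct (concat strings)"
proof (rule card_distinct)
  have "length (concat strings) = sum_list (map ((!) lam) [0..<length lam])"
    by (simp add: strings_def length_concat comp_def)
  also have "\<dots> = CARD('n)" using partition by (simp add: is_partition_def map_nth)
  finally show "card (set (concat strings)) = length (concat strings)" by (simp only: set_strings)
qed

lemma consecutive_strings: "(a, b) \<in> consecutive strings \<longleftrightarrow> (a, b) \<in> root_set lam \<sigma>"
proof
  assume "(a, b) \<in> consecutive strings"
  then obtain i j where ij: "i < length lam" "Suc j < lam ! i"
    "a = \<sigma> i (int (lam ! i) - 1 - 2 * int j)" "b = \<sigma> i (int (lam ! i) - 1 - 2 * int (Suc j))"
    by (auto simp: consecutive_def strings_def)
  have "D i (int (lam ! i) - 1 - 2 * int j)" "D i (int (lam ! i) - 1 - 2 * int (Suc j))"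
    using ij by (simp_all only: D_position)
  then show "(a, b) \<in> root_set lam \<sigma>" by (simp add: root_set_iff ij)
next
  assume "(a, b) \<in> root_set lam \<sigma>"
  then obtain i k where ik: "a = \<sigma> i k" "b = \<sigma> i (k - 2)" "D i k" "D i (k - 2)"
    by (auto simp: root_set_def D_iff)
  then obtain j where j: "j < lam ! i" "k = int (lam ! i) - 1 - 2 * int j"
    by (auto simp: D_iff dom_index_def)
  have i: "i < length lam" using ik by (simp add: D_def)
  have e: "k - 2 = int (lam ! i) - 1 - 2 * int (Suc j)" using j by simp
  have sj: "Suc j < lam ! i" using ik(4) D_position[OF i, of "Suc j"] unfolding e by blast
  let ?xs = "map (\<lambda>j. \<sigma> i (int (lam ! i) - 1 - 2 * int j)) [0..<lam ! i]"
  have "?xs \<in> set strings" using i by (auto simp: strings_def)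
  moreover have "?xs ! j = a" using j ik(1) by simp
  moreover have "?xs ! Suc j = b"
  proof -
    have "?xs ! Suc j = \<sigma> i (int (lam ! i) - 1 - 2 * int (Suc j))" using sj by simp
    then show ?thesis unfolding e[symmetric] ik(2) .
  qed
  ultimately show "(a, b) \<in> consecutive strings"
    unfolding consecutive_def using sj by (intro CollectI exI[of _ ?xs] exI[of _ j]) simp
qed

lemma jordan_matrix_eq_reindex_X:
  "jordan_matrix (map (\<lambda>k. (k, 0)) lam) = reindex ((!) (concat strings)) ((!) (concat strings)) X"
proof -
  have len: "length (concat strings) = CARD('n)"
    using distinct_card[OF distinct_strings] by (simp only: set_strings)
  have e: "map (\<lambda>xs. (length xs, 0 :: complex)) strings = map (\<lambda>k. (k, 0)) lam"
    by (rule nth_equalityI) (simp_all add: strings_def)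
  have sl: "sum_list lam = CARD('n)" using partition by (simp add: is_partition_def)
  show ?thesis
  proof (rule eq_matI)
    fix p q assume "p < dim_row (reindex ((!) (concat strings)) ((!) (concat strings)) X)"
      "q < dim_col (reindex ((!) (concat strings)) ((!) (concat strings)) X)"
    then have pq: "p < CARD('n)" "q < CARD('n)" by (simp_all add: reindex_def)
    show "jordan_matrix (map (\<lambda>k. (k, 0)) lam) $$ (p, q)
        = reindex ((!) (concat strings)) ((!) (concat strings)) X $$ (p, q)"
      using jordan_matrix_consecutive[OF distinct_strings, of p q] pq
      by (simp add: e len reindex_def X_def consecutive_strings)
  qed (simp_all add: reindex_def comp_def sl)
qed

lemma orbit_of_type_eq: "orbit_of_type lam = {Ad p X | p. invertible p}"
proof -
  have 1: "numbering ((!) (sorted_list_of_set (UNIV :: 'n set)))"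
    by (rule numbering_nth) simp_all
  have 2: "numbering ((!) (concat strings))"
    by (rule numbering_nth[OF distinct_strings set_strings])
  have 0: "0 \<notin> fst ` set (map (\<lambda>k. (k, 0 :: complex)) lam)"
    using partition by (auto simp: is_partition_def)
  show ?thesis
    unfolding orbit_of_type_def jordan_nf_def jordan_matrix_eq_reindex_X to_mat_reindex
      similar_reindex_iff[OF 1 2] using 0 by auto
qed

lemma orbit_of_type_SL: "orbit_of_type lam = (\<lambda>g. Ad g X) ` carrier SL"
  unfolding orbit_of_type_eq using Ad_SL_ex SL_invertible by (auto simp: image_iff) metis

lemma matpow_X: "matpow X k $ a $ b \<noteq> 0 \<Longrightarrow> wt a = wt b + 2 * int k"
proof (induction k arbitrary: a)
  case 0
  then show ?case by (simp add: matpow_0 mat_1_nth split: if_splits)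
next
  case (Suc k)
  obtain c where "X $ a $ c * matpow X k $ c $ b \<noteq> 0"
    by (rule sum.not_neutral_contains_not_neutral[OF Suc.prems[unfolded matpow_Suc matrix_mult_nth]]) blast
  then show ?case using Suc.IH[of c] by (simp add: X_nth split: if_splits)
qed

lemma nilpotent_orbit_of_type: "nilpotent_orbit (orbit_of_type lam :: 'n cmat set)"
proof -
  have "trace X = 0" by (simp add: trace_def X_nth)
  moreover have "\<exists>k. matpow X k = 0"
  proof -
    \<comment> \<open>Nonzero entries of \<open>X^k\<close> have degree \<open>2 k\<close>, which
      for this \<open>k\<close> exceeds the spread of the weights.\<close>
    define k where "k = Suc (nat (Max (range wt) - Min (range (wt :: 'n \<Rightarrow> int))))"
    have "matpow X k $ a $ b = 0" for a b
    proof (rule ccontr)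
      assume "matpow X k $ a $ b \<noteq> 0"
      then have "wt a = wt b + 2 * int k" by (rule matpow_X)
      moreover have "wt a \<le> Max (range wt)" "Min (range wt) \<le> wt b" by simp_all
      moreover have "Max (range wt) - Min (range wt) \<le> int (nat (Max (range wt) - Min (range wt)))"
        by simp
      moreover have "0 \<le> int (nat (Max (range wt) - Min (range wt)))" by simp
      moreover have False if "x = y + 2 * (1 + N)" "x \<le> M" "m \<le> y" "M - m \<le> N" "0 \<le> N" for x y M m N :: int
        using that by presburger
      ultimately show False unfolding k_def of_nat_Suc by metis
    qed
    then show ?thesis by (auto simp: vec_eq_iff)
  qed
  ultimately show ?thesis unfolding nilpotent_orbit_def orbit_of_type_SL
    by (auto simp: sl_alg_def)
qed

end

section \<open>The unitary group and triangularisation\<close>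

definition herm :: "complex^'n \<Rightarrow> complex^('n::finite) \<Rightarrow> complex" where
  "herm x y = (\<Sum>i\<in>UNIV. x $ i * cnj (y $ i))"

lemma herm_linear:
  "herm (x - y) z = herm x z - herm y z" "herm (c *s x) z = c * herm x z"
  "herm (\<Sum>i\<in>A. f i) z = (\<Sum>i\<in>A. herm (f i) z)" "herm x (c *s z) = cnj c * herm x z"
proof -
  show "herm (\<Sum>i\<in>A. f i) z = (\<Sum>i\<in>A. herm (f i) z)"
    unfolding herm_def by (subst sum.swap) (simp add: sum_component sum_distrib_right)
qed (simp_all add: herm_def sum_subtractf sum_distrib_left algebra_simps)

lemma herm_commute: "herm y x = cnj (herm x y)"
  by (simp add: herm_def mult.commute)

lemma herm_self: "herm x x = of_real ((norm x)\<^sup>2)"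
proof -
  have "(norm x)\<^sup>2 = (\<Sum>i\<in>UNIV. (norm (x $ i))\<^sup>2)"
    by (simp add: norm_vec_def L2_set_def sum_nonneg)
  then show ?thesis by (simp add: herm_def complex_norm_square[symmetric] del: of_real_power)
qed

definition hadj :: "('n::finite) cmat \<Rightarrow> 'n cmat" where
  "hadj A = (\<chi> i j. cnj (A $ j $ i))"

definition unitary_matrices :: "('n::finite) cmat set" where
  "unitary_matrices = {u. hadj u ** u = mat 1}"

lemma unitary_invertible:
  assumes "u \<in> unitary_matrices" shows "invertible u" "matrix_inv u = hadj u"
proof -
  show "invertible u" using assms invertible_left_inverse by (auto simp: unitary_matrices_def)
  have "u ** hadj u = mat 1"
    using assms by (simp add: unitary_matrices_def matrix_left_right_inverse)
  then show "matrix_inv u = hadj u" by (rule matrix_inv_unique)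
qed

lemma continuous_on_hadj [continuous_intros]: "continuous_on S f \<Longrightarrow> continuous_on S (\<lambda>x. hadj (f x))"
  unfolding hadj_def by (intro continuous_intros)

lemma compact_unitary: "compact (unitary_matrices :: ('n::finite) cmat set)"
proof -
  have "closed (unitary_matrices :: 'n cmat set)"
    unfolding unitary_matrices_def by (intro closed_Collect_eq continuous_intros)
  moreover have "bounded (unitary_matrices :: 'n cmat set)"
  proof (rule boundedI)
    fix u :: "'n cmat" assume u: "u \<in> unitary_matrices"
    have e: "norm (u $ i $ j) \<le> 1" for i j
    proof -
      have "(\<Sum>k\<in>UNIV. cnj (u $ k $ j) * u $ k $ j) = 1"
        using u by (auto simp: unitary_matrices_def vec_eq_iff matrix_mult_nth hadj_def mat_1_nth
            dest: spec[of _ j])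
      then have "complex_of_real (\<Sum>k\<in>UNIV. (norm (u $ k $ j))\<^sup>2) = 1"
        by (simp add: complex_norm_square mult.commute del: of_real_power)
      then have "(\<Sum>k\<in>UNIV. (norm (u $ k $ j))\<^sup>2) = 1" using of_real_eq_1_iff by blast
      moreover have "(norm (u $ i $ j))\<^sup>2 \<le> (\<Sum>k\<in>UNIV. (norm (u $ k $ j))\<^sup>2)"
        by (rule member_le_sum) auto
      ultimately show ?thesis using power_le_one_iff[of "norm (u $ i $ j)" 2] by (simp add: abs_square_le_1)
    qed
    have "norm (u $ i) \<le> (\<Sum>j\<in>(UNIV :: 'n set). 1)" for i
    proof -
      have "norm (u $ i) \<le> (\<Sum>j\<in>UNIV. norm (u $ i $ j))"
        unfolding norm_vec_def[of "u $ i"] by (rule L2_set_le_sum) simp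
      also have "\<dots> \<le> (\<Sum>j\<in>(UNIV :: 'n set). 1)" by (rule sum_mono) (rule e)
      finally show ?thesis .
    qed
    then have "(\<Sum>i\<in>UNIV. norm (u $ i)) \<le> (\<Sum>i\<in>(UNIV :: 'n set). \<Sum>j\<in>(UNIV :: 'n set). 1)"
      by (rule sum_mono)
    moreover have "norm u \<le> (\<Sum>i\<in>UNIV. norm (u $ i))"
      unfolding norm_vec_def[of u] by (rule L2_set_le_sum) simp
    ultimately show "norm u \<le> (\<Sum>i\<in>(UNIV :: 'n set). \<Sum>j\<in>(UNIV :: 'n set). 1)" by (rule order_trans[rotated])
  qed
  ultimately show ?thesis by (simp add: compact_eq_bounded_closed)
qed

text \<open>\<open>\<beta> j\<close> lists the coefficients of the \<open>j\<close>-th orthonormalised column with respect to the columns of \<open>g\<close>.\<close>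

lemma Gram_Schmidt:
  fixes g :: "('n::{finite,wellorder}) cmat"
  assumes "invertible g" "finite A"
  shows "\<exists>\<beta>. \<forall>j\<in>A. (\<forall>k>j. \<beta> j $ k = 0) \<and> \<beta> j $ j \<noteq> 0 \<and>
    (\<forall>i\<in>A. herm (g *v \<beta> j) (g *v \<beta> i) = (if i = j then 1 else 0))"
  using assms(2)
proof (induction A rule: finite_linorder_max_induct)
  case (insert m A)
  then obtain \<beta> where tri: "\<And>j k. j \<in> A \<Longrightarrow> j < k \<Longrightarrow> \<beta> j $ k = 0" and diag: "\<And>j. j \<in> A \<Longrightarrow> \<beta> j $ j \<noteq> 0"
    and orth: "\<And>i j. i \<in> A \<Longrightarrow> j \<in> A \<Longrightarrow> herm (g *v \<beta> j) (g *v \<beta> i) = (if i = j then 1 else 0)"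
    by metis
  let ?e = "axis m (1 :: complex)"
  \<comment> \<open>The subtracted vectors are supported on indices below \<open>m\<close>, so the
    entry at \<open>m\<close> remains 1 and the new vector cannot vanish.\<close>
  define w where "w = ?e - (\<Sum>i\<in>A. herm (g *v ?e) (g *v \<beta> i) *s \<beta> i)"
  have gw: "g *v w = g *v ?e - (\<Sum>i\<in>A. herm (g *v ?e) (g *v \<beta> i) *s (g *v \<beta> i))"
    by (simp add: w_def matrix_vector_mult_diff_distrib vec.linear_sum[OF matrix_vector_mul_linear_gen]
        matrix_vector_scale)
  have wm: "w $ m = 1"
    using insert.hyps(2) tri by (simp add: w_def sum_component)
  have wk: "w $ k = 0" if "m < k" for k
  proof -
    have "\<beta> i $ k = 0" if "i \<in> A" for i using insert.hyps(2) that tri \<open>m < k\<close> by (meson less_trans)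
    then show ?thesis using that by (simp add: w_def sum_component axis_def)
  qed
  have perp: "herm (g *v w) (g *v \<beta> j) = 0" if j: "j \<in> A" for j
  proof -
    have "(\<Sum>i\<in>A. herm (g *v ?e) (g *v \<beta> i) * herm (g *v \<beta> i) (g *v \<beta> j))
        = (\<Sum>i\<in>A. if i = j then herm (g *v ?e) (g *v \<beta> j) else 0)"
      by (rule sum.cong) (use j orth in auto)
    also have "\<dots> = herm (g *v ?e) (g *v \<beta> j)" using insert.hyps(1) j by simp
    finally show ?thesis by (simp add: gw herm_linear)
  qed
  have "w \<noteq> 0" using wm by auto
  then have "g *v w \<noteq> 0" using assms(1)
    by (metis matrix_inv_left_inverse matrix_vector_mul_assoc matrix_vector_mul_lid matrix_vector_mult_0_right)
  then have r: "norm (g *v w) \<noteq> 0" by simp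
  define r where "r = complex_of_real (1 / norm (g *v w))"
  have r0: "r \<noteq> 0" "cnj r = r" using r by (simp_all add: r_def)
  have rr: "r * (r * herm (g *v w) (g *v w)) = 1"
    unfolding herm_self r_def of_real_mult[symmetric] of_real_eq_1_iff
    using r by (simp add: power2_eq_square)
  have mA: "m \<notin> A" using insert.hyps(2) by auto
  let ?\<beta> = "\<beta>(m := r *s w)"
  have "(\<forall>k>j. ?\<beta> j $ k = 0) \<and> ?\<beta> j $ j \<noteq> 0 \<and>
    (\<forall>i\<in>insert m A. herm (g *v ?\<beta> j) (g *v ?\<beta> i) = (if i = j then 1 else 0))" if j: "j \<in> insert m A" for j
  proof (cases "j = m")
    case True
    then show ?thesis using wk wm r0 rr perp mA
      by (auto simp: matrix_vector_scale herm_linear)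
  next
    case False
    then have jA: "j \<in> A" using j by simp
    have "herm (g *v \<beta> j) (g *v w) = 0" using herm_commute[of "g *v w" "g *v \<beta> j"] perp[OF jA]
      by (metis complex_cnj_zero herm_commute)
    then show ?thesis using False jA tri diag orth mA
      by (auto simp: matrix_vector_scale herm_linear)
  qed
  then show ?case by blast
qed simp

lemma upper_invertible:
  assumes "A \<in> upper" shows "invertible A \<longleftrightarrow> (\<forall>i. A $ i $ i \<noteq> 0)"
proof -
  have "det A = (\<Prod>i\<in>UNIV. A $ i $ i)"
    using assms by (intro det_upperdiagonal) (simp add: upper_def)
  then show ?thesis by (simp add: invertible_det_nz)
qed

lemma upper_matrix_inv: "A \<in> upper \<Longrightarrow> invertible A \<Longrightarrow> matrix_inv A \<in> upper"
  by (rule matrix_inv_in_subspace[OF subspace_upper(2)]) (auto intro: upper_mult)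

text \<open>QR decomposition: the local \<open>b\<close> collects the Gram-Schmidt coefficients,
  \<open>g ** b\<close> has orthonormal columns, and the triangular factor is the inverse of this
  \<open>b\<close>.\<close>

lemma unitary_upper_decomposition:
  fixes g :: "('n::{finite,wellorder}) cmat"
  assumes "invertible g"
  obtains u b where "u \<in> unitary_matrices" "b \<in> upper" "invertible b" "g = u ** b"
proof -
  obtain \<beta> where tri: "\<And>j k. j < k \<Longrightarrow> \<beta> j $ k = 0" and diag: "\<And>j. \<beta> j $ j \<noteq> 0"
    and orth: "\<And>i j. herm (g *v \<beta> j) (g *v \<beta> i) = (if i = j then 1 else 0)"
    using Gram_Schmidt[OF assms, of UNIV] by auto
  define b where "b = (\<chi> i j. \<beta> j $ i)"
  have b: "b \<in> upper" using tri by (simp add: b_def upper_def)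
  then have binv: "invertible b" using diag by (simp add: upper_invertible) (simp add: b_def)
  have gb: "(g ** b) $ k $ j = (g *v \<beta> j) $ k" for k j
    by (simp add: matrix_mult_nth matrix_vector_mult_def b_def)
  have "(hadj (g ** b) ** (g ** b)) $ i $ j = mat 1 $ i $ j" for i j
  proof -
    have "(hadj (g ** b) ** (g ** b)) $ i $ j = (\<Sum>k\<in>UNIV. hadj (g ** b) $ i $ k * (g ** b) $ k $ j)"
      by (rule matrix_mult_nth)
    also have "\<dots> = herm (g *v \<beta> j) (g *v \<beta> i)"
      by (simp add: hadj_def gb herm_def mult.commute)
    finally show ?thesis by (simp add: orth mat_1_nth)
  qed
  then have "g ** b \<in> unitary_matrices" by (simp add: unitary_matrices_def vec_eq_iff)
  moreover have "matrix_inv b \<in> upper" by (rule upper_matrix_inv[OF b binv])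
  moreover have "g = (g ** b) ** matrix_inv b" using binv by simp
  ultimately show ?thesis using that invertible_matrix_inv[OF binv] by blast
qed

section \<open>The closure of the orbit\<close>

abbreviation polyfun :: "(complex \<Rightarrow> complex) \<Rightarrow> bool" where
  "polyfun f \<equiv> \<exists>p. \<forall>t. f t = poly p t"

lemma polyfun_const: "polyfun (\<lambda>t. c)" by (rule exI[of _ "[:c:]"]) simp

lemma polyfun_power: "polyfun (\<lambda>t. t ^ k)" by (rule exI[of _ "monom 1 k"]) (simp add: poly_monom)

lemma polyfun_add: "polyfun f \<Longrightarrow> polyfun g \<Longrightarrow> polyfun (\<lambda>t. f t + g t)"
  by (metis poly_add)

lemma polyfun_mult: "polyfun f \<Longrightarrow> polyfun g \<Longrightarrow> polyfun (\<lambda>t. f t * g t)"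
  by (metis poly_mult)

lemma polyfun_sum: "(\<And>i. i \<in> A \<Longrightarrow> polyfun (f i)) \<Longrightarrow> polyfun (\<lambda>t. \<Sum>i\<in>A. f i t)"
proof (induction A rule: infinite_finite_induct)
  case (insert a A)
  then show ?case using polyfun_add[of "f a" "\<lambda>t. \<Sum>i\<in>A. f i t"] by simp
qed (use polyfun_const[of 0] in simp_all)

lemma bracket_zero_left: "bracket 0 M = 0" and bracket_one_left: "bracket (mat 1) M = 0"
  by (simp_all add: bracket_def matrix_mult_simps)

lemma bracket_sum_left: "bracket (\<Sum>i\<in>A. f i) M = (\<Sum>i\<in>A. bracket (f i) M)"
  by (induction A rule: infinite_finite_induct) (simp_all add: bracket_zero_left bracket_linear)

lemma cscale_sum: "cscale c (\<Sum>i\<in>A. f i) = (\<Sum>i\<in>A. cscale c (f i))"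
  by (rule cmat.scale_sum_right)

context index_system
begin

lemma orbit_Ad:
  fixes g Y :: "'n cmat"
  assumes "invertible g" "Y \<in> orbit_of_type lam" shows "Ad g Y \<in> orbit_of_type lam"
proof -
  obtain p where p: "invertible p" "Y = Ad p X" using assms(2) by (auto simp: orbit_of_type_eq)
  then have "Ad g Y = Ad (g ** p) X" by (simp add: Ad_mult assms(1))
  then show ?thesis using invertible_mult[OF assms(1) p(1)] by (auto simp: orbit_of_type_eq)
qed

text \<open>The equation \<open>G X = (X + t M) G\<close> is solved by the formal series \<open>1 + \<Sum>\<^sub>j t\<^sup>j\<^sup>+\<^sup>1 u\<^sub>j\<close> with
  \<open>[u\<^sub>j, X] = v\<^sub>j\<close> and \<open>v\<^sub>j\<^sub>+\<^sub>1 = M u\<^sub>j\<close>; a linear relation between the \<open>v\<^sub>j\<close> allows it to be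
  truncated to a polynomial in \<open>t\<close>.\<close>

lemma finite_not_in_orbit:
  assumes M: "M \<in> I"
  shows "finite {t. X + cscale t M \<notin> orbit_of_type lam}"
proof -
  define pick where "pick V = (SOME Y. Y \<in> upper \<and> bracket Y X = V)" for V
  have pick: "pick V \<in> upper \<and> bracket (pick V) X = V" if "V \<in> I" for V
    unfolding pick_def by (rule someI_ex) (use that I_subset_Z in \<open>auto simp: Z_def\<close>)
  define v where "v i = ((\<lambda>V. M ** pick V) ^^ i) M" for i
  define u where "u i = pick (v i)" for i
  have vI: "v i \<in> I" for i
    by (induction i) (use M pick upper_mult_I in \<open>simp_all add: v_def\<close>)
  have v0: "v 0 = M" and vS: "M ** u i = v (Suc i)" for i by (simp_all add: v_def u_def)
  have bu: "bracket (u i) X = v i" for i using pick[OF vI] by (simp add: u_def)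
  obtain N c where N: "v N = (\<Sum>i<N. c i *\<^sub>R v i)" by (rule sequence_dependent)
  define d where "d i = (if i = N then 1 else - complex_of_real (c i))" for i
  have rel: "(\<Sum>i\<le>N. cscale (d i) (v i)) = 0"
  proof -
    have "(\<Sum>i\<le>N. cscale (d i) (v i)) = v N + (\<Sum>i<N. cscale (d i) (v i))"
      unfolding lessThan_Suc_atMost[symmetric] by (simp add: d_def add.commute)
    also have "(\<Sum>i<N. cscale (d i) (v i)) = (\<Sum>i<N. - (c i *\<^sub>R v i))"
      by (rule sum.cong) (simp_all add: d_def scaleR_eq_cscale)
    finally show ?thesis using N by (simp add: sum_negf)
  qed
  \<comment> \<open>The i-th partial sum of the series fails the equation exactly by
    \<open>t^(i+1) v_i\<close>. Weighted with \<open>d i * t^(N - i)\<close> the errors become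
    \<open>t^(N+1)\<close> times the vanishing combination of the \<open>v i\<close>. Only the term
    \<open>i = N\<close> survives at \<open>t = 0\<close>, and \<open>d N = 1\<close>, so
    \<open>G 0\<close> is the identity.\<close>
  define G where "G t = (\<Sum>i\<le>N. cscale (d i * t ^ (N - i)) (mat 1 + (\<Sum>j<i. cscale (t ^ Suc j) (u j))))" for t
  have comm: "bracket (G t) X = cscale t (M ** G t)" for t
  proof -
    let ?s = "\<lambda>i. \<Sum>j<i. cscale (t ^ Suc j) (v j)"
    have 1: "bracket (G t) X = (\<Sum>i\<le>N. cscale (d i * t ^ (N - i)) (?s i))"
      unfolding G_def bracket_sum_left bracket_linear bracket_one_left bu by simp
    have 2: "cscale t (M ** (mat 1 + (\<Sum>j<i. cscale (t ^ Suc j) (u j)))) = ?s (Suc i)" for i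
      unfolding sum.lessThan_Suc_shift
      by (simp add: matrix_mult_simps matrix_mult_sum_right cscale_mult vS cscale_sum v0
          cmat.scale_right_distrib del: sum.lessThan_Suc)
    have "cscale t (M ** G t) = (\<Sum>i\<le>N. cscale (d i * t ^ (N - i)) (?s (Suc i)))"
      unfolding G_def matrix_mult_sum_right cscale_sum cscale_mult 2[symmetric]
      by (simp add: mult.commute)
    also have "\<dots> = bracket (G t) X + (\<Sum>i\<le>N. cscale (d i * t ^ (N - i)) (cscale (t ^ Suc i) (v i)))"
      unfolding 1 by (simp add: cmat.scale_right_distrib sum.distrib)
    also have "(\<Sum>i\<le>N. cscale (d i * t ^ (N - i)) (cscale (t ^ Suc i) (v i))) = cscale (t ^ Suc N) (\<Sum>i\<le>N. cscale (d i) (v i))"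
      unfolding cscale_sum
    proof (rule sum.cong[OF refl])
      fix i assume "i \<in> {..N}"
      then have "t ^ (N - i) * t ^ Suc i = t ^ Suc N" by (simp flip: power_add add: Suc_diff_le)
      then have "d i * t ^ (N - i) * t ^ Suc i = t ^ Suc N * d i" by (metis mult.assoc mult.commute)
      then show "cscale (d i * t ^ (N - i)) (cscale (t ^ Suc i) (v i)) = cscale (t ^ Suc N) (cscale (d i) (v i))"
        by simp
    qed
    also have "\<dots> = 0" by (simp add: rel)
    finally show ?thesis by simp
  qed
  have "G 0 = (\<Sum>i\<le>N. if i = N then mat 1 else 0)"
    unfolding G_def by (rule sum.cong) (auto simp: d_def power_0_left)
  then have "det (G 0) \<noteq> 0" by simp
  moreover have "polyfun (\<lambda>t. G t $ a $ b)" for a b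
    unfolding G_def sum_component cscale_nth vector_add_component
    by (intro polyfun_sum polyfun_mult polyfun_add polyfun_const polyfun_power)
  ultimately have "finite {t. det (G t) = 0}" using finite_singular_parameters[of G 0] by blast
  moreover have "{t. X + cscale t M \<notin> orbit_of_type lam} \<subseteq> {t. det (G t) = 0}"
  proof clarify
    fix t assume n: "X + cscale t M \<notin> orbit_of_type lam"
    show "det (G t) = 0"
    proof (rule ccontr)
      assume "det (G t) \<noteq> 0"
      then have inv: "invertible (G t)" by (simp add: invertible_det_nz)
      have "G t ** X = (X + cscale t M) ** G t"
        using comm[of t] by (simp add: bracket_def matrix_mult_simps cscale_mult algebra_simps)
      then have "Ad (G t) X = X + cscale t M" using Ad_eq_iff[OF inv] by blast
      then show False using n inv unfolding orbit_of_type_eq by force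
    qed
  qed
  ultimately show ?thesis by (rule finite_subset[rotated])
qed

text \<open>\<open>A\<close> is the point \<open>t = 1\<close> of a line through \<open>X\<close>;
  the parameters landing in the orbit form a cofinite, hence dense, set.\<close>

lemma I_subset_closure: "I \<subseteq> closure (orbit_of_type lam)"
proof
  fix A assume A: "A \<in> I"
  let ?f = "\<lambda>t. X + cscale t (A - X)"
  let ?F = "{t. ?f t \<notin> orbit_of_type lam}"
  have "finite ?F" by (rule finite_not_in_orbit[OF cmat.subspace_diff[OF subspace_I A X_in_I]])
  then have "closure (- ?F) = UNIV" by (simp add: closure_complement empty_interior_finite)
  moreover have "?f ` closure (- ?F) \<subseteq> closure (orbit_of_type lam)"
  proof (rule image_closure_subset)
    show "continuous_on (closure (- ?F)) ?f" unfolding cscale_def by (intro continuous_intros)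
    show "?f ` (- ?F) \<subseteq> closure (orbit_of_type lam)" using closure_subset by fastforce
  qed simp
  ultimately have "?f 1 \<in> closure (orbit_of_type lam)" by blast
  then show "A \<in> closure (orbit_of_type lam)" by simp
qed

lemma Ad_upper_I: "b \<in> upper \<Longrightarrow> invertible b \<Longrightarrow> A \<in> I \<Longrightarrow> Ad b A \<in> I"
  unfolding Ad_def by (intro upper_mult_I upper_matrix_inv)

text \<open>In \<open>g = u ** b\<close> the triangular factor maps \<open>I\<close> to itself, so
  unitary conjugations suffice; conversely a unitary matrix is rescaled into \<open>SL\<close> by
  \<open>Ad_SL_ex\<close>. Compactness applies to this form.\<close>

lemma saturation_eq: "{Ad g x | g x. g \<in> carrier SL \<and> x \<in> I} = {Y. \<exists>u\<in>unitary_matrices. hadj u ** Y ** u \<in> I}"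
proof (intro equalityI subsetI)
  fix Y assume "Y \<in> {Ad g x | g x. g \<in> carrier SL \<and> x \<in> I}"
  then obtain g x where Y: "Y = Ad g x" "g \<in> carrier SL" "x \<in> I" by blast
  obtain u b where ub: "u \<in> unitary_matrices" "b \<in> upper" "invertible b" "g = u ** b"
    using unitary_upper_decomposition[OF SL_invertible[OF Y(2)]] by blast
  note u = unitary_invertible[OF ub(1)]
  have "Ad (matrix_inv u) Y = Ad b x" 
    unfolding Y ub(4) Ad_mult[OF u(1) ub(3)] by (rule Ad_inv_Ad[OF u(1)])
  moreover have "Ad (matrix_inv u) Y = matrix_inv u ** Y ** u"
    unfolding Ad_def matrix_inv_matrix_inv[OF u(1)] by (rule refl)
  ultimately have "hadj u ** Y ** u \<in> I"
    using Ad_upper_I[OF ub(2,3) Y(3)] by (simp only: u(2))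
  then show "Y \<in> {Y. \<exists>u\<in>unitary_matrices. hadj u ** Y ** u \<in> I}" using ub by blast
next
  fix Y assume "Y \<in> {Y. \<exists>u\<in>unitary_matrices. hadj u ** Y ** u \<in> I}"
  then obtain u where u: "u \<in> unitary_matrices" "hadj u ** Y ** u \<in> I" by blast
  note ui = unitary_invertible[OF u(1)]
  have "Y = Ad u (hadj u ** Y ** u)"
    unfolding Ad_def ui(2)[symmetric] by (simp add: matrix_mul_assoc ui(1) matrix_inv_right_inverse)
  moreover obtain h where h: "h \<in> carrier SL" "Ad h = Ad u" using Ad_SL_ex[OF ui(1)] by blast
  ultimately have "Y = Ad h (hadj u ** Y ** u)" by simp
  then show "Y \<in> {Ad g x | g x. g \<in> carrier SL \<and> x \<in> I}" using u(2) h(1) by blast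
qed

lemma closed_saturation: "closed {Ad g x | g x. g \<in> carrier SL \<and> x \<in> I}"
  unfolding saturation_eq closed_sequential_limits
proof (intro allI impI, elim conjE)
  fix Y :: "nat \<Rightarrow> 'n cmat" and L
  assume "\<forall>n. Y n \<in> {Y. \<exists>u\<in>unitary_matrices. hadj u ** Y ** u \<in> I}" and Y: "Y \<longlonglongrightarrow> L"
  then obtain u where u: "\<And>n. u n \<in> unitary_matrices" "\<And>n. hadj (u n) ** Y n ** u n \<in> I"
    by simp metis
  obtain l r where l: "l \<in> unitary_matrices" "strict_mono r" "(u \<circ> r) \<longlonglongrightarrow> l"
    using compact_unitary u(1) unfolding compact_def by meson
  have Yr: "(\<lambda>n. Y (r n)) \<longlonglongrightarrow> L" using LIMSEQ_subseq_LIMSEQ[OF Y l(2)] by (simp add: comp_def)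
  have ur: "(\<lambda>n. u (r n)) \<longlonglongrightarrow> l" using l(3) by (simp add: comp_def)
  have "(\<lambda>n. hadj (u (r n))) \<longlonglongrightarrow> hadj l"
    unfolding hadj_def using ur by (intro tendsto_intros)
  then have "(\<lambda>n. hadj (u (r n)) ** Y (r n) ** u (r n)) \<longlonglongrightarrow> hadj l ** L ** l"
    using ur Yr by (intro tendsto_intros)
  then have "hadj l ** L ** l \<in> I"
    by (rule closed_sequentially[OF closed_subspace[OF cmat_subspace_imp_subspace[OF subspace_I]], rotated])
      (rule u(2))
  then show "L \<in> {Y. \<exists>u\<in>unitary_matrices. hadj u ** Y ** u \<in> I}" using l(1) by blast
qed

theorem associated_orbit_I: "associated_orbit I (orbit_of_type lam)"
  unfolding associated_orbit_def
proof (intro conjI nilpotent_orbit_of_type equalityI)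
  show "{Ad g x | g x. g \<in> carrier SL \<and> x \<in> I} \<subseteq> closure (orbit_of_type lam)"
  proof clarify
    fix g x :: "'n cmat" assume g: "g \<in> carrier SL" and x: "x \<in> I"
    have "Ad g ` closure (orbit_of_type lam) \<subseteq> closure (orbit_of_type lam)"
    proof (rule image_closure_subset)
      show "continuous_on (closure (orbit_of_type lam)) (Ad g)"
        using continuous_on_Ad[OF continuous_on_id] by simp
      show "Ad g ` orbit_of_type lam \<subseteq> closure (orbit_of_type lam)"
        using orbit_Ad[OF SL_invertible[OF g]] closure_subset by blast
    qed simp
    then show "Ad g x \<in> closure (orbit_of_type lam)" using I_subset_closure x by blast
  qed
  show "closure (orbit_of_type lam) \<subseteq> {Ad g x | g x. g \<in> carrier SL \<and> x \<in> I}"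
    by (rule closure_minimal[OF _ closed_saturation]) (use X_in_I in \<open>auto simp: orbit_of_type_SL\<close>)
qed

end

section \<open>Simultaneous triangularisation\<close>

text \<open>\<open>P\<close> realises the quotient by \<open>W\<close> on a complement, inside the
  same matrix type: a basis of \<open>W\<close> is extended to the whole space and sent to
  0.\<close>

lemma projection_along_subspace:
  fixes W :: "(complex^'n::finite) set"
  assumes "vec.subspace W"
  obtains P :: "'n cmat" where "\<And>w. w \<in> W \<Longrightarrow> P *v w = 0" "\<And>x. x - P *v x \<in> W"
proof -
  obtain B where B: "B \<subseteq> W" "vec.independent B" "W \<subseteq> vec.span B"
    using vec.maximal_independent_subset[of W] by metis
  obtain C where C: "B \<subseteq> C" "vec.independent C" "UNIV \<subseteq> vec.span C"
    using vec.maximal_independent_subset_extend[OF subset_UNIV B(2)] by metis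
  obtain f where f: "Vector_Spaces.linear (*s) (*s) f" "\<And>x. x \<in> C \<Longrightarrow> f x = (if x \<in> B then 0 else x)"
    using vec.linear_independent_extend[OF C(2), of "\<lambda>x. if x \<in> B then 0 else x"] by auto
  define P where "P = matrix f"
  have P: "P *v x = f x" for x unfolding P_def using matrix_works[OF f(1)] by simp
  have "P *v w = 0" if "w \<in> W" for w
  proof -
    have "w \<in> vec.span B" using that B by blast
    then have "f w = 0"
    proof (rule vec.span_induct[where P = "\<lambda>w. f w = 0"])
      show "vec.subspace {x. f x = 0}" using f(1)
        by (simp add: vec.subspace_def vec.linear_0 vec.linear_add vec.linear_scale)
    qed (use f(2) C(1) in auto)
    then show ?thesis by (simp add: P)
  qed
  moreover have "x - P *v x \<in> W" for x
  proof -
    have "x \<in> vec.span C" using C(3) by blast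
    then show ?thesis unfolding P
    proof (rule vec.span_induct[where P = "\<lambda>x. x - f x \<in> W"])
      show "vec.subspace {x. x - f x \<in> W}"
        unfolding vec.subspace_def mem_Collect_eq
      proof (intro conjI ballI allI impI)
        show "0 - f 0 \<in> W" using vec.subspace_0[OF assms] by (simp add: vec.linear_0[OF f(1)])
      next
        fix x y assume "x \<in> {x. x - f x \<in> W}" "y \<in> {x. x - f x \<in> W}"
        then have "(x - f x) + (y - f y) \<in> W" using vec.subspace_add[OF assms] by blast
        then show "x + y - f (x + y) \<in> W" by (simp add: vec.linear_add[OF f(1)] algebra_simps)
      next
        fix c x assume "x \<in> {x. x - f x \<in> W}"
        then have "c *s (x - f x) \<in> W" using vec.subspace_scale[OF assms] by blast
        then show "c *s x - f (c *s x) \<in> W"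
          by (simp add: vec.linear_scale[OF f(1)] vec.scale_right_diff_distrib)
      qed
    next
      fix x assume "x \<in> C"
      then show "x - f x \<in> W" using f(2) B(1) vec.subspace_0[OF assms] by auto
    qed
  qed
  ultimately show ?thesis using that by blast
qed

text \<open>\<open>Lie_Kolchin_eigenvector\<close> for the quotient of \<open>U\<close> by
  \<open>W\<close>, which lives on the fixed vectors of \<open>P\<close> in \<open>U\<close> with
  the action \<open>P ** \<rho> g\<close>.\<close>

lemma Lie_Kolchin_extend:
  fixes H :: "('n::finite) cmat set"
  assumes H: "subgroup H SL" "connected H" "(derived SL ^^ n) H = {mat 1}" and rep: "rep_on H \<rho> U"
    and W: "vec.subspace W" "W \<subseteq> U" "W \<noteq> U" "\<And>g w. g \<in> H \<Longrightarrow> w \<in> W \<Longrightarrow> \<rho> g *v w \<in> W"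
  shows "\<exists>u\<in>U - W. \<forall>g\<in>H. \<exists>c. \<rho> g *v u - c *s u \<in> W"
proof -
  obtain P :: "'n cmat" where P0: "\<And>w. w \<in> W \<Longrightarrow> P *v w = 0" and PW: "\<And>x. x - P *v x \<in> W"
    using projection_along_subspace[OF W(1)] by blast
  have U: "vec.subspace U" and cont: "continuous_on H \<rho>" and inv: "\<And>g u. g \<in> H \<Longrightarrow> u \<in> U \<Longrightarrow> \<rho> g *v u \<in> U"
    and one: "\<And>u. u \<in> U \<Longrightarrow> \<rho> (mat 1) *v u = u"
    and mult: "\<And>g h u. g \<in> H \<Longrightarrow> h \<in> H \<Longrightarrow> u \<in> U \<Longrightarrow> \<rho> (g ** h) *v u = \<rho> g *v (\<rho> h *v u)"
    using rep by (auto simp: rep_on_def)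
  let ?U = "{u \<in> U. P *v u = u}"
  have PU: "P *v x \<in> ?U" if "x \<in> U" for x
  proof -
    have "x - (x - P *v x) \<in> U" using vec.subspace_diff[OF U that] PW W(2) by blast
    moreover have "P *v (x - P *v x) = 0" using P0 PW by blast
    ultimately show ?thesis by (simp add: matrix_vector_mult_diff_distrib)
  qed
  have comp: "(P ** \<rho> g) *v u = P *v (\<rho> g *v u)" for g u
    by (simp add: matrix_vector_mul_assoc)
  have "rep_on H (\<lambda>g. P ** \<rho> g) ?U"
    unfolding rep_on_def comp
  proof (intro conjI ballI)
    show "vec.subspace ?U" using U unfolding vec.subspace_def
      by (auto simp: matrix_vector_right_distrib matrix_vector_scale)
    show "continuous_on H (\<lambda>g. P ** \<rho> g)" using cont by (intro continuous_intros)
    show "P *v (\<rho> g *v u) \<in> ?U" if "g \<in> H" "u \<in> ?U" for g u using that inv PU by blast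
    show "P *v (\<rho> (mat 1) *v u) = u" if "u \<in> ?U" for u using that one by simp
    fix g h u assume g: "g \<in> H" and h: "h \<in> H" and u: "u \<in> ?U"
    \<comment> \<open>Inserting \<open>P\<close> before \<open>\<rho> g\<close> changes the vector
      by an element of \<open>W\<close>, which \<open>\<rho> g\<close> preserves and
      \<open>P\<close> kills.\<close>
    have "P *v (\<rho> g *v (\<rho> h *v u - P *v (\<rho> h *v u))) = 0" using P0 W(4)[OF g PW] by blast
    then show "P *v (\<rho> (g ** h) *v u) = P *v (\<rho> g *v (P *v (\<rho> h *v u)))"
      using mult[OF g h] u by (simp add: matrix_vector_mult_diff_distrib)
  qed
  moreover have "?U \<noteq> {0}"
  proof -
    obtain x where x: "x \<in> U" "x \<notin> W" using W by blast
    then have "P *v x \<noteq> 0" using PW[of x] by auto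
    then show ?thesis using PU[OF x(1)] by blast
  qed
  ultimately have "\<exists>u\<in>?U. u \<noteq> 0 \<and> (\<forall>g\<in>H. \<exists>c. (P ** \<rho> g) *v u = c *s u)"
    by (rule Lie_Kolchin_eigenvector[OF H])
  then obtain u where u: "u \<in> ?U" "u \<noteq> 0" "\<forall>g\<in>H. \<exists>c. P *v (\<rho> g *v u) = c *s u"
    unfolding comp by blast
  have "u \<notin> W" using P0[of u] u by auto
  moreover have "\<exists>c. \<rho> g *v u - c *s u \<in> W" if "g \<in> H" for g using u(3) that PW[of "\<rho> g *v u"] by metis
  ultimately show ?thesis using u by blast
qed

lemma invertible_cancel:
  fixes A :: "('n::finite) cmat"
  assumes "invertible A" "A *v x = A *v y" shows "x = y"
proof -
  have "matrix_inv A *v (A *v x) = matrix_inv A *v (A *v y)" using assms(2) by simp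
  then show ?thesis using assms(1) by (simp add: matrix_vector_mul_assoc matrix_inv_left_inverse)
qed

definition coord :: "'n set \<Rightarrow> (complex^'n::finite) set" where
  "coord J = {x. \<forall>i. i \<notin> J \<longrightarrow> x $ i = 0}"

text \<open>A full flag whose basis is labelled by \<open>J\<close> itself, so that triangularity
  refers to the order of the indices. Labels are added in increasing order; a proper subset of
  \<open>J\<close> spans too small a space, so the quotient is nonzero and provides the next
  vector.\<close>

lemma Lie_Kolchin_triangular:
  fixes H :: "('n::{finite,wellorder}) cmat set" and J :: "'n set"
  assumes H: "subgroup H SL" "connected H" "(derived SL ^^ n) H = {mat 1}" and rep: "rep_on H \<rho> (coord J)"
  shows "\<exists>q. (\<forall>j\<in>J. q j \<in> coord J) \<and> (\<forall>c. (\<Sum>j\<in>J. c j *s q j) = 0 \<longrightarrow> (\<forall>j\<in>J. c j = 0)) \<and>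
    (\<forall>g\<in>H. \<forall>j\<in>J. \<exists>c. \<rho> g *v q j = (\<Sum>i\<in>{i \<in> J. i \<le> j}. c i *s q i))"
proof -
  let ?P = "\<lambda>A q. (\<forall>j\<in>A. q j \<in> coord J) \<and> (\<forall>c. (\<Sum>j\<in>A. c j *s q j) = 0 \<longrightarrow> (\<forall>j\<in>A. c j = 0)) \<and>
    (\<forall>g\<in>H. \<forall>j\<in>A. \<exists>c. \<rho> g *v q j = (\<Sum>i\<in>{i \<in> A. i \<le> j}. c i *s q i))"
  have sub: "vec.subspace (coord J)" using rep by (simp add: rep_on_def)
  have "A \<subseteq> J \<longrightarrow> (\<exists>q. ?P A q)" if "finite A" for A
    using that
  proof (induction A rule: finite_linorder_max_induct)
    case (insert m A)
    show ?case
    proof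
      assume mA: "insert m A \<subseteq> J"
      then obtain q where q: "?P A q" using insert.IH by auto
      have m: "m \<notin> A" using insert.hyps(2) by auto
      define W where "W = {x. \<exists>c. x = (\<Sum>i\<in>A. c i *s q i)}"
      have "vec.subspace W"
        unfolding vec.subspace_def W_def
      proof (safe)
        show "\<exists>c. 0 = (\<Sum>i\<in>A. c i *s q i)" by (rule exI[of _ "\<lambda>_. 0"]) simp
      next
        fix c d show "\<exists>e. (\<Sum>i\<in>A. c i *s q i) + (\<Sum>i\<in>A. d i *s q i) = (\<Sum>i\<in>A. e i *s q i)"
          by (rule exI[of _ "\<lambda>i. c i + d i"]) (simp add: vec.scale_left_distrib sum.distrib)
      next
        fix c d show "\<exists>e. c *s (\<Sum>i\<in>A. d i *s q i) = (\<Sum>i\<in>A. e i *s q i)"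
          by (rule exI[of _ "\<lambda>i. c * d i"]) (simp add: vec.scale_sum_right)
      qed
      moreover have "W \<subseteq> coord J"
      proof
        fix x assume "x \<in> W"
        then obtain c where x: "x = (\<Sum>i\<in>A. c i *s q i)" by (auto simp: W_def)
        show "x \<in> coord J" unfolding x using q
          by (intro vec.subspace_sum sub vec.subspace_scale) auto
      qed
      moreover have "W \<noteq> coord J"
      proof
        assume e: "W = coord J"
        have "x \<in> vec.span (q ` A)" if xW: "x \<in> W" for x
        proof -
          obtain c where x: "x = (\<Sum>i\<in>A. c i *s q i)" using xW by (auto simp: W_def)
          show ?thesis unfolding x by (intro vec.span_sum vec.span_scale vec.span_base) auto
        qed
        then have "vec.dim W \<le> card (q ` A)"
          using insert.hyps(1) by (intro vec.dim_le_card) auto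
        also have "\<dots> \<le> card A" using insert.hyps(1) by (rule card_image_le)
        also have "\<dots> < card (insert m A)" using insert.hyps(1) m by simp
        also have "\<dots> \<le> card J" using mA by (intro card_mono) auto
        also have "card J = vec.dim (coord J)" unfolding coord_def by (rule dim_substandard_cart[symmetric])
        finally show False using e by simp
      qed
      moreover have "\<rho> g *v w \<in> W" if g: "g \<in> H" and w: "w \<in> W" for g w
      proof -
        obtain c where c: "w = (\<Sum>i\<in>A. c i *s q i)" using w by (auto simp: W_def)
        have "\<rho> g *v q j \<in> W" if jA: "j \<in> A" for j
        proof -
          obtain d where d: "\<rho> g *v q j = (\<Sum>i\<in>{i \<in> A. i \<le> j}. d i *s q i)" using q g jA by blast
          also have "\<dots> = (\<Sum>i\<in>A. (if i \<le> j then d i else 0) *s q i)"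
            using insert.hyps(1) by (intro sum.mono_neutral_cong_left) auto
          finally show ?thesis by (auto simp: W_def)
        qed
        then have "(\<Sum>i\<in>A. c i *s (\<rho> g *v q i)) \<in> W"
          by (intro vec.subspace_sum vec.subspace_scale) (use \<open>vec.subspace W\<close> in auto)
        then show ?thesis unfolding c
          by (simp add: vec.linear_sum[OF matrix_vector_mul_linear_gen] matrix_vector_scale)
      qed
      ultimately obtain u where u: "u \<in> coord J" "u \<notin> W" "\<forall>g\<in>H. \<exists>c. \<rho> g *v u - c *s u \<in> W"
        using Lie_Kolchin_extend[OF H rep, of W] by blast
      let ?q = "q(m := u)"
      have qA: "(\<Sum>j\<in>A. c j *s ?q j) = (\<Sum>j\<in>A. c j *s q j)" for c
        using m by (intro sum.cong) auto
      have "?P (insert m A) ?q"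
      proof (intro conjI allI impI ballI)
        fix j assume "j \<in> insert m A" then show "?q j \<in> coord J" using q u by auto
      next
        fix c j assume c: "(\<Sum>j\<in>insert m A. c j *s ?q j) = 0" and j: "j \<in> insert m A"
        have e: "c m *s u + (\<Sum>j\<in>A. c j *s q j) = 0"
          using c unfolding sum.insert[OF insert.hyps(1) m] qA by simp
        have cm: "c m = 0"
        proof (rule ccontr)
          assume n: "c m \<noteq> 0"
          have "u = (- inverse (c m)) *s (\<Sum>j\<in>A. c j *s q j)"
          proof -
            have "c m *s u = - (\<Sum>j\<in>A. c j *s q j)" using e by (simp add: eq_neg_iff_add_eq_0)
            then have "inverse (c m) *s (c m *s u) = - (inverse (c m) *s (\<Sum>j\<in>A. c j *s q j))" by simp
            then show ?thesis using n by simp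
          qed
          also have "\<dots> \<in> W" by (intro vec.subspace_scale \<open>vec.subspace W\<close>) (auto simp: W_def)
          finally show False using u(2) by simp
        qed
        then have "(\<Sum>j\<in>A. c j *s q j) = 0" using e by simp
        then show "c j = 0" using q cm j by blast
      next
        fix g j assume g: "g \<in> H" and j: "j \<in> insert m A"
        show "\<exists>c. \<rho> g *v ?q j = (\<Sum>i\<in>{i \<in> insert m A. i \<le> j}. c i *s ?q i)"
        proof (cases "j = m")
          case True
          obtain c where "\<rho> g *v u - c *s u \<in> W" using u g by blast
          then obtain d where d: "\<rho> g *v u - c *s u = (\<Sum>i\<in>A. d i *s q i)" by (auto simp: W_def)
          have S: "{i \<in> insert m A. i \<le> j} = insert m A" using insert.hyps(2) True by auto
          have "\<rho> g *v ?q j = (\<Sum>i\<in>insert m A. (d(m := c)) i *s ?q i)"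
          proof -
            have "(\<Sum>i\<in>A. (d(m := c)) i *s ?q i) = (\<Sum>i\<in>A. d i *s q i)"
              using m by (intro sum.cong) auto
            then show ?thesis using True d insert.hyps(1) m by (simp add: algebra_simps)
          qed
          then show ?thesis unfolding S by blast
        next
          case False
          then have jA: "j \<in> A" using j by simp
          then obtain d where d: "\<rho> g *v q j = (\<Sum>i\<in>{i \<in> A. i \<le> j}. d i *s q i)" using q g by blast
          have S: "{i \<in> insert m A. i \<le> j} = {i \<in> A. i \<le> j}" using insert.hyps(2) jA by auto
          have "(\<Sum>i\<in>{i \<in> A. i \<le> j}. d i *s ?q i) = (\<Sum>i\<in>{i \<in> A. i \<le> j}. d i *s q i)"
            using m by (intro sum.cong) auto
          then have "\<rho> g *v ?q j = (\<Sum>i\<in>{i \<in> A. i \<le> j}. d i *s ?q i)" using False d by simp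
          then show ?thesis unfolding S by blast
        qed
      qed
      then show "\<exists>q. ?P (insert m A) q" by (rule exI[of _ ?q])
    qed
  qed simp
  from this[of J] show ?thesis by simp
qed

section \<open>The centraliser\<close>

context index_system
begin

section \<open>Entries of the centraliser along pairs of strings\<close>

definition cent :: "'n cmat set" where "cent = {M. M ** X = X ** M}"

definition len :: "'n \<Rightarrow> nat" where "len a = lam ! str a"

definition ent :: "'n cmat \<Rightarrow> nat \<Rightarrow> int \<Rightarrow> nat \<Rightarrow> int \<Rightarrow> complex" where
  "ent M i k j l = (if D i k \<and> D j l then M $ \<sigma> i k $ \<sigma> j l else 0)"

text \<open>Commuting with \<open>X\<close> makes entries constant when both positions move by 2.
  The value 0 off the strings encodes the boundary condition at the ends.\<close>

lemma cent_shift: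
  assumes "M \<in> cent" "D i k" "D j l"
  shows "ent M i k j (l + 2) = ent M i (k - 2) j l"
proof -
  have "(M ** X) $ \<sigma> i k $ \<sigma> j l = (X ** M) $ \<sigma> i k $ \<sigma> j l" using assms(1) by (simp add: cent_def)
  then show ?thesis using assms(2,3) by (simp add: mult_X_nth X_mult_nth ent_def)
qed

text \<open>The row has fewer steps below it than the column. Moving down with constant entry, the
  row runs off its string while the column is still on its own, and there the entry is 0.\<close>

lemma cent_zero_down:
  assumes "M \<in> cent"
  shows "D i k \<Longrightarrow> D j l \<Longrightarrow> k + int (lam ! i) < l + int (lam ! j) \<Longrightarrow> ent M i k j l = 0"
proof (induction "nat (k + int (lam ! i))" arbitrary: k l rule: less_induct)
  case less
  have D: "D j (l - 2)" using less.prems by (simp add: D_def) presburger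
  have "ent M i k j l = ent M i (k - 2) j (l - 2)"
    using cent_shift[OF assms less.prems(1) D] by simp
  also have "\<dots> = 0"
  proof (cases "D i (k - 2)")
    case True
    show ?thesis by (rule less.hyps) (use less.prems True D in \<open>auto simp: D_def\<close>)
  qed (simp add: ent_def)
  finally show ?case .
qed

lemma cent_zero_up:
  assumes "M \<in> cent"
  shows "D i k \<Longrightarrow> D j l \<Longrightarrow> int (lam ! j) - l < int (lam ! i) - k \<Longrightarrow> ent M i k j l = 0"
proof (induction "nat (int (lam ! j) - l)" arbitrary: k l rule: less_induct)
  case less
  have D: "D i (k + 2)" using less.prems by (simp add: D_def) presburger
  have "ent M i k j l = ent M i (k + 2) j (l + 2)"
    using cent_shift[OF assms D less.prems(2)] by simp
  also have "\<dots> = 0"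
  proof (cases "D j (l + 2)")
    case True
    show ?thesis by (rule less.hyps) (use less.prems True D in \<open>auto simp: D_def\<close>)
  qed (simp add: ent_def)
  finally show ?case .
qed

text \<open>With \<open>wt a \<le> wt b\<close>, shifting downwards works if the string of
  \<open>a\<close> is shorter, upwards if it is longer; at equal lengths the strict inequality of
  the weights is enough.\<close>

lemma cent_zero:
  assumes M: "M \<in> cent" and ab: "wt a < wt b \<or> wt a = wt b \<and> len a \<noteq> len b"
  shows "M $ a $ b = 0"
proof -
  have "ent M (str a) (wt a) (str b) (wt b) = 0"
  proof (cases "len a < len b \<or> wt a < wt b \<and> len a = len b")
    case True
    then show ?thesis using ab by (intro cent_zero_down[OF M]) (auto simp: len_def)
  next
    case False
    then show ?thesis using ab by (intro cent_zero_up[OF M]) (auto simp: len_def)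
  qed
  then show ?thesis by (simp add: ent_def)
qed

definition top :: "'n \<Rightarrow> 'n" where "top a = \<sigma> (str a) (int (len a) - 1)"

lemma D_same_len: "D i k \<Longrightarrow> j < length lam \<Longrightarrow> lam ! i = lam ! j \<Longrightarrow> D j k"
  by (simp add: D_def)

lemma str_less [simp]: "str a < length lam" using D_str_wt[of a] unfolding D_def by blast

lemma D_len: "D (str a) k \<longleftrightarrow> - int (len a) < k \<and> k < int (len a) \<and> odd (k + int (len a))"
  by (simp add: D_def len_def)

lemma D_top [simp]: "D (str a) (int (len a) - 1)"
  using D_str_wt[of a] unfolding D_len by auto

lemma top_simps [simp]: "str (top a) = str a" "wt (top a) = int (len a) - 1" "len (top a) = len a"
proof -
  show s: "str (top a) = str a" unfolding top_def by (rule str_\<sigma>[OF D_top])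
  show "wt (top a) = int (len a) - 1" unfolding top_def by (rule wt_\<sigma>[OF D_top])
  show "len (top a) = len a" unfolding len_def s ..
qed

text \<open>Two equally long strings reach their highest positions simultaneously, so one value
  determines all degree 0 entries of the pair.\<close>

lemma cent_top:
  assumes M: "M \<in> cent" and j: "j < length lam" and e: "lam ! i = lam ! j"
  shows "D i k \<Longrightarrow> M $ \<sigma> i k $ \<sigma> j k = M $ \<sigma> i (int (lam ! i) - 1) $ \<sigma> j (int (lam ! i) - 1)"
proof (induction "nat (int (lam ! i) - k)" arbitrary: k rule: less_induct)
  case less
  show ?case
  proof (cases "k = int (lam ! i) - 1")
    case False
    then have D: "D i (k + 2)" using less.prems by (simp add: D_def) presburger
    have "ent M i (k + 2) j (k + 2) = ent M i k j k"
      using cent_shift[OF M D D_same_len[OF less.prems j e]] by simp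
    then have "M $ \<sigma> i k $ \<sigma> j k = M $ \<sigma> i (k + 2) $ \<sigma> j (k + 2)"
      using D less.prems D_same_len[OF _ j e] by (simp add: ent_def)
    also have "\<dots> = M $ \<sigma> i (int (lam ! i) - 1) $ \<sigma> j (int (lam ! i) - 1)"
      by (rule less.hyps) (use D less.prems in \<open>auto simp: D_def\<close>)
    finally show ?thesis .
  qed simp
qed

text \<open>The projection of the centraliser onto its part of degree 0, a product of full matrix algebras
  indexed by the distinct parts.\<close>

definition deg0 :: "'n cmat \<Rightarrow> 'n cmat" where
  "deg0 M = (\<chi> a b. if wt a = wt b then M $ a $ b else 0)"

text \<open>Degrees add under multiplication and none is negative in the centraliser, so two degrees
  with sum 0 both vanish. This makes the degree 0 part a representation.\<close>

lemma deg0_mult: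
  assumes "M \<in> cent" "N \<in> cent" shows "deg0 (M ** N) = deg0 M ** deg0 N"
proof -
  have "deg0 (M ** N) $ a $ b = (deg0 M ** deg0 N) $ a $ b" for a b
  proof (cases "wt a = wt b")
    case True
    have "M $ a $ c * N $ c $ b = deg0 M $ a $ c * deg0 N $ c $ b" for c
      using cent_zero[OF assms(1), of a c] cent_zero[OF assms(2), of c b] True
      by (cases "wt c" "wt a" rule: linorder_cases) (auto simp: deg0_def)
    then show ?thesis using True by (simp add: deg0_def matrix_mult_nth)
  next
    case False
    have "deg0 M $ a $ c * deg0 N $ c $ b = 0" for c using False by (simp add: deg0_def)
    then have "(deg0 M ** deg0 N) $ a $ b = 0" unfolding matrix_mult_nth by (intro sum.neutral) blast
    then show ?thesis using False by (simp add: deg0_def)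
  qed
  then show ?thesis by (simp add: vec_eq_iff)
qed

lemma deg0_one: "deg0 (mat 1) = mat 1"
  by (simp add: deg0_def vec_eq_iff mat_1_nth)

lemma continuous_on_deg0: "continuous_on S f \<Longrightarrow> continuous_on S (\<lambda>x. deg0 (f x))"
proof -
  assume f: "continuous_on S f"
  have "continuous_on S (\<lambda>x. if wt a = wt b then f x $ a $ b else 0)" for a b
    using f by (cases "wt a = wt b") (auto intro: continuous_intros)
  then show ?thesis unfolding deg0_def by (intro continuous_intros)
qed

text \<open>\<open>coord (tops k)\<close> is the multiplicity space of the Jordan blocks of size
  \<open>k\<close>, to which Lie-Kolchin will be applied.\<close>

definition tops :: "nat \<Rightarrow> 'n set" where "tops k = {a. len a = k \<and> wt a = int k - 1}"

lemma top_in_tops: "top a \<in> tops (len a)" by (simp add: tops_def)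

lemma top_of_tops: "a \<in> tops k \<Longrightarrow> top a = a"
  by (rule str_wt_eqD) (simp_all add: tops_def)

lemma deg0_tops:
  assumes "M \<in> cent" "x \<in> coord (tops k)" shows "deg0 M *v x \<in> coord (tops k)"
proof -
  have "(deg0 M *v x) $ a = 0" if a: "a \<notin> tops k" for a
  proof -
    have "deg0 M $ a $ b * x $ b = 0" for b
    proof (cases "b \<in> tops k")
      case True
      then have "wt a \<noteq> wt b \<or> len a \<noteq> len b" using a by (auto simp: tops_def)
      then show ?thesis using cent_zero[OF assms(1), of a b] by (auto simp: deg0_def)
    qed (use assms(2) in \<open>simp add: coord_def\<close>)
    then have "(\<Sum>b\<in>UNIV. deg0 M $ a $ b * x $ b) = 0" by (intro sum.neutral) blast
    then show ?thesis by (simp add: matrix_vector_mult_def)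
  qed
  then show ?thesis by (simp add: coord_def)
qed

lemma cent_one: "mat 1 \<in> cent" and cent_mult: "M \<in> cent \<Longrightarrow> N \<in> cent \<Longrightarrow> M ** N \<in> cent"
  by (simp add: cent_def) (simp add: cent_def, metis matrix_mul_assoc)

lemma cent_matrix_inv: "M \<in> cent \<Longrightarrow> invertible M \<Longrightarrow> matrix_inv M \<in> cent"
  unfolding cent_def mem_Collect_eq by (metis matrix_mul_assoc matrix_mul_inv_cancel(2,3))

lemma vec_subspace_coord: "vec.subspace (coord J)"
  by (auto simp: vec.subspace_def coord_def)

text \<open>Transports a basis of each space of highest vectors along the strings.\<close>

definition block :: "(nat \<Rightarrow> 'n \<Rightarrow> (complex, 'n) vec) \<Rightarrow> 'n cmat" where
  "block q = (\<chi> a b. if wt a = wt b \<and> len a = len b then q (len b) (top b) $ top a else 0)"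

lemma block_\<sigma>:
  assumes "D i k" "D j l"
  shows "block q $ \<sigma> i k $ \<sigma> j l = (if k = l \<and> lam ! i = lam ! j
    then q (lam ! j) (\<sigma> j (int (lam ! j) - 1)) $ \<sigma> i (int (lam ! i) - 1) else 0)"
proof -
  have s: "str (\<sigma> i k) = i" "str (\<sigma> j l) = j" "wt (\<sigma> i k) = k" "wt (\<sigma> j l) = l"
    using assms by simp_all
  show ?thesis unfolding block_def top_def len_def by (simp only: vec_lambda_beta s)
qed

lemma block_cent: "block q \<in> cent"
proof -
  have "(block q ** X) $ a $ b = (X ** block q) $ a $ b" for a b
  proof -
    obtain i k j l where ab: "a = \<sigma> i k" "b = \<sigma> j l" "D i k" "D j l"
      using \<sigma>_str_wt D_str_wt by metis
    have "D j (l + 2) \<longleftrightarrow> D i (k - 2)" if "k = l + 2" "lam ! i = lam ! j"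
      using that ab(3,4) by (auto simp: D_def)
    then show ?thesis unfolding ab mult_X_nth[OF ab(4)] X_mult_nth[OF ab(3)]
      using ab(3,4) by (auto simp: block_\<sigma>)
  qed
  then show ?thesis by (simp add: cent_def vec_eq_iff)
qed

lemma deg0_block: "deg0 (block q) = block q"
  by (simp add: deg0_def block_def vec_eq_iff)

lemma block_top:
  assumes q: "\<And>k j. j \<in> tops k \<Longrightarrow> q k j \<in> coord (tops k)" and j: "j \<in> tops k"
  shows "block q *v axis j 1 = q k j"
proof -
  have "block q $ a $ j = q k j $ a" for a
  proof (cases "a \<in> tops k")
    case True
    then show ?thesis using j top_of_tops[of a k] top_of_tops[of j k] by (simp add: block_def tops_def)
  next
    case False
    then have "q k j $ a = 0" using q[OF j] by (simp add: coord_def)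
    then show ?thesis using False j by (auto simp: block_def tops_def)
  qed
  then show ?thesis
    by (simp add: vec_eq_iff matrix_vector_mult_def axis_def if_distrib cong: if_cong)
qed

lemma block_invertible:
  assumes q: "\<And>k j. j \<in> tops k \<Longrightarrow> q k j \<in> coord (tops k)"
    and ind: "\<And>k c. (\<Sum>j\<in>tops k. c j *s q k j) = 0 \<Longrightarrow> \<forall>j\<in>tops k. c j = 0"
  shows "invertible (block q)"
proof -
  have "x = 0" if x: "block q *v x = 0" for x
  proof -
    have "x $ b = 0" for b
    proof -
      let ?k = "len b" and ?m = "wt b"
      have Dm: "D (str j) ?m" if "j \<in> tops ?k" for j
        using that D_str_wt[of b] unfolding D_len tops_def by simp
      \<comment> \<open>\<open>dn\<close> moves a highest position down to the weight of
        \<open>b\<close>. The rows and columns at this weight and size carry a copy of the basis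
        \<open>q ?k\<close>, so its independence forces these coordinates of \<open>x\<close> to
        vanish.\<close>
      define dn where "dn j = \<sigma> (str j) ?m" for j
      have dn: "wt (dn j) = ?m" "len (dn j) = ?k" "top (dn j) = j" if "j \<in> tops ?k" for j
        using Dm[OF that] that top_of_tops[OF that] by (auto simp: dn_def len_def tops_def top_def)
      have img: "dn ` tops ?k = {c. wt c = ?m \<and> len c = ?k}"
      proof
        show "dn ` tops ?k \<subseteq> {c. wt c = ?m \<and> len c = ?k}" using dn by auto
        show "{c. wt c = ?m \<and> len c = ?k} \<subseteq> dn ` tops ?k"
        proof clarify
          fix c assume c: "wt c = ?m" "len c = ?k"
          have "c = dn (top c)" unfolding dn_def using c \<sigma>_str_wt[of c] by simp
          then show "c \<in> dn ` tops ?k" using top_in_tops[of c] c by auto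
        qed
      qed
      have inj: "inj_on dn (tops ?k)" by (rule inj_on_inverseI[of _ top]) (rule dn(3))
      have "(\<Sum>j\<in>tops ?k. x $ dn j *s q ?k j) $ t = 0" for t
      proof (cases "t \<in> tops ?k")
        case False
        then show ?thesis using q by (auto simp: sum_component coord_def intro!: sum.neutral)
      next
        case True
        have "(\<Sum>j\<in>tops ?k. x $ dn j * q ?k j $ t) = (\<Sum>j\<in>tops ?k. block q $ dn t $ dn j * x $ dn j)"
          by (rule sum.cong) (use dn True in \<open>auto simp: block_def\<close>)
        also have "\<dots> = (\<Sum>c | wt c = ?m \<and> len c = ?k. block q $ dn t $ c * x $ c)"
          unfolding img[symmetric] by (subst sum.reindex[OF inj]) simp
        also have "\<dots> = (block q *v x) $ dn t"
          unfolding matrix_vector_mult_def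
          by (simp, intro sum.mono_neutral_left) (use dn(1,2)[OF True] in \<open>auto simp: block_def\<close>)
        finally show ?thesis by (simp add: x sum_component)
      qed
      then have "(\<Sum>j\<in>tops ?k. x $ dn j *s q ?k j) = 0" by (simp add: vec_eq_iff)
      then have "x $ dn (top b) = 0" using ind[of "\<lambda>j. x $ dn j" ?k] top_in_tops[of b] by simp
      then show ?thesis by (simp add: dn_def)
    qed
    then show ?thesis by (simp add: vec_eq_iff)
  qed
  then show ?thesis using invertible_left_inverse matrix_left_invertible_ker by blast
qed

text \<open>After transport by \<open>p\<close> the group commutes with \<open>X\<close>.
  Lie-Kolchin on each \<open>coord (tops k)\<close> gives bases that \<open>block\<close> assembles
  into a matrix commuting with \<open>X\<close>; correcting \<open>p\<close> by it keeps
  \<open>Ad p X\<close> and makes the degree 0 part triangular on highest positions. The other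
  entries below the diagonal vanish by \<open>cent_zero\<close> or are carried to the highest
  positions by \<open>cent_top\<close>.\<close>

lemma conjugate_into_upper:
  fixes p :: "'n cmat"
  assumes H: "subgroup H SL" "connected H" "(derived SL ^^ n) H = {mat 1}"
    and p: "invertible p" and HX: "\<And>h. h \<in> H \<Longrightarrow> h ** Ad p X = Ad p X ** h"
  shows "\<exists>g. invertible g \<and> Ad g X = Ad p X \<and> (\<forall>h\<in>H. Ad (matrix_inv g) h \<in> upper \<inter> cent)"
proof -
  let ?c = "\<lambda>h. Ad (matrix_inv p) h"
  note p' = invertible_matrix_inv[OF p]
  have cH: "?c h \<in> cent" if "h \<in> H" for h
  proof -
    have "?c (h ** Ad p X) = ?c (Ad p X ** h)" using HX[OF that] by simp
    then show ?thesis by (simp add: Ad_matrix_mult[OF p'] Ad_inv_Ad[OF p] cent_def)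
  qed
  have rep: "rep_on H (\<lambda>h. deg0 (?c h)) (coord (tops k))" for k
    unfolding rep_on_def
  proof (intro conjI ballI)
    show "continuous_on H (\<lambda>h. deg0 (?c h))" by (intro continuous_on_deg0 continuous_intros)
    show "deg0 (?c (mat 1)) *v u = u" for u by (simp add: Ad_mat_1[OF p'] deg0_one)
    show "deg0 (?c (g ** h)) *v u = deg0 (?c g) *v (deg0 (?c h) *v u)" if "g \<in> H" "h \<in> H" for g h u
      using that cH by (simp add: Ad_matrix_mult[OF p'] deg0_mult matrix_vector_mul_assoc)
  qed (use deg0_tops cH vec_subspace_coord in auto)
  let ?P = "\<lambda>k q. (\<forall>j\<in>tops k. q j \<in> coord (tops k)) \<and>
    (\<forall>c. (\<Sum>j\<in>tops k. c j *s q j) = 0 \<longrightarrow> (\<forall>j\<in>tops k. c j = 0)) \<and>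
    (\<forall>h\<in>H. \<forall>j\<in>tops k. \<exists>c. deg0 (?c h) *v q j = (\<Sum>i\<in>{i \<in> tops k. i \<le> j}. c i *s q i))"
  have "\<exists>q. \<forall>k. ?P k (q k)"
    by (rule choice, rule allI, rule Lie_Kolchin_triangular[OF H rep])
  then obtain q where all: "\<forall>k. ?P k (q k)" by (rule exE)
  have q: "\<And>k j. j \<in> tops k \<Longrightarrow> q k j \<in> coord (tops k)"
    and ind: "\<And>k c. (\<Sum>j\<in>tops k. c j *s q k j) = 0 \<Longrightarrow> \<forall>j\<in>tops k. c j = 0"
    and tri: "\<And>k h j. h \<in> H \<Longrightarrow> j \<in> tops k \<Longrightarrow>
      \<exists>c. deg0 (?c h) *v q k j = (\<Sum>i\<in>{i \<in> tops k. i \<le> j}. c i *s q k i)"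
    using all by simp_all
  let ?Q = "block q"
  have Q: "invertible ?Q" by (rule block_invertible[OF q ind])
  have bt: "?Q *v axis j 1 = q k j" if "j \<in> tops k" for k j
    using q that by (intro block_top)
  have QX: "Ad ?Q X = X" using block_cent[of q] Ad_eq_iff[OF Q] by (simp add: cent_def)
  have "Ad (matrix_inv (p ** ?Q)) h \<in> upper \<inter> cent" if h: "h \<in> H" for h
  proof -
    define N' where "N' = Ad (matrix_inv ?Q) (?c h)"
    have N': "Ad (matrix_inv (p ** ?Q)) h = N'"
      unfolding N'_def by (simp add: matrix_inv_mult p Q Ad_mult p' invertible_matrix_inv)
    have QN: "?Q ** N' = ?c h ** ?Q"
      using Ad_Ad_inv[OF Q, of "?c h"] unfolding N'_def[symmetric] Ad_eq_iff[OF Q] .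
    have "N' \<in> cent" unfolding N'_def Ad_def[of "matrix_inv ?Q"] matrix_inv_matrix_inv[OF Q]
      by (intro cent_mult cent_matrix_inv block_cent cH h Q)
    note N'c = this
    \<comment> \<open>Column \<open>j\<close> of the conjugate on \<open>tops k\<close> is the
      expansion of \<open>deg0 (?c h)\<close> applied to \<open>q k j\<close> in the basis
      \<open>q k\<close>, which involves only labels up to \<open>j\<close>.\<close>
    have key: "N' $ a $ j = 0" if j: "j \<in> tops k" and a: "a \<in> tops k" "j < a" for a j k
    proof -
      obtain c where c: "deg0 (?c h) *v q k j = (\<Sum>i\<in>{i \<in> tops k. i \<le> j}. c i *s q k i)"
        using tri[OF h j] by blast
      have "?Q *v (deg0 N' *v axis j 1) = deg0 (?Q ** N') *v axis j 1"
        by (simp add: matrix_vector_mul_assoc deg0_mult[OF block_cent N'c] deg0_block)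
      also have "\<dots> = deg0 (?c h) *v (?Q *v axis j 1)"
        unfolding QN by (simp add: matrix_vector_mul_assoc deg0_mult[OF cH[OF h] block_cent] deg0_block)
      also have "\<dots> = (\<Sum>i\<in>{i \<in> tops k. i \<le> j}. c i *s (?Q *v axis i 1))"
        unfolding bt[OF j] c by (rule sum.cong) (auto simp: bt)
      also have "\<dots> = ?Q *v (\<Sum>i\<in>{i \<in> tops k. i \<le> j}. c i *s axis i 1)"
        by (simp add: vec.linear_sum[OF matrix_vector_mul_linear_gen] matrix_vector_scale)
      finally have "deg0 N' *v axis j 1 = (\<Sum>i\<in>{i \<in> tops k. i \<le> j}. c i *s axis i 1)"
        by (rule invertible_cancel[OF Q])
      then have "(deg0 N' *v axis j 1) $ a = (\<Sum>i\<in>{i \<in> tops k. i \<le> j}. c i *s axis i 1) $ a"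
        by (rule arg_cong)
      moreover have "(deg0 N' *v axis j 1) $ a = deg0 N' $ a $ j"
        by (simp add: matrix_vector_mult_def axis_def if_distrib cong: if_cong)
      moreover have "(\<Sum>i\<in>{i \<in> tops k. i \<le> j}. c i *s axis i 1) $ a = 0"
        unfolding sum_component by (rule sum.neutral) (use a in \<open>auto simp: axis_def\<close>)
      ultimately have "deg0 N' $ a $ j = 0" by simp
      then show ?thesis using a j by (simp add: deg0_def tops_def)
    qed
    have "N' $ a $ b = 0" if ba: "b < a" for a b
    proof (cases "wt a = wt b \<and> len a = len b")
      case True
      have "N' $ a $ b = N' $ top a $ top b"
      proof -
        have "\<sigma> (str b) (wt a) = b" using True by simp
        moreover have "\<sigma> (str a) (wt b) = a" using True \<sigma>_str_wt[of a] by metis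
        moreover have "N' $ \<sigma> (str a) (wt a) $ \<sigma> (str b) (wt a)
            = N' $ \<sigma> (str a) (int (lam ! str a) - 1) $ \<sigma> (str b) (int (lam ! str a) - 1)"
          by (rule cent_top[OF N'c str_less _ D_str_wt]) (use True in \<open>simp add: len_def\<close>)
        moreover have "int (lam ! str a) - 1 = int (len b) - 1" using True by (simp add: len_def)
        ultimately show ?thesis using True by (simp add: top_def)
      qed
      \<comment> \<open>By (3) two strings are ordered at their highest weights as they are at the
        common weight of \<open>a\<close> and \<open>b\<close>.\<close>
      moreover have "top b < top a"
      proof (rule ccontr)
        assume "\<not> top b < top a"
        then have le: "\<sigma> (str a) (int (len a) - 1) \<le> \<sigma> (str b) (int (len a) - 1)" using True by (simp add: top_def)
        have D: "D (str b) (int (len a) - 1)" "D (str b) (wt a)" using True D_top[of b] D_str_wt[of b] by simp_all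
        have "a \<le> \<sigma> (str b) (wt a)"
          using \<sigma>_le[OF D_top D(1) D_str_wt D(2) le] by simp
        moreover have "\<sigma> (str b) (wt a) = b" using True by simp
        ultimately show False using ba by simp
      qed
      ultimately show ?thesis using key[of "top b" "len b" "top a"] top_in_tops[of a] top_in_tops[of b] True by simp
    next
      case False
      moreover have "wt a \<le> wt b" using wt_mono[of b a] ba by simp
      ultimately have "wt a < wt b \<or> wt a = wt b \<and> len a \<noteq> len b" by linarith
      then show ?thesis by (rule cent_zero[OF N'c])
    qed
    then show ?thesis using N'c unfolding N' by (simp add: upper_def)
  qed
  moreover have "Ad (p ** ?Q) X = Ad p X" by (simp add: Ad_mult p Q QX)
  ultimately show ?thesis using invertible_mult[OF p Q] by blast
qed

end

section \<open>The matrix exponential and Lie algebras\<close>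

lemma cmod_matpow_le:
  fixes A :: "('n::finite) cmat"
  shows "cmod (matpow A k $ i $ j) \<le> (\<Sum>i\<in>UNIV. \<Sum>j\<in>UNIV. cmod (A $ i $ j)) ^ k"
proof (induction k arbitrary: i)
  case 0
  show ?case by (simp add: matpow_0 mat_1_nth)
next
  case (Suc k)
  let ?K = "\<Sum>i\<in>UNIV. \<Sum>j\<in>UNIV. cmod (A $ i $ j)"
  have "cmod (matpow A (Suc k) $ i $ j) \<le> (\<Sum>l\<in>UNIV. cmod (A $ i $ l * matpow A k $ l $ j))"
    unfolding matpow_Suc matrix_mult_nth by (rule norm_sum)
  also have "\<dots> \<le> (\<Sum>l\<in>UNIV. cmod (A $ i $ l) * ?K ^ k)"
    unfolding norm_mult by (intro sum_mono mult_left_mono Suc.IH) simp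
  also have "\<dots> = (\<Sum>l\<in>UNIV. cmod (A $ i $ l)) * ?K ^ k" by (simp add: sum_distrib_right)
  also have "\<dots> \<le> ?K * ?K ^ k"
  proof (rule mult_right_mono)
    show "(\<Sum>l\<in>UNIV. cmod (A $ i $ l)) \<le> ?K"
      by (rule member_le_sum[where f = "\<lambda>i. \<Sum>l\<in>UNIV. cmod (A $ i $ l)"]) (auto intro: sum_nonneg)
  qed (auto intro!: zero_le_power sum_nonneg)
  finally show ?case by simp
qed

text \<open>With a complex parameter \<open>z\<close> the entries of the exponential are everywhere
  convergent power series, from which continuity and the derivative at 0 are read off.\<close>

lemma summable_matpow_entries:
  fixes A :: "('n::finite) cmat"
  shows "summable (\<lambda>k. matpow A k $ i $ j / fact k * z ^ k)"
proof -
  let ?K = "\<Sum>i\<in>UNIV. \<Sum>j\<in>UNIV. cmod (A $ i $ j)"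
  show ?thesis
  proof (rule summable_comparison_test')
    show "summable (\<lambda>k. inverse (fact k) * (?K * cmod z) ^ k)" by (rule summable_exp)
    fix k :: nat
    have "cmod (matpow A k $ i $ j) * cmod z ^ k / fact k \<le> ?K ^ k * cmod z ^ k / fact k"
      by (intro divide_right_mono mult_right_mono cmod_matpow_le) auto
    then show "cmod (matpow A k $ i $ j / fact k * z ^ k) \<le> inverse (fact k) * (?K * cmod z) ^ k"
      by (simp add: norm_mult norm_divide norm_power power_mult_distrib field_simps)
  qed
qed

lemma mexp_sums:
  fixes A :: "('n::finite) cmat"
  shows "(\<lambda>k. (1 / fact k) *\<^sub>R matpow A k) sums mexp A"
proof -
  have "(\<lambda>k. (1 / fact k) *\<^sub>R matpow A k) sums (\<chi> i j. \<Sum>k. matpow A k $ i $ j / fact k)"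
    unfolding sums_def
  proof (intro vec_tendstoI)
    fix i j
    have "(\<lambda>k. matpow A k $ i $ j / fact k) sums (\<Sum>k. matpow A k $ i $ j / fact k)"
      using summable_matpow_entries[of A i j 1] by (simp add: summable_sums)
    moreover have "(\<Sum>k<n. (1 / fact k) *\<^sub>R matpow A k) $ i $ j = (\<Sum>k<n. matpow A k $ i $ j / fact k)" for n
      by (simp add: sum_component scaleR_conv_of_real[where 'a = complex])
    ultimately show "(\<lambda>n. (\<Sum>k<n. (1 / fact k) *\<^sub>R matpow A k) $ i $ j)
        \<longlonglongrightarrow> (\<chi> i j. \<Sum>k. matpow A k $ i $ j / fact k) $ i $ j"
      by (simp add: sums_def)
  qed
  then show ?thesis unfolding mexp_def by (simp add: sums_iff)
qed

lemma mexp_nth: "mexp A $ i $ j = (\<Sum>k. matpow A k $ i $ j / fact k)" for A :: "('n::finite) cmat"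
proof -
  have "(\<lambda>k. ((1 / fact k) *\<^sub>R matpow A k) $ i $ j) sums (mexp A $ i $ j)"
    using mexp_sums[of A] unfolding sums_def
    by (simp only: sum_component[symmetric]) (intro tendsto_intros)
  then show ?thesis by (simp add: sums_iff scaleR_conv_of_real[where 'a = complex])
qed

lemma mexp_in_subspace:
  fixes A :: "('n::finite) cmat"
  assumes S: "subspace S" "mat 1 \<in> S" "\<And>M N. M \<in> S \<Longrightarrow> N \<in> S \<Longrightarrow> M ** N \<in> S" and A: "A \<in> S"
  shows "mexp A \<in> S"
proof -
  have "matpow A k \<in> S" for k by (induction k) (use S A in \<open>auto simp: matpow_0 matpow_Suc\<close>)
  then have "(\<Sum>k<n. (1 / fact k) *\<^sub>R matpow A k) \<in> S" for n
    by (intro subspace_sum subspace_scale S)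
  then show ?thesis
    by (rule closed_sequentially[OF closed_subspace[OF S(1)] _ mexp_sums[of A, unfolded sums_def]])
qed

lemma matpow_scaleR: "matpow (t *\<^sub>R A) k = t ^ k *\<^sub>R matpow A k" for A :: "('n::finite) cmat"
  by (induction k) (simp_all add: matpow_0 matpow_Suc matrix_mult_simps)

lemma mexp_scaleR_nth:
  "mexp (t *\<^sub>R A) $ i $ j = (\<Sum>k. matpow A k $ i $ j / fact k * of_real t ^ k)" for A :: "('n::finite) cmat"
  unfolding mexp_nth matpow_scaleR
  by (rule suminf_cong) (simp add: scaleR_conv_of_real[where 'a = complex])

lemma mexp_zero: "mexp (0 :: ('n::finite) cmat) = mat 1"
proof -
  have "mexp (0 :: 'n cmat) $ i $ j = mat 1 $ i $ j" for i j
    using mexp_scaleR_nth[of 0 "0 :: 'n cmat" i j] powser_zero[of "\<lambda>k. matpow (0 :: 'n cmat) k $ i $ j / fact k"]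
    by (simp add: matpow_0)
  then show ?thesis by (simp add: vec_eq_iff)
qed

lemma continuous_mexp_scaleR: "continuous_on UNIV (\<lambda>t. mexp (t *\<^sub>R A))" for A :: "('n::finite) cmat"
proof -
  have "continuous_on UNIV (\<lambda>t::real. \<Sum>k. matpow A k $ i $ j / fact k * of_real t ^ k)" for i j
  proof -
    have "continuous_on UNIV (\<lambda>z. \<Sum>k. matpow A k $ i $ j / fact k * z ^ k)"
      using isCont_powser_converges_everywhere[OF summable_matpow_entries[of A i j]]
      by (simp add: continuous_at_imp_continuous_on)
    then show ?thesis
      by (rule continuous_on_compose2) (auto intro: continuous_intros)
  qed
  then have "continuous_on UNIV (\<lambda>t. \<chi> i j. mexp (t *\<^sub>R A) $ i $ j)"
    unfolding mexp_scaleR_nth by (intro continuous_intros)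
  then show ?thesis by simp
qed

text \<open>The difference quotients of \<open>mexp\<close> at 0 lie in \<open>S\<close> and
  converge to \<open>A\<close>; a linear subspace is closed.\<close>

lemma mexp_derivative_in_subspace:
  fixes A :: "('n::finite) cmat"
  assumes S: "subspace S" "mat 1 \<in> S" and mexp: "\<And>t. mexp (t *\<^sub>R A) \<in> S"
  shows "A \<in> S"
proof -
  define h where "h m = inverse (of_nat (Suc m) :: real)" for m
  have h: "h \<longlonglongrightarrow> 0" "h m \<noteq> 0" for m
    unfolding h_def by (rule LIMSEQ_inverse_real_of_nat) simp
  let ?y = "\<lambda>m. inverse (h m) *\<^sub>R (mexp (h m *\<^sub>R A) - mat 1)"
  have "?y \<longlonglongrightarrow> A"
  proof (intro vec_tendstoI)
    fix i j
    let ?c = "\<lambda>k. matpow A k $ i $ j / fact k"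
    let ?F = "\<lambda>z. \<Sum>k. ?c k * z ^ k"
    have F0: "?F 0 = mat 1 $ i $ j" using powser_zero[of ?c] by (simp add: matpow_0)
    have "(?F has_field_derivative (\<Sum>n. diffs ?c n * 0 ^ n)) (at 0)"
      by (rule termdiffs_strong_converges_everywhere) (rule summable_matpow_entries)
    moreover have "(\<Sum>n. diffs ?c n * 0 ^ n) = A $ i $ j"
      using powser_zero[of "diffs ?c"] by (simp add: diffs_def matpow_Suc matpow_0)
    ultimately have "(\<lambda>z. (?F (0 + z) - ?F 0) / z) \<midarrow>0\<rightarrow> A $ i $ j"
      by (simp add: DERIV_def)
    moreover have "filterlim (\<lambda>m. complex_of_real (h m)) (at 0) sequentially"
      using tendsto_of_real[OF h(1)] h(2) by (intro filterlim_atI) auto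
    ultimately have "(\<lambda>m. (?F (0 + of_real (h m)) - ?F 0) / of_real (h m)) \<longlonglongrightarrow> A $ i $ j"
      by (rule filterlim_compose)
    moreover have "?y m $ i $ j = (?F (0 + of_real (h m)) - ?F 0) / of_real (h m)" for m
      unfolding F0 using mexp_scaleR_nth[of "h m" A i j]
      by (simp add: scaleR_conv_of_real[where 'a = complex] divide_inverse mult.commute)
    ultimately show "(\<lambda>m. ?y m $ i $ j) \<longlonglongrightarrow> A $ i $ j" by simp
  qed
  moreover have "?y m \<in> S" for m by (intro subspace_scale subspace_diff S mexp)
  ultimately show ?thesis using closed_sequentially[OF closed_subspace[OF S(1)], of ?y A] by simp
qed

lemma mexp_upper_diagonal:
  assumes "A \<in> upper" shows "mexp A $ i $ i = exp (A $ i $ i)"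
proof -
  have "matpow A k \<in> upper \<and> matpow A k $ i $ i = (A $ i $ i) ^ k" for k
  proof (induction k)
    case (Suc k)
    have "A $ i $ l * matpow A k $ l $ i = (if l = i then A $ i $ i * matpow A k $ i $ i else 0)" for l
      using assms Suc by (cases l i rule: linorder_cases) (auto simp: upper_def)
    then have "matpow A (Suc k) $ i $ i = (\<Sum>l\<in>UNIV. if l = i then A $ i $ i * matpow A k $ i $ i else 0)"
      unfolding matpow_Suc matrix_mult_nth by (intro sum.cong[OF refl])
    then have "matpow A (Suc k) $ i $ i = A $ i $ i * matpow A k $ i $ i" by simp
    then show ?case using Suc upper_mult[OF assms] by (simp add: matpow_Suc)
  qed (simp add: matpow_0 mat_1_nth)
  then have "mexp A $ i $ i = (\<Sum>k. (A $ i $ i) ^ k /\<^sub>R fact k)"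
    unfolding mexp_nth by (intro suminf_cong) (simp add: scaleR_conv_of_real divide_inverse mult.commute)
  then show ?thesis by (simp add: exp_def)
qed

lemma det_mexp_upper:
  assumes "A \<in> upper" shows "det (mexp A) = exp (trace A)"
proof -
  have "mexp A \<in> upper"
    by (rule mexp_in_subspace[OF subspace_upper(2) one_upper upper_mult assms])
  then have "det (mexp A) = (\<Prod>i\<in>UNIV. mexp A $ i $ i)"
    by (intro det_upperdiagonal) (simp add: upper_def)
  then show ?thesis by (simp add: mexp_upper_diagonal[OF assms] trace_def exp_sum)
qed

text \<open>\<open>H\<close> may be anything between the identity component and the whole group,
  which covers \<open>upper_borel\<close> and \<open>B1\<close> at once. One inclusion
  differentiates one-parameter subgroups; in the other, such a subgroup is a connected set through 1
  and cannot leave the component.\<close>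

lemma lie_alg_subalgebra:
  fixes S :: "('n::{finite,wellorder}) cmat set"
  assumes S: "subspace S" "mat 1 \<in> S" "\<And>M N. M \<in> S \<Longrightarrow> N \<in> S \<Longrightarrow> M ** N \<in> S" "S \<subseteq> upper"
    and H: "connected_component_set (carrier SL \<inter> S) (mat 1) \<subseteq> H" "H \<subseteq> carrier SL \<inter> S"
  shows "lie_alg H = {Y \<in> S. trace Y = 0}"
proof (intro equalityI subsetI)
  fix Y assume "Y \<in> lie_alg H"
  then have Y: "\<And>t. mexp (t *\<^sub>R Y) \<in> carrier SL \<inter> S" using H(2) by (auto simp: lie_alg_def)
  have YS: "Y \<in> S" by (rule mexp_derivative_in_subspace[OF S(1,2)]) (use Y in auto)
  \<comment> \<open>A single nonzero \<open>t\<close> would leave the multiples of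
    \<open>2 pi i\<close>; all real \<open>t\<close> together can be differentiated at 0.\<close>
  have "exp (t *\<^sub>R trace Y) = 1" for t :: real
  proof -
    have "t *\<^sub>R Y \<in> upper" using YS S(4) subspace_scale[OF subspace_upper(2)] by blast
    from det_mexp_upper[OF this] have "exp (trace (t *\<^sub>R Y)) = 1" using Y[of t] by (simp add: SL_def)
    moreover have "trace (t *\<^sub>R Y) = t *\<^sub>R trace Y" by (simp add: trace_def scaleR_sum_right)
    ultimately show ?thesis by simp
  qed
  then have "((\<lambda>t::real. 1) has_vector_derivative exp (0 *\<^sub>R trace Y) * trace Y) (at 0)"
    using exp_scaleR_has_vector_derivative_right[of "trace Y" 0 UNIV] by simp
  then have "trace Y = 0"
    using vector_derivative_unique_at[OF _ has_vector_derivative_const] by fastforce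
  then show "Y \<in> {Y \<in> S. trace Y = 0}" using YS by simp
next
  fix Y assume "Y \<in> {Y \<in> S. trace Y = 0}"
  then have Y: "Y \<in> S" "trace Y = 0" by auto
  have "mexp (t *\<^sub>R Y) \<in> carrier SL \<inter> S" for t
  proof -
    have tS: "t *\<^sub>R Y \<in> S" using Y(1) by (rule subspace_scale[OF S(1)])
    have "trace (t *\<^sub>R Y) = t *\<^sub>R trace Y" by (simp add: trace_def scaleR_sum_right)
    then have "det (mexp (t *\<^sub>R Y)) = 1" using det_mexp_upper[of "t *\<^sub>R Y"] tS S(4) Y(2) by auto
    then show ?thesis using mexp_in_subspace[OF S(1-3) tS] by (simp add: SL_def)
  qed
  then have "range (\<lambda>t. mexp (t *\<^sub>R Y)) \<subseteq> connected_component_set (carrier SL \<inter> S) (mat 1)"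
    by (intro connected_component_maximal connected_continuous_image continuous_mexp_scaleR connected_UNIV)
      (auto intro: range_eqI[of _ _ 0] simp: mexp_zero)
  then show "Y \<in> lie_alg H" using H(1) by (auto simp: lie_alg_def)
qed

lemma matpow_Ad: "invertible g \<Longrightarrow> matpow (Ad g A) k = Ad g (matpow A k)"
  by (induction k) (simp_all add: matpow_0 matpow_Suc Ad_mat_1 Ad_matrix_mult)

lemma mexp_Ad:
  fixes g A :: "('n::finite) cmat"
  assumes "invertible g" shows "mexp (Ad g A) = Ad g (mexp A)"
proof -
  have "bounded_linear (Ad g)" by (rule linear_conv_bounded_linear[THEN iffD1, OF linear_Ad])
  from bounded_linear.sums[OF this mexp_sums[of A]]
  have "(\<lambda>k. (1 / fact k) *\<^sub>R matpow (Ad g A) k) sums Ad g (mexp A)"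
    by (simp add: matpow_Ad[OF assms] linear_scale[OF linear_Ad])
  then show ?thesis by (rule sums_unique2[OF mexp_sums])
qed

lemma Ad_image_iff:
  assumes "invertible g" shows "Y \<in> Ad g ` H \<longleftrightarrow> Ad (matrix_inv g) Y \<in> H"
  using Ad_Ad_inv[OF assms, of Y] Ad_inv_Ad[OF assms] by (metis imageE image_eqI)

lemma lie_alg_Ad:
  assumes "invertible g" shows "lie_alg (Ad g ` H) = Ad g ` lie_alg H"
proof -
  have "mexp (t *\<^sub>R Y) \<in> Ad g ` H \<longleftrightarrow> mexp (t *\<^sub>R Ad (matrix_inv g) Y) \<in> H" for t Y
    unfolding Ad_image_iff[OF assms] mexp_Ad[OF invertible_matrix_inv[OF assms], symmetric]
      linear_scale[OF linear_Ad] by (rule refl)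
  then have "Y \<in> lie_alg (Ad g ` H) \<longleftrightarrow> Y \<in> Ad g ` lie_alg H" for Y
    unfolding Ad_image_iff[OF assms, of Y "lie_alg H"] unfolding lie_alg_def by simp
  then show ?thesis by blast
qed

section \<open>Dimensions\<close>

definition elem_basis :: "('n::finite) cmat set" where
  "elem_basis = range (\<lambda>(i, j). elem_mat i j)"

lemma finite_dimensional_cmat: "finite_dimensional_vector_space cscale (elem_basis :: ('n::finite) cmat set)"
proof (unfold_locales)
  show fin: "finite (elem_basis :: 'n cmat set)" by (simp add: elem_basis_def)
  have e: "elem_mat i j = elem_mat k l \<longleftrightarrow> i = k \<and> j = l" for i j k l :: 'n
  proof
    assume "elem_mat i j = (elem_mat k l :: 'n cmat)"
    then have "elem_mat i j $ i $ j = (elem_mat k l :: 'n cmat) $ i $ j" by simp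
    then show "i = k \<and> j = l" by (simp add: elem_mat_nth split: if_splits)
  qed simp
  then have inj: "inj (\<lambda>(i, j). elem_mat i j :: 'n cmat)" by (auto simp: inj_def)
  show "cmat.independent (elem_basis :: 'n cmat set)"
    unfolding cmat.independent_explicit_finite_subsets
  proof (intro allI impI ballI)
    fix A :: "'n cmat set" and u v
    assume A: "A \<subseteq> elem_basis" "finite A" and s: "(\<Sum>v\<in>A. cscale (u v) v) = 0" and v: "v \<in> A"
    obtain i j where ij: "v = elem_mat i j" using v A by (auto simp: elem_basis_def)
    have "(\<Sum>w\<in>A. cscale (u w) w) $ i $ j = (\<Sum>w\<in>A. if w = v then u v else 0)"
      unfolding sum_component
    proof (rule sum.cong[OF refl])
      fix w assume "w \<in> A"
      then obtain k l where "w = elem_mat k l" using A by (auto simp: elem_basis_def)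
      then show "cscale (u w) w $ i $ j = (if w = v then u v else 0)"
        using e[of k l i j] by (auto simp: ij elem_mat_nth)
    qed
    then show "u v = 0" using s v A(2) by simp
  qed
  show "cmat.span (elem_basis :: 'n cmat set) = UNIV"
  proof -
    have "M \<in> cmat.span elem_basis" for M :: "'n cmat"
    proof -
      have "(\<Sum>i\<in>UNIV. \<Sum>j\<in>UNIV. cscale (M $ i $ j) (elem_mat i j)) \<in> cmat.span elem_basis"
        by (intro cmat.span_sum cmat.span_scale cmat.span_base) (auto simp: elem_basis_def)
      then show ?thesis by (simp only: matrix_eq_sum_elem_mat[symmetric])
    qed
    then show ?thesis by blast
  qed
qed

interpretation cmat: finite_dimensional_vector_space "cscale :: complex \<Rightarrow> ('n::finite) cmat \<Rightarrow> 'n cmat" elem_basis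
  by (rule finite_dimensional_cmat)

interpretation cmat_pair: finite_dimensional_vector_space_pair
  "cscale :: complex \<Rightarrow> ('n::finite) cmat \<Rightarrow> 'n cmat" elem_basis
  "cscale :: complex \<Rightarrow> 'n cmat \<Rightarrow> 'n cmat" elem_basis
  by unfold_locales

abbreviation clinear :: "(('n::finite) cmat \<Rightarrow> 'n cmat) \<Rightarrow> bool" where
  "clinear \<equiv> Vector_Spaces.linear cscale cscale"

lemma clinearI:
  "(\<And>A B. f (A + B) = f A + f B) \<Longrightarrow> (\<And>c A. f (cscale c A) = cscale c (f A)) \<Longrightarrow> clinear f"
  by unfold_locales

lemma clinear_Ad: "clinear (Ad g)"
  by (rule clinearI) (simp_all add: Ad_add Ad_cscale)

lemma dim_Ad_image: "invertible g \<Longrightarrow> cmat.dim (Ad g ` S) = cmat.dim S"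
  by (rule cmat_pair.dim_image_eq[OF clinear_Ad])
    (rule inj_on_inverseI[of _ "Ad (matrix_inv g)"], rule Ad_inv_Ad)

text \<open>A basis of the kernel in \<open>S\<close> is extended to one of \<open>S\<close>; the
  added vectors span a complement on which \<open>f\<close> is injective.\<close>

lemma rank_nullity:
  assumes S: "cmat.subspace S" and f: "clinear f"
  shows "cmat.dim S = cmat.dim (f ` S) + cmat.dim {x \<in> S. f x = 0}"
proof -
  let ?K = "{x \<in> S. f x = 0}"
  have f0: "f 0 = 0" and fadd: "f (x + y) = f x + f y" and fdiff: "f (x - y) = f x - f y"
    and fscale: "f (cscale c x) = cscale c (f x)" for x y c
    using f by (simp_all add: cmat_pair.linear_0 cmat_pair.linear_add cmat_pair.linear_diff cmat_pair.linear_scale)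
  have K: "cmat.subspace ?K"
    using S by (auto simp: cmat.subspace_def f0 fadd fscale)
  obtain B where B: "B \<subseteq> ?K" "cmat.independent B" "?K \<subseteq> cmat.span B"
    by (rule cmat.maximal_independent_subset)
  have "B \<subseteq> S" using B(1) by auto
  then obtain C where C: "B \<subseteq> C" "C \<subseteq> S" "cmat.independent C" "S \<subseteq> cmat.span C"
    by (rule cmat.maximal_independent_subset_extend[OF _ B(2)])
  let ?T = "cmat.span (C - B)"
  have spB: "cmat.span B = ?K" by (rule subset_antisym[OF cmat.span_minimal[OF B(1) K] B(3)])
  have spC: "cmat.span C = S" by (rule subset_antisym[OF cmat.span_minimal[OF C(2) S] C(4)])
  have finC: "finite C" using C(3) by (rule cmat.finiteI_independent)
  have dK: "cmat.dim ?K = card B" using cmat.dim_span_eq_card_independent[OF B(2)] unfolding spB .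
  have dS: "cmat.dim S = card C" using cmat.dim_span_eq_card_independent[OF C(3)] unfolding spC .
  have iT: "cmat.independent (C - B)" by (rule cmat.independent_mono[OF C(3)]) simp
  then have dT: "cmat.dim ?T = card (C - B)" by (rule cmat.dim_span_eq_card_independent)
  have sum: "{x + y |x y. x \<in> ?K \<and> y \<in> ?T} = S"
    using cmat.span_Un[of B "C - B"] C(1) spB spC by (simp add: Un_absorb1)
  have "cmat.dim S + cmat.dim (?K \<inter> ?T) = cmat.dim ?K + cmat.dim ?T"
    using cmat.dim_sums_Int[OF K cmat.subspace_span, of "C - B"] unfolding sum .
  moreover have "card C = card B + card (C - B)"
    using finC C(1) finite_subset[OF C(1) finC] by (simp add: card_Diff_subset card_mono)
  ultimately have "cmat.dim (?K \<inter> ?T) = 0" using dK dS dT by simp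
  then have KT: "?K \<inter> ?T \<subseteq> {0}" by simp
  have TS: "?T \<subseteq> S" using spC cmat.span_mono[of "C - B" C] by auto
  have inj: "inj_on f ?T"
  proof (rule inj_onI)
    fix x y assume xy: "x \<in> ?T" "y \<in> ?T" "f x = f y"
    then have "x - y \<in> ?T" by (intro cmat.span_diff)
    moreover have "f (x - y) = 0" using xy fdiff by simp
    ultimately have "x - y \<in> ?K \<inter> ?T" using TS by auto
    then show "x = y" using KT by auto
  qed
  have "f ` S = f ` ?T"
  proof
    show "f ` S \<subseteq> f ` ?T"
    proof (rule image_subsetI)
      fix z assume "z \<in> S"
      then have "z \<in> {x + y |x y. x \<in> ?K \<and> y \<in> ?T}" by (simp only: sum)
      then obtain x y where xy: "z = x + y" "f x = 0" "y \<in> ?T" by blast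
      then have "f z = f y" using fadd by simp
      then show "f z \<in> f ` ?T" using xy(3) by simp
    qed
    show "f ` ?T \<subseteq> f ` S" by (rule image_mono[OF TS])
  qed
  then have "cmat.dim (f ` S) = card (C - B)"
    using cmat_pair.dim_image_eq[OF f, of ?T] inj dT by (simp add: cmat.span_span)
  then show ?thesis using dS dK \<open>card C = card B + card (C - B)\<close> by simp
qed

section \<open>Borel subgroups of the centraliser\<close>

lemma SL_Int_subgroup:
  fixes S :: "('n::finite) cmat set"
  assumes S: "subspace S" "mat 1 \<in> S" "\<And>M N. M \<in> S \<Longrightarrow> N \<in> S \<Longrightarrow> M ** N \<in> S"
  shows "subgroup (carrier SL \<inter> S) SL"
  unfolding subgroup_SL_iff
proof (intro conjI ballI)
  fix x :: "'n cmat" assume x: "x \<in> carrier SL \<inter> S"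
  show "matrix_inv x \<in> carrier SL \<inter> S"
    using x matrix_inv_in_subspace[OF S(1,2) SL_invertible S(3)] det_matrix_inv_SL by blast
qed (use S in \<open>auto simp: SL_def det_mul\<close>)

lemma component_subgroup:
  fixes B :: "('n::finite) cmat set"
  assumes B: "subgroup B SL"
  shows "subgroup (connected_component_set B (mat 1)) SL"
proof -
  let ?C = "connected_component_set B (mat 1)"
  have BS: "B \<subseteq> carrier SL" and B1: "mat 1 \<in> B" and Bm: "\<And>x y. x \<in> B \<Longrightarrow> y \<in> B \<Longrightarrow> x ** y \<in> B"
    and Bi: "\<And>x. x \<in> B \<Longrightarrow> matrix_inv x \<in> B"
    using B by (auto simp: subgroup_SL_iff)
  have CB: "?C \<subseteq> B" by (rule connected_component_subset)
  have conn: "connected ?C" by (rule connected_connected_component)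
  have C1: "mat 1 \<in> ?C" using B1 by (simp add: connected_component_refl)
  have "(\<lambda>(a, b). a ** b) ` (?C \<times> ?C) \<subseteq> ?C"
  proof (rule connected_component_maximal)
    show "mat 1 \<in> (\<lambda>(a, b). a ** b) ` (?C \<times> ?C)" using C1 by (intro image_eqI[of _ _ "(mat 1, mat 1)"]) auto
    show "connected ((\<lambda>(a, b). a ** b) ` (?C \<times> ?C))" by (rule connected_mult_image[OF conn conn])
    show "(\<lambda>(a, b). a ** b) ` (?C \<times> ?C) \<subseteq> B" using CB Bm by auto
  qed
  then have "x ** y \<in> ?C" if "x \<in> ?C" "y \<in> ?C" for x y using that by (auto simp: image_subset_iff)
  moreover have "matrix_inv ` ?C \<subseteq> ?C"
  proof (rule connected_component_maximal)
    show "mat 1 \<in> matrix_inv ` ?C" using C1 by (intro image_eqI[of _ _ "mat 1"]) auto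
    show "connected (matrix_inv ` ?C)" by (rule connected_inv_image[OF conn]) (use CB BS in blast)
    show "matrix_inv ` ?C \<subseteq> B" using CB Bi by auto
  qed
  ultimately show ?thesis unfolding subgroup_SL_iff using CB BS C1 by (meson image_subset_iff subset_trans)
qed

section \<open>Solvability of triangular groups\<close>

definition height :: "'n::{finite,wellorder} \<Rightarrow> nat" where "height a = card {b. b < a}"

lemma height_less: "a < b \<Longrightarrow> height a < height (b :: 'n::{finite,wellorder})"
  unfolding height_def by (rule psubset_card_mono) (auto intro: less_trans)

lemma height_le_iff: "height a \<le> height b \<longleftrightarrow> a \<le> (b :: 'n::{finite,wellorder})"
  using height_less[of a b] height_less[of b a] by (cases a b rule: linorder_cases) auto

text \<open>Filtration of the upper triangular matrices by distance from the diagonal: additive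
  under products and zero from \<open>CARD('n)\<close> on.\<close>

definition band :: "nat \<Rightarrow> ('n::{finite,wellorder}) cmat set" where
  "band k = {A. \<forall>a b. A $ a $ b \<noteq> 0 \<longrightarrow> height a + k \<le> height b}"

lemma band_0: "band 0 = upper"
proof -
  have "(A $ a $ b \<noteq> 0 \<longrightarrow> a \<le> b) \<longleftrightarrow> (b < a \<longrightarrow> A $ a $ b = 0)" for A :: "'a cmat" and a b
    by (cases "b < a") auto
  then show ?thesis by (simp add: band_def upper_def height_le_iff)
qed

lemma band_mono: "l \<le> k \<Longrightarrow> band k \<subseteq> band l"
  by (fastforce simp: band_def)

lemma band_mult: "A \<in> band k \<Longrightarrow> B \<in> band l \<Longrightarrow> A ** B \<in> band (k + l)"
proof -
  assume A: "A \<in> band k" and B: "B \<in> band l"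
  have "height a + (k + l) \<le> height b" if nz: "(A ** B) $ a $ b \<noteq> 0" for a b
  proof -
    obtain c where "A $ a $ c * B $ c $ b \<noteq> 0"
      by (rule sum.not_neutral_contains_not_neutral[OF nz[unfolded matrix_mult_nth]]) blast
    then have "height a + k \<le> height c" "height c + l \<le> height b" using A B by (auto simp: band_def)
    then show ?thesis by simp
  qed
  then show ?thesis by (simp add: band_def)
qed

lemma band_diff: "A \<in> band k \<Longrightarrow> B \<in> band k \<Longrightarrow> A - B \<in> band k"
  by (auto simp: band_def) (metis diff_0_right)

lemma band_uminus: "A \<in> band k \<Longrightarrow> - A \<in> band k"
  by (simp add: band_def)

lemma band_add: "A \<in> band k \<Longrightarrow> B \<in> band k \<Longrightarrow> A + B \<in> band k"
  using band_diff[OF _ band_uminus, of A k B] by simp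

lemma band_CARD: "(A :: ('n::{finite,wellorder}) cmat) \<in> band CARD('n) \<Longrightarrow> A = 0"
proof -
  assume A: "A \<in> band CARD('n)"
  have lt: "height b < CARD('n)" for b :: 'n
    unfolding height_def by (rule psubset_card_mono) auto
  have "A $ a $ b = 0" for a b
  proof (rule ccontr)
    assume "A $ a $ b \<noteq> 0"
    then have "height a + CARD('n) \<le> height b" using A by (simp add: band_def)
    then show False using lt[of b] by simp
  qed
  then show ?thesis by (simp add: vec_eq_iff)
qed

text \<open>For \<open>k = 0\<close> all upper triangular matrices, for \<open>k = 1\<close> the
  unipotent ones; the derived series will descend one step at a time.\<close>

definition congruent_one :: "nat \<Rightarrow> ('n::{finite,wellorder}) cmat set" where
  "congruent_one k = {A \<in> upper. A - mat 1 \<in> band k}"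

lemma congruent_one_mult: "A \<in> congruent_one k \<Longrightarrow> B \<in> congruent_one k \<Longrightarrow> A ** B \<in> congruent_one k"
proof -
  assume A: "A \<in> congruent_one k" and B: "B \<in> congruent_one k"
  have "(A - mat 1) ** B \<in> band (k + 0)"
    using A B by (intro band_mult) (auto simp: congruent_one_def band_0)
  then have "(A - mat 1) ** B + (B - mat 1) \<in> band k"
    using B by (intro band_add) (simp_all add: congruent_one_def)
  moreover have "A ** B - mat 1 = (A - mat 1) ** B + (B - mat 1)" by (simp add: matrix_mult_simps)
  ultimately have "A ** B - mat 1 \<in> band k" by (simp only:)
  then show ?thesis using A B by (simp add: congruent_one_def upper_mult)
qed

lemma congruent_one_inv: "A \<in> congruent_one k \<Longrightarrow> invertible A \<Longrightarrow> matrix_inv A \<in> congruent_one k"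
proof -
  assume A: "A \<in> congruent_one k" and i: "invertible A"
  have u: "matrix_inv A \<in> upper" using A i upper_matrix_inv by (auto simp: congruent_one_def)
  have "(A - mat 1) ** matrix_inv A \<in> band (k + 0)"
    using A u by (intro band_mult) (auto simp: congruent_one_def band_0)
  moreover have "matrix_inv A - mat 1 = - ((A - mat 1) ** matrix_inv A)"
    using i by (simp add: matrix_mult_simps matrix_inv_right_inverse)
  ultimately show ?thesis using u band_uminus by (auto simp: congruent_one_def)
qed

text \<open>For \<open>k = 0\<close> the diagonals of \<open>A ** B\<close> and
  \<open>B ** A\<close> agree. For \<open>k > 0\<close> subtracting 1 from both factors leaves
  \<open>A ** B - B ** A\<close> unchanged and puts it into \<open>band (k + k)\<close>. The group
  commutator minus 1 is this difference times an upper triangular matrix.\<close>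

lemma congruent_one_commutator:
  assumes A: "A \<in> congruent_one k" "invertible A" and B: "B \<in> congruent_one k" "invertible B"
  shows "A ** B ** matrix_inv A ** matrix_inv B \<in> congruent_one (Suc k)"
proof -
  have uA: "A \<in> upper" and uB: "B \<in> upper" and A1: "A - mat 1 \<in> band k" and B1: "B - mat 1 \<in> band k"
    using A B by (auto simp: congruent_one_def)
  have iu: "matrix_inv A ** matrix_inv B \<in> upper" using uA uB A B by (intro upper_mult upper_matrix_inv)
  have AB: "A ** B - B ** A \<in> band (Suc k)"
  proof (cases "k = 0")
    case True
    have u: "A ** B - B ** A \<in> upper"
      using subspace_diff[OF subspace_upper(2)] upper_mult uA uB by blast
    have d: "(A ** B) $ i $ i = A $ i $ i * B $ i $ i" if "A \<in> upper" "B \<in> upper" for A B :: "'a cmat" and i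
    proof -
      have "(A ** B) $ i $ i = (\<Sum>l\<in>UNIV. if l = i then A $ i $ i * B $ i $ i else 0)"
        unfolding matrix_mult_nth
      proof (rule sum.cong[OF refl])
        fix l show "A $ i $ l * B $ l $ i = (if l = i then A $ i $ i * B $ i $ i else 0)"
          using that by (cases l i rule: linorder_cases) (auto simp: upper_def)
      qed
      then show ?thesis by simp
    qed
    have "height a + 1 \<le> height b" if nz: "(A ** B - B ** A) $ a $ b \<noteq> 0" for a b
    proof -
      have "\<not> b < a" using nz u by (auto simp: upper_def)
      moreover have "a \<noteq> b" using nz d[OF uA uB, of a] d[OF uB uA, of a] by auto
      ultimately have "a < b" by simp
      then show ?thesis using height_less[of a b] by simp
    qed
    then show ?thesis using True by (simp add: band_def)
  next
    case False
    have "(A - mat 1) ** (B - mat 1) - (B - mat 1) ** (A - mat 1) \<in> band (k + k)"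
      by (intro band_diff band_mult A1 B1)
    moreover have "A ** B - B ** A = (A - mat 1) ** (B - mat 1) - (B - mat 1) ** (A - mat 1)"
      by (simp add: matrix_mult_simps)
    ultimately show ?thesis using band_mono[of "Suc k" "k + k"] False by auto
  qed
  have "(A ** B - B ** A) ** (matrix_inv A ** matrix_inv B) \<in> band (Suc k + 0)"
    using AB iu by (intro band_mult) (simp_all add: band_0)
  moreover have "A ** B ** matrix_inv A ** matrix_inv B - mat 1 = (A ** B - B ** A) ** (matrix_inv A ** matrix_inv B)"
    using A(2) B(2) by (simp add: matrix_mult_simps matrix_mul_assoc matrix_inv_right_inverse)
  moreover have "A ** B ** matrix_inv A ** matrix_inv B \<in> upper"
    using upper_mult[OF upper_mult[OF uA uB] iu] by (simp add: matrix_mul_assoc)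
  ultimately show ?thesis by (simp add: congruent_one_def)
qed

lemma Ad_matrix_inv:
  "invertible g \<Longrightarrow> invertible A \<Longrightarrow> Ad g (matrix_inv A) = matrix_inv (Ad g A)"
  by (rule matrix_inv_unique[symmetric]) (simp add: Ad_matrix_mult[symmetric] matrix_inv_right_inverse Ad_mat_1)

lemma Ad_SL: "invertible g \<Longrightarrow> A \<in> carrier SL \<Longrightarrow> Ad g A \<in> carrier SL"
  by (simp add: SL_def det_Ad)

text \<open>The conjugated filtration \<open>?K\<close> absorbs the derived series, and its term at
  \<open>CARD('n)\<close> is trivial.\<close>

lemma solvable_if_conjugate_upper:
  fixes H :: "('n::{finite,wellorder}) cmat set"
  assumes H: "subgroup H SL" and g: "invertible g" and up: "\<And>h. h \<in> H \<Longrightarrow> Ad g h \<in> upper"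
  shows "solvable (SL\<lparr>carrier := H\<rparr>)"
proof -
  let ?K = "\<lambda>k. {h \<in> carrier SL. Ad g h \<in> congruent_one k}"
  have K: "subgroup (?K k) SL" for k
    unfolding subgroup_SL_iff
  proof (intro conjI ballI)
    show "mat 1 \<in> ?K k" by (simp add: SL_def Ad_mat_1 g congruent_one_def band_def)
    show "x ** y \<in> ?K k" if "x \<in> ?K k" "y \<in> ?K k" for x y
      using that by (simp add: SL_def det_mul Ad_matrix_mult g congruent_one_mult)
    show "matrix_inv x \<in> ?K k" if x: "x \<in> ?K k" for x
    proof -
      have xS: "x \<in> carrier SL" using x by simp
      have "Ad g (matrix_inv x) \<in> congruent_one k"
        unfolding Ad_matrix_inv[OF g SL_invertible[OF xS]]
        by (rule congruent_one_inv) (use x SL_invertible[OF Ad_SL[OF g xS]] in auto)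
      then show ?thesis using det_matrix_inv_SL[OF xS] by simp
    qed
  qed auto
  have "(derived SL ^^ k) H \<subseteq> ?K k" for k
  proof (induction k)
    case 0
    have "Ad g h - mat 1 \<in> upper" if "h \<in> H" for h
      using subspace_diff[OF subspace_upper(2) up[OF that] one_upper] .
    then show ?case using H up by (auto simp: subgroup_SL_iff congruent_one_def band_0)
  next
    case (Suc k)
    have "derived SL (?K k) \<subseteq> ?K (Suc k)"
      unfolding derived_def
    proof (rule SL.generate_subgroup_incl[OF _ K])
      have KS: "?K k \<subseteq> carrier SL" by auto
      show "derived_set SL (?K k) \<subseteq> ?K (Suc k)"
        unfolding derived_set_SL[OF KS]
      proof (rule image_subsetI, clarify)
        fix x y :: "'n cmat" assume x: "x \<in> carrier SL" "Ad g x \<in> congruent_one k"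
          and y: "y \<in> carrier SL" "Ad g y \<in> congruent_one k"
        have inv: "invertible x" "invertible y" "invertible (Ad g x)" "invertible (Ad g y)"
          using x y Ad_SL[OF g] SL_invertible by blast+
        have "Ad g (x ** y ** matrix_inv x ** matrix_inv y) \<in> congruent_one (Suc k)"
          using congruent_one_commutator[OF x(2) inv(3) y(2) inv(4)]
          by (simp add: Ad_matrix_mult g Ad_matrix_inv inv)
        moreover have "x ** y ** matrix_inv x ** matrix_inv y \<in> carrier SL"
          using x(1) y(1) det_matrix_inv_SL[OF x(1)] det_matrix_inv_SL[OF y(1)] by (simp add: SL_def det_mul)
        ultimately show "x ** y ** matrix_inv x ** matrix_inv y \<in> carrier SL \<and>
            Ad g (x ** y ** matrix_inv x ** matrix_inv y) \<in> congruent_one (Suc k)" by simp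
      qed
    qed
    moreover have "(derived SL ^^ Suc k) H \<subseteq> derived SL (?K k)"
      using SL.mono_derived[OF Suc.IH] by simp
    ultimately show ?case by (rule subset_trans[rotated])
  qed
  then have sub: "(derived SL ^^ CARD('n)) H \<subseteq> ?K CARD('n)" .
  have "h = mat 1" if "h \<in> (derived SL ^^ CARD('n)) H" for h
  proof -
    have "Ad g h - mat 1 = 0" using sub that by (intro band_CARD) (auto simp: congruent_one_def)
    then have "Ad (matrix_inv g) (Ad g h) = Ad (matrix_inv g) (mat 1)" by simp
    then show ?thesis by (simp add: Ad_inv_Ad[OF g] Ad_mat_1 invertible_matrix_inv[OF g])
  qed
  moreover have "mat 1 \<in> (derived SL ^^ CARD('n)) H"
    using subgroup.one_closed[OF SL.exp_of_derived_is_subgroup[OF H]] by simp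
  ultimately have "(derived SL ^^ CARD('n)) H = {mat 1}" by blast
  then show ?thesis using solvable_SL_iff[OF H] by blast
qed

lemma subgroup_Ad_image:
  assumes H: "subgroup H SL" and g: "invertible g"
  shows "subgroup (Ad g ` H) SL"
proof -
  have HS: "H \<subseteq> carrier SL" using H by (simp add: subgroup_SL_iff)
  show ?thesis
    unfolding subgroup_SL_iff
  proof (intro conjI ballI)
    show "Ad g ` H \<subseteq> carrier SL" using HS Ad_SL[OF g] by blast
    show "mat 1 \<in> Ad g ` H" using H Ad_mat_1[OF g] by (metis imageI subgroup_SL_iff)
    show "x ** y \<in> Ad g ` H" if xy: "x \<in> Ad g ` H" "y \<in> Ad g ` H" for x y
    proof -
      obtain a b where ab: "a \<in> H" "b \<in> H" "x = Ad g a" "y = Ad g b" using xy by blast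
      then have "x ** y = Ad g (a ** b)" by (simp add: Ad_matrix_mult g)
      then show ?thesis using ab H by (simp add: subgroup_SL_iff)
    qed
    show "matrix_inv x \<in> Ad g ` H" if x: "x \<in> Ad g ` H" for x
    proof -
      obtain a where a: "a \<in> H" "x = Ad g a" using x by blast
      then have "matrix_inv x = Ad g (matrix_inv a)" using Ad_matrix_inv[OF g SL_invertible, of a] HS by auto
      then show ?thesis using a H by (simp add: subgroup_SL_iff)
    qed
  qed
qed

lemma centralizer_iff: "h \<in> centralizer A \<longleftrightarrow> h \<in> carrier SL \<and> h ** A = A ** h"
  unfolding centralizer_def using Ad_eq_iff[OF SL_invertible, of h A A] by auto

context index_system
begin

section \<open>The Borel subgroups and the value of \<open>m_orbit\<close>\<close>

definition alg :: "'n cmat set" where "alg = upper \<inter> cent"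

lemma alg_props: "subspace alg" "mat 1 \<in> alg" "\<And>M N. M \<in> alg \<Longrightarrow> N \<in> alg \<Longrightarrow> M ** N \<in> alg" "alg \<subseteq> upper"
proof -
  have "subspace cent" by (simp add: subspace_def cent_def matrix_mult_simps)
  then show "subspace alg" unfolding alg_def by (intro subspace_inter subspace_upper)
  show "mat 1 \<in> alg" "alg \<subseteq> upper" by (simp_all add: alg_def cent_one)
  show "M ** N \<in> alg" if "M \<in> alg" "N \<in> alg" for M N
    using that by (simp add: alg_def upper_mult cent_mult)
qed

definition B1 :: "'n cmat set" where "B1 = connected_component_set (carrier SL \<inter> alg) (mat 1)"

lemma B1_subset: "B1 \<subseteq> carrier SL \<inter> alg"
  unfolding B1_def by (rule connected_component_subset)

lemma B1_subgroup: "subgroup B1 SL"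
  unfolding B1_def by (intro component_subgroup SL_Int_subgroup alg_props)

lemma B1_maximal: "connected T \<Longrightarrow> mat 1 \<in> T \<Longrightarrow> T \<subseteq> carrier SL \<inter> alg \<Longrightarrow> T \<subseteq> B1"
  unfolding B1_def by (rule connected_component_maximal)

lemma connected_Ad_image: "connected S \<Longrightarrow> connected (Ad g ` S)"
  using continuous_on_Ad[OF continuous_on_id] by (intro connected_continuous_image) auto

lemma Ad_B1:
  assumes g: "invertible g"
  shows "connected_solvable (Ad g ` B1)" "Ad g ` B1 \<subseteq> centralizer (Ad g X)"
proof -
  have sub: "subgroup (Ad g ` B1) SL" by (rule subgroup_Ad_image[OF B1_subgroup g])
  moreover have "connected (Ad g ` B1)"
    by (rule connected_Ad_image) (simp add: B1_def connected_connected_component)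
  moreover have "solvable (SL\<lparr>carrier := Ad g ` B1\<rparr>)"
  proof (rule solvable_if_conjugate_upper[OF sub invertible_matrix_inv[OF g]])
    fix h assume "h \<in> Ad g ` B1"
    then show "Ad (matrix_inv g) h \<in> upper" using B1_subset alg_props(4) Ad_inv_Ad[OF g] by auto
  qed
  ultimately show "connected_solvable (Ad g ` B1)" by (simp add: connected_solvable_def)
  show "Ad g ` B1 \<subseteq> centralizer (Ad g X)"
  proof (rule image_subsetI)
    fix h assume "h \<in> B1"
    then have h: "h \<in> carrier SL" "h ** X = X ** h" using B1_subset by (auto simp: alg_def cent_def)
    then show "Ad g h \<in> centralizer (Ad g X)"
      by (simp add: centralizer_iff Ad_SL[OF g] Ad_matrix_mult[OF g, symmetric])
  qed
qed

lemma connected_solvable_conjugate: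
  assumes p: "invertible p" and H: "connected_solvable H" "H \<subseteq> centralizer (Ad p X)"
  shows "\<exists>g. invertible g \<and> Ad g X = Ad p X \<and> H \<subseteq> Ad g ` B1"
proof -
  have sub: "subgroup H SL" and conn: "connected H" using H(1) by (auto simp: connected_solvable_def)
  obtain n where n: "(derived SL ^^ n) H = {mat 1}"
    using H(1) solvable_SL_iff[OF sub] by (auto simp: connected_solvable_def)
  have HX: "h ** Ad p X = Ad p X ** h" if "h \<in> H" for h using that H(2) centralizer_iff by blast
  obtain g where g: "invertible g" "Ad g X = Ad p X" and up: "\<And>h. h \<in> H \<Longrightarrow> Ad (matrix_inv g) h \<in> alg"
    using conjugate_into_upper[OF sub conn n p HX] unfolding alg_def by blast
  have "Ad (matrix_inv g) ` H \<subseteq> B1"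
  proof (rule B1_maximal)
    show "connected (Ad (matrix_inv g) ` H)" by (rule connected_Ad_image[OF conn])
    have "mat 1 \<in> H" using sub by (simp add: subgroup_SL_iff)
    then show "mat 1 \<in> Ad (matrix_inv g) ` H"
      using Ad_mat_1[OF invertible_matrix_inv[OF g(1)]] by (metis imageI)
    have "H \<subseteq> carrier SL" using sub by (simp add: subgroup_SL_iff)
    then show "Ad (matrix_inv g) ` H \<subseteq> carrier SL \<inter> alg"
      using up Ad_SL[OF invertible_matrix_inv[OF g(1)]] by blast
  qed
  then have "H \<subseteq> Ad g ` B1" using Ad_image_iff[OF g(1)] by blast
  then show ?thesis using g by blast
qed

text \<open>The conjugate of \<open>B1\<close> that contains \<open>H\<close> is connected, solvable
  and in the same centraliser, so maximality of \<open>H\<close> gives equality.\<close>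

lemma borel_subgroup_conjugate:
  assumes p: "invertible p" and H: "borel_subgroup (centralizer (Ad p X)) H"
  shows "\<exists>g. invertible g \<and> H = Ad g ` B1"
proof -
  have H': "connected_solvable H" "H \<subseteq> centralizer (Ad p X)"
    and max: "\<And>K. K \<subseteq> centralizer (Ad p X) \<Longrightarrow> connected_solvable K \<Longrightarrow> H \<subseteq> K \<Longrightarrow> K = H"
    using H by (auto simp: borel_subgroup_def)
  obtain g where g: "invertible g" "Ad g X = Ad p X" "H \<subseteq> Ad g ` B1"
    using connected_solvable_conjugate[OF p H'] by blast
  have "Ad g ` B1 = H" by (rule max) (use Ad_B1[OF g(1)] g in auto)
  then show ?thesis using g(1) by blast
qed

text \<open>Conjugation by \<open>g\<close> preserves the dimension of the linear span of \<open>B1\<close>, so \<open>B1\<close> cannot be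
  properly contained in one of its conjugates.\<close>

lemma B1_not_enlarged:
  assumes g: "invertible g" and sub: "B1 \<subseteq> Ad g ` B1"
  shows "Ad g ` B1 = B1"
proof -
  have "span B1 \<subseteq> span (Ad g ` B1)" by (rule span_mono[OF sub])
  moreover have "dim (span (Ad g ` B1)) \<le> dim (span B1)"
    using dim_image_le[OF linear_Ad, of g B1] by simp
  ultimately have eq: "span B1 = span (Ad g ` B1)"
    by (intro subspace_dim_equal subspace_span)
  have "span B1 \<subseteq> alg" using B1_subset alg_props(1) by (intro span_minimal) auto
  then have "Ad g ` B1 \<subseteq> alg" unfolding eq by (rule subset_trans[OF span_superset])
  moreover have "connected (Ad g ` B1)"
    by (rule connected_Ad_image) (simp add: B1_def connected_connected_component)
  moreover have "Ad g ` B1 \<subseteq> carrier SL" "mat 1 \<in> Ad g ` B1"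
    using subgroup_Ad_image[OF B1_subgroup g] by (simp_all add: subgroup_SL_iff)
  ultimately have "Ad g ` B1 \<subseteq> B1" by (intro B1_maximal) auto
  then show ?thesis using sub by (rule subset_antisym)
qed

text \<open>A connected solvable subgroup containing \<open>B1\<close> lies in a conjugate of
  \<open>B1\<close>, which equals \<open>B1\<close> by \<open>B1_not_enlarged\<close>. The Borel
  subgroup found here makes the integer in \<open>m_orbit\<close> unique.\<close>

lemma borel_subgroup_B1: "borel_subgroup (centralizer X) B1"
  unfolding borel_subgroup_def
proof (intro conjI allI impI)
  have one: "invertible (mat 1 :: 'n cmat)" by (simp add: invertible_det_nz)
  have im: "Ad (mat 1) ` B1 = B1" by simp
  show "B1 \<subseteq> centralizer X" "connected_solvable B1"
    using Ad_B1[OF one] unfolding im by simp_all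
  fix H assume "H \<subseteq> centralizer X \<and> connected_solvable H \<and> B1 \<subseteq> H"
  then have H: "H \<subseteq> centralizer (Ad (mat 1) X)" "connected_solvable H" "B1 \<subseteq> H" by simp_all
  obtain g where g: "invertible g" "H \<subseteq> Ad g ` B1"
    using connected_solvable_conjugate[OF one H(2,1)] by blast
  have "Ad g ` B1 = B1" by (rule B1_not_enlarged[OF g(1) subset_trans[OF H(3) g(2)]])
  then show "H = B1" using g(2) H(3) by simp
qed

lemma lie_alg_B1: "lie_alg B1 = {Y \<in> alg. trace Y = 0}"
  by (rule lie_alg_subalgebra[OF alg_props equalityD2[OF B1_def] B1_subset])

lemma lie_alg_upper_borel: "lie_alg (upper_borel :: 'n cmat set) = b_alg"
proof -
  have B: "(upper_borel :: 'n cmat set) = carrier SL \<inter> upper" by (auto simp: upper_borel_def upper_def)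
  show ?thesis unfolding b_alg_upper B
    by (rule lie_alg_subalgebra[OF subspace_upper(2) one_upper _ order.refl
        connected_component_subset order.refl]) (rule upper_mult)
qed

text \<open>Rank and nullity of bracketing with \<open>X\<close> on \<open>b_alg\<close>: the image
  is \<open>I\<close>, and the kernel is the traceless part of \<open>alg\<close>.\<close>

lemma dim_I: "cmat.dim (b_alg :: 'n cmat set) = cmat.dim I + cmat.dim (lie_alg B1)"
proof -
  have "clinear (\<lambda>Y. bracket Y X)"
    by (rule clinearI) (simp_all add: bracket_linear)
  moreover have "cmat.subspace (b_alg :: 'n cmat set)"
    using subspace_upper(1) unfolding b_alg_upper cmat.subspace_def
    by (auto simp: trace_def sum.distrib sum_distrib_left[symmetric])
  moreover have "{Y \<in> b_alg. bracket Y X = 0} = lie_alg B1"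
    by (auto simp: lie_alg_B1 b_alg_upper alg_def cent_def bracket_def)
  ultimately show ?thesis using rank_nullity[of b_alg "\<lambda>Y. bracket Y X"] by (simp flip: I_eq_bracket_b)
qed

text \<open>Conjugation does not change dimensions, so all Borel subgroups give the same value; a
  competing integer is tested on \<open>X\<close> and \<open>B1\<close>.\<close>

lemma m_orbit_eq: "m_orbit (orbit_of_type lam :: 'n cmat set) = int (cmat.dim I)"
  unfolding m_orbit_def
proof (rule the_equality)
  have dim: "int (cmat.dim I) = int (group_dim (upper_borel :: 'n cmat set)) - int (group_dim B1)"
    unfolding group_dim_def lie_alg_upper_borel dim_I by simp
  show "\<forall>Y\<in>(orbit_of_type lam :: 'n cmat set). \<forall>H. borel_subgroup (centralizer Y) H \<longrightarrow>
      int (cmat.dim I) = int (group_dim (upper_borel :: 'n cmat set)) - int (group_dim H)"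
  proof (intro ballI allI impI)
    fix Y :: "'n cmat" and H assume "Y \<in> orbit_of_type lam" and H: "borel_subgroup (centralizer Y) H"
    then obtain p where p: "invertible p" "Y = Ad p X" by (auto simp: orbit_of_type_eq)
    obtain g where g: "invertible g" "H = Ad g ` B1"
      using borel_subgroup_conjugate[OF p(1)] H unfolding p(2) by blast
    have "group_dim H = group_dim B1"
      unfolding group_dim_def g(2) lie_alg_Ad[OF g(1)] by (rule dim_Ad_image[OF g(1)])
    then show "int (cmat.dim I) = int (group_dim (upper_borel :: 'n cmat set)) - int (group_dim H)"
      using dim by simp
  qed
  fix m :: int
  assume m: "\<forall>Y\<in>(orbit_of_type lam :: 'n cmat set). \<forall>H. borel_subgroup (centralizer Y) H \<longrightarrow>
      m = int (group_dim (upper_borel :: 'n cmat set)) - int (group_dim H)"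
  have "X = Ad (mat 1) X" "invertible (mat 1 :: 'n cmat)" by (simp_all add: invertible_det_nz)
  then have "X \<in> orbit_of_type lam" unfolding orbit_of_type_eq by blast
  then show "m = int (cmat.dim I)" using m borel_subgroup_B1 dim by simp
qed

end

theorem proposition3p5:
  fixes lam :: "nat list" and \<sigma> :: "nat \<Rightarrow> int \<Rightarrow> 'n::{finite,wellorder}"
  assumes "is_partition lam CARD('n)"
    and "index_maps lam \<sigma>"
  shows "associated_orbit (generated_ideal (root_set lam \<sigma>)) (orbit_of_type lam)
    \<and> int (cmat.dim (generated_ideal (root_set lam \<sigma>)))
        = m_orbit (orbit_of_type lam :: ('n cmat) set)"
proof -
  interpret index_system lam \<sigma> using assms by unfold_locales
  show ?thesis
    using associated_orbit_I m_orbit_eq by (simp add: generated_ideal_eq_I)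
qed

end
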